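(* Let $q\in(-1,0)\cup(0,1)$. The Haar state, the counit, and the idempotent states induced by the quantum subgroups $U(1)$ and $\mathbb{Z}_n$, $2\le n<\infty$, are the only idempotent states on $SU_q(2)$.
   Context: $\mathrm{Pol}(SU_q(2))$ is the $*$-bialgebra generated by $\alpha,\gamma$ with relations $\alpha\gamma=q\gamma\alpha$, $\alpha\gamma^*=q\gamma^*\alpha$, $\gamma^*\gamma=\gamma\gamma^*$, $\gamma^*\gamma+\alpha^*\alpha=1$, $\alpha\alpha^*-\alpha^*\alpha=(1-q^2)\gamma^*\gamma$, coproduct $\Delta(\alpha)=\alpha\otimes\alpha-q\gamma^*\otimes\gamma$, $\Delta(\gamma)=\gamma\otimes\alpha+\alpha^*\otimes\gamma$, counit $\varepsilon(\alpha)=1$, $\varepsilon(\gamma)=0$. $C(SU_q(2))$ is its universal enveloping $C^*$-algebra with $\Delta$, $\varepsilon$ extended; for $q\ne0$ it is a compact quantum group. Its Haar state is the unique state $h$ with $(h\otimes\mathrm{id})\Delta(x)=(\mathrm{id}\otimes h)\Delta(x)=h(x)1$. A state $\phi$ on $C(SU_q(2))$ is idempotent if $(\phi\otimes\phi)\circ\Delta=\phi$. $U(1)$ is a quantum subgroup of $SU_q(2)$ via the surjective coproduct-preserving unital $*$-homomorphism $j:C(SU_q(2))\to C(U(1))$, $\alpha\mapsto w$, $\gamma\mapsto0$, where $w$ is the coordinate function on the circle. The closed subgroups $\mathbb{Z}_n\subset U(1)$ ($n$-th roots of unity) are quantum subgroups by composing $j$ with restriction $C(U(1))\to C(\mathbb{Z}_n)$.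 The idempotent state induced by $K=U(1)$ or $K=\mathbb{Z}_n$ is $x\mapsto\int_K j(x)\,d\mu_K$ with $\mu_K$ the normalized Haar measure of $K$. *)

theory Defs
  imports "HOL-Analysis.Analysis" "HOL-Library.Poly_Mapping" "HOL-Library.Nonpos_Ints"
begin

section \<open>Unital C*-algebras\<close>

class cstar_algebra = banach + real_normed_algebra_1 +
  fixes scaleC :: "complex \<Rightarrow> 'a \<Rightarrow> 'a" (infixr "*\<^sub>C" 75)
    and star :: "'a \<Rightarrow> 'a"
  assumes scaleC_of_real: "complex_of_real r *\<^sub>C x = r *\<^sub>R x"
    and scaleC_add_left: "(c + d) *\<^sub>C x = c *\<^sub>C x + d *\<^sub>C x"
    and scaleC_add_right: "c *\<^sub>C (x + y) = c *\<^sub>C x + c *\<^sub>C y"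
    and scaleC_scaleC: "c *\<^sub>C d *\<^sub>C x = (c * d) *\<^sub>C x"
    and scaleC_mult_left: "(c *\<^sub>C x) * y = c *\<^sub>C (x * y)"
    and scaleC_mult_right: "x * (c *\<^sub>C y) = c *\<^sub>C (x * y)"
    and norm_scaleC: "norm (c *\<^sub>C x) = cmod c * norm x"
    and star_star: "star (star x) = x"
    and star_add: "star (x + y) = star x + star y"
    and star_scaleC: "star (c *\<^sub>C x) = cnj c *\<^sub>C star x"
    and star_mult: "star (x * y) = star y * star x"
    and cstar_identity: "norm (star x * x) = (norm x)\<^sup>2"

instantiation complex :: cstar_algebra
begin

definition scaleC_complex :: "complex \<Rightarrow> complex \<Rightarrow> complex"
  where "scaleC_complex c z = c * z"

definition star_complex :: "complex \<Rightarrow> complex"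
  where "star_complex = cnj"

instance
  by standard
    (auto simp: scaleC_complex_def star_complex_def algebra_simps scaleR_conv_of_real
      norm_mult power2_eq_square)

end

definition bounded_clinear :: "('a::cstar_algebra \<Rightarrow> 'b::cstar_algebra) \<Rightarrow> bool"
  where "bounded_clinear f \<longleftrightarrow> bounded_linear f \<and> (\<forall>c x. f (c *\<^sub>C x) = c *\<^sub>C f x)"

(* Boundedness is automatic for *-homomorphisms between C*-algebras. *)
definition star_hom :: "('a::cstar_algebra \<Rightarrow> 'b::cstar_algebra) \<Rightarrow> bool"
  where "star_hom f \<longleftrightarrow> bounded_clinear f \<and> f 1 = 1 \<and>
    (\<forall>x y. f (x * y) = f x * f y) \<and> (\<forall>x. f (star x) = star (f x))"

definition state :: "('a::cstar_algebra \<Rightarrow> complex) \<Rightarrow> bool"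
  where "state \<phi> \<longleftrightarrow> bounded_clinear \<phi> \<and> (\<forall>x. \<phi> (star x * x) \<in> \<real>\<^sub>\<ge>\<^sub>0) \<and> \<phi> 1 = 1"


section \<open>The *-algebra of polynomials on \<open>SU\<^sub>q(2)\<close>\<close>

(* The free unital *-algebra on two generators is the monoid algebra of the words in the
   letters alpha, alpha*, gamma, gamma*. *)
datatype letter = Alpha | Alpha_Star | Gamma | Gamma_Star

datatype letters = Word (letters_of: "letter list")

instantiation letters :: monoid_add
begin

definition "0 = Word []"
definition "u + v = Word (letters_of u @ letters_of v)"

instance
  by standard (auto simp: zero_letters_def plus_letters_def)

end

type_synonym free_alg = "letters \<Rightarrow>\<^sub>0 complex"

abbreviation fconst :: "complex \<Rightarrow> free_alg"
  where "fconst c \<equiv> Poly_Mapping.single 0 c"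

abbreviation fgen :: "letter \<Rightarrow> free_alg"
  where "fgen l \<equiv> Poly_Mapping.single (Word [l]) 1"

fun letter_star :: "letter \<Rightarrow> letter" where
  "letter_star Alpha = Alpha_Star"
| "letter_star Alpha_Star = Alpha"
| "letter_star Gamma = Gamma_Star"
| "letter_star Gamma_Star = Gamma"

definition word_star :: "letters \<Rightarrow> letters"
  where "word_star w = Word (rev (map letter_star (letters_of w)))"

definition fstar :: "free_alg \<Rightarrow> free_alg"
  where "fstar x = (\<Sum>w\<in>Poly_Mapping.keys x.
    Poly_Mapping.single (word_star w) (cnj (Poly_Mapping.lookup x w)))"

definition relators :: "real \<Rightarrow> free_alg set"
  where "relators q =
    (let a = fgen Alpha; a' = fgen Alpha_Star; c = fgen Gamma; c' = fgen Gamma_Star in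
     {a * c - fconst (of_real q) * (c * a),
      a * c' - fconst (of_real q) * (c' * a),
      c' * c - c * c',
      c' * c + a' * a - 1,
      a * a' - a' * a - fconst (of_real (1 - q\<^sup>2)) * (c' * c)})"

(* Pol(SU_q(2)) is the quotient of free_alg by this two-sided *-ideal. *)
inductive_set rel_ideal :: "real \<Rightarrow> free_alg set" for q :: real where
  relator: "r \<in> relators q \<Longrightarrow> r \<in> rel_ideal q"
| add: "x \<in> rel_ideal q \<Longrightarrow> y \<in> rel_ideal q \<Longrightarrow> x + y \<in> rel_ideal q"
| mult_left: "x \<in> rel_ideal q \<Longrightarrow> y * x \<in> rel_ideal q"
| mult_right: "x \<in> rel_ideal q \<Longrightarrow> x * y \<in> rel_ideal q"
| star: "x \<in> rel_ideal q \<Longrightarrow> fstar x \<in> rel_ideal q"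

(* States of Pol(SU_q(2)), as functionals on free_alg vanishing on the ideal. *)
definition pol_state :: "real \<Rightarrow> (free_alg \<Rightarrow> complex) \<Rightarrow> bool"
  where "pol_state q \<phi> \<longleftrightarrow>
    (\<forall>x y. \<phi> (x + y) = \<phi> x + \<phi> y) \<and> (\<forall>c x. \<phi> (fconst c * x) = c * \<phi> x) \<and>
    (\<forall>x\<in>rel_ideal q. \<phi> x = 0) \<and>
    (\<forall>x. \<phi> (fstar x * x) \<in> \<real>\<^sub>\<ge>\<^sub>0) \<and> \<phi> 1 = 1"


section \<open>The universal enveloping C*-algebra\<close>

(* The norm of the universal enveloping C*-algebra: the supremum of the operator norms
   of pi(x) over the *-representations pi on Hilbert spaces.  As every *-representation is a
   direct sum of cyclic ones, and the cyclic ones are the GNS representations of states, pi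
   ranges over GNS representations: pi_phi acts by left multiplication on the algebra itself
   with the (semi-)inner product (y, z) = phi(y* z). *)
definition universal_norm :: "real \<Rightarrow> free_alg \<Rightarrow> real"
  where "universal_norm q x =
    Sup {sqrt (Re (\<phi> (fstar (x * y) * (x * y)))) | \<phi> y. pol_state q \<phi> \<and> \<phi> (fstar y * y) = 1}"

fun eval_letter :: "'a::cstar_algebra \<Rightarrow> 'a \<Rightarrow> letter \<Rightarrow> 'a" where
  "eval_letter \<alpha> \<gamma> Alpha = \<alpha>"
| "eval_letter \<alpha> \<gamma> Alpha_Star = star \<alpha>"
| "eval_letter \<alpha> \<gamma> Gamma = \<gamma>"
| "eval_letter \<alpha> \<gamma> Gamma_Star = star \<gamma>"

definition eval_free :: "'a::cstar_algebra \<Rightarrow> 'a \<Rightarrow> free_alg \<Rightarrow> 'a"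
  where "eval_free \<alpha> \<gamma> x = (\<Sum>w\<in>Poly_Mapping.keys x.
    Poly_Mapping.lookup x w *\<^sub>C prod_list (map (eval_letter \<alpha> \<gamma>) (letters_of w)))"

(* The ambient C*-algebra 'a, with the given elements alpha and gamma, is C(SU_q(2)): it is the
   separated completion of free_alg for the universal seminorm.  The defining relations hold
   because that seminorm vanishes on rel_ideal q. *)
definition is_CSUq2 :: "real \<Rightarrow> 'a::cstar_algebra \<Rightarrow> 'a \<Rightarrow> bool"
  where "is_CSUq2 q \<alpha> \<gamma> \<longleftrightarrow>
    (\<forall>x. norm (eval_free \<alpha> \<gamma> x) = universal_norm q x) \<and>
    closure (range (eval_free \<alpha> \<gamma>)) = UNIV"


section \<open>The spatial tensor product\<close>

(* A list of pairs (a_i, b_i) stands for the sum of the a_i \<otimes> b_i in the algebraic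
   tensor product. *)
type_synonym 'a tensors = "('a \<times> 'a) list"

definition tmult :: "'a::cstar_algebra tensors \<Rightarrow> 'a tensors \<Rightarrow> 'a tensors"
  where "tmult xs ys = [(a * c, b * d). (a, b) \<leftarrow> xs, (c, d) \<leftarrow> ys]"

definition tstar :: "'a::cstar_algebra tensors \<Rightarrow> 'a tensors"
  where "tstar xs = [(star a, star b). (a, b) \<leftarrow> xs]"

definition tfun :: "('a::cstar_algebra \<Rightarrow> complex) \<Rightarrow> ('a \<Rightarrow> complex) \<Rightarrow> 'a tensors \<Rightarrow> complex"
  where "tfun \<phi> \<psi> xs = (\<Sum>(a, b)\<leftarrow>xs. \<phi> a * \<psi> b)"

(* The minimal C*-norm: the supremum over states phi, psi of the operator norm of
   (pi_phi \<otimes> pi_psi)(x), where pi_phi \<otimes> pi_psi is the GNS representation of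
   phi \<otimes> psi. *)
definition spatial_norm :: "'a::cstar_algebra tensors \<Rightarrow> real"
  where "spatial_norm xs =
    Sup {sqrt (Re (tfun \<phi> \<psi> (tmult (tstar (tmult xs ys)) (tmult xs ys)))) | \<phi> \<psi> ys.
      state \<phi> \<and> state \<psi> \<and> tfun \<phi> \<psi> (tmult (tstar ys) ys) = 1}"

(* The C*-algebra 'b, with the bilinear map tens, is the minimal C*-tensor product of 'a
   with itself. *)
definition is_spatial_tensor :: "('a::cstar_algebra \<Rightarrow> 'a \<Rightarrow> 'b::cstar_algebra) \<Rightarrow> bool"
  where "is_spatial_tensor tens \<longleftrightarrow>
    (\<forall>a a' b. tens (a + a') b = tens a b + tens a' b) \<and>
    (\<forall>a b b'. tens a (b + b') = tens a b + tens a b') \<and>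
    (\<forall>c a b. tens (c *\<^sub>C a) b = c *\<^sub>C tens a b) \<and>
    (\<forall>c a b. tens a (c *\<^sub>C b) = c *\<^sub>C tens a b) \<and>
    tens 1 1 = 1 \<and>
    (\<forall>a b a' b'. tens a b * tens a' b' = tens (a * a') (b * b')) \<and>
    (\<forall>a b. star (tens a b) = tens (star a) (star b)) \<and>
    (\<forall>xs. norm (\<Sum>(a, b)\<leftarrow>xs. tens a b) = spatial_norm xs) \<and>
    closure (range (\<lambda>xs. \<Sum>(a, b)\<leftarrow>xs. tens a b)) = UNIV"

(* The continuous linear extension of a \<otimes> b \<mapsto> B a b. *)
definition tensor_lift ::
    "('a::cstar_algebra \<Rightarrow> 'a \<Rightarrow> 'b::cstar_algebra) \<Rightarrow> ('a \<Rightarrow> 'a \<Rightarrow> 'c::cstar_algebra) \<Rightarrow> 'b \<Rightarrow> 'c"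
  where "tensor_lift tens B = (THE F. bounded_clinear F \<and> (\<forall>a b. F (tens a b) = B a b))"


section \<open>Quantum group structure and idempotent states\<close>

definition comult ::
    "real \<Rightarrow> ('a::cstar_algebra \<Rightarrow> 'a \<Rightarrow> 'b::cstar_algebra) \<Rightarrow> 'a \<Rightarrow> 'a \<Rightarrow> 'a \<Rightarrow> 'b"
  where "comult q tens \<alpha> \<gamma> = (THE \<Delta>. star_hom \<Delta> \<and>
    \<Delta> \<alpha> = tens \<alpha> \<alpha> - q *\<^sub>R tens (star \<gamma>) \<gamma> \<and>
    \<Delta> \<gamma> = tens \<gamma> \<alpha> + tens (star \<alpha>) \<gamma>)"

definition counit :: "'a::cstar_algebra \<Rightarrow> 'a \<Rightarrow> 'a \<Rightarrow> complex"
  where "counit \<alpha> \<gamma> = (THE \<epsilon>. star_hom \<epsilon> \<and> \<epsilon> \<alpha> = 1 \<and> \<epsilon> \<gamma> = 0)"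

definition haar_state ::
    "('a::cstar_algebra \<Rightarrow> 'a \<Rightarrow> 'b::cstar_algebra) \<Rightarrow> ('a \<Rightarrow> 'b) \<Rightarrow> 'a \<Rightarrow> complex"
  where "haar_state tens \<Delta> = (THE h. state h \<and>
    (\<forall>x. tensor_lift tens (\<lambda>a b. h a *\<^sub>C b) (\<Delta> x) = h x *\<^sub>C 1 \<and>
         tensor_lift tens (\<lambda>a b. h b *\<^sub>C a) (\<Delta> x) = h x *\<^sub>C 1))"

definition idempotent_state ::
    "('a::cstar_algebra \<Rightarrow> 'a \<Rightarrow> 'b::cstar_algebra) \<Rightarrow> ('a \<Rightarrow> 'b) \<Rightarrow> ('a \<Rightarrow> complex) \<Rightarrow> bool"
  where "idempotent_state tens \<Delta> \<phi> \<longleftrightarrow>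
    state \<phi> \<and> tensor_lift tens (\<lambda>a b. \<phi> a * \<phi> b) \<circ> \<Delta> = \<phi>"

(* The homomorphism j onto C(U(1)).  Continuous functions on the unit circle are
   represented by functions on the plane that vanish off the circle. *)
definition circle_map :: "'a::cstar_algebra \<Rightarrow> 'a \<Rightarrow> 'a \<Rightarrow> complex \<Rightarrow> complex"
  where "circle_map \<alpha> \<gamma> = (THE j.
    (\<forall>x. continuous_on (sphere 0 1) (j x) \<and> (\<forall>w. w \<notin> sphere 0 1 \<longrightarrow> j x w = 0)) \<and>
    (\<forall>w\<in>sphere 0 1. star_hom (\<lambda>x. j x w) \<and> j \<alpha> w = w \<and> j \<gamma> w = 0))"

definition circle_state :: "'a::cstar_algebra \<Rightarrow> 'a \<Rightarrow> 'a \<Rightarrow> complex"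
  where "circle_state \<alpha> \<gamma> x =
    integral {0..2 * pi} (\<lambda>t. circle_map \<alpha> \<gamma> x (cis t)) / of_real (2 * pi)"

definition cyclic_state :: "'a::cstar_algebra \<Rightarrow> 'a \<Rightarrow> nat \<Rightarrow> 'a \<Rightarrow> complex"
  where "cyclic_state \<alpha> \<gamma> n x = (\<Sum>w | w ^ n = 1. circle_map \<alpha> \<gamma> x w) / of_nat n"

end

theory Submission
  imports Defs
begin

text \<open>States of \<open>C(SU\<^sub>q(2))\<close> are determined on words in the generators, and the words of length
  \<open>n\<close> are, up to scalars, the matrix entries \<open>U I J\<close> of the \<open>n\<close>-th tensor power of the
  fundamental corepresentation. An idempotent state \<open>\<phi>\<close> thus amounts to a sequence of
  idempotent matrices \<open>\<phi>(U)\<close>; these are contractive, hence orthogonal projections. Hermitian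
  symmetry means invariance under the antipode \<open>S\<close>; as \<open>S\<^sup>2\<close> rescales \<open>\<gamma>\<close>, \<open>\<phi>(U I J) = 0\<close>
  unless \<open>I\<close> and \<open>J\<close> have the same weight.

  If \<open>\<phi>(\<gamma>\<^sup>*\<gamma>) = 0\<close>, then \<open>\<phi>\<close> lives on the circle and \<open>\<phi>(\<alpha>\<^sup>k)\<close> is the indicator function of a
  subgroup of \<open>\<int>\<close>. Otherwise, a column of the projection \<open>\<phi>(U)\<close> is fixed by \<open>U\<close> modulo the left
  kernel of \<open>\<phi>\<close>; in the row \<open>I = (1, \<dots>, 1)\<close> this puts a multiple of \<open>\<gamma>\<^sup>a (\<alpha>\<^sup>*)\<^sup>b\<close> into that kernel,
  so the multiple is \<open>0\<close>. Modulo shorter words, \<open>U K J\<close> depends on \<open>K\<close> only through its weight and a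
  power \<open>\<theta>(K)\<close> of \<open>q\<close>, and the same powers are the coefficients of this multiple. Hence
  \<open>(\<Sum> \<theta>(K)\<^sup>2) \<phi>(U K J)\<close> is determined by shorter words, and \<open>\<phi>\<close> is unique. A cluster point of the
  Cesaro means of convolution powers gives existence; applied to \<open>(\<rho> + \<phi>)/2\<close> for an arbitrary
  state \<open>\<rho>\<close>, existence and uniqueness show that \<open>\<phi>\<close> absorbs \<open>\<rho>\<close>, so \<open>\<phi>\<close> is the Haar state.\<close>

section \<open>C*-algebras and bounded linear maps\<close>

text \<open>The algebra and its tensor square are known only through norms that are suprema over GNS
  representations of states, and the comultiplication, the counit, the lifts, the Haar state and the
  circle map are definite descriptions. Each must be shown to exist and to be unique before it can
  be used. The two tensor factors interact in the positivity of
  \<open>\<phi> \<otimes> \<psi>\<close>, which rests on the Schur product theorem.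

  Uniqueness depends on constant rows: inside one row of \<open>U\<close> two entries exchange with
  factor \<open>1 / q\<close> and no remainder, so the relation for a fixed column collapses to one
  monomial. Between two rows the exchange also leaves a scalar, hence shorter words. That the factor
  is \<open>1 / q\<close> both times turns the linear relation into a sum of squares, which cannot
  cancel even for negative \<open>q\<close>.

  Existence needs a starting state that is nonzero on \<open>star \<gamma> * \<gamma>\<close>, since
  Cesaro means of a state on the circle stay on the circle. A vector state of an
  infinite-dimensional representation provides it.\<close>

lemma star_one [simp]: "star (1::'a::cstar_algebra) = 1"
  by (metis mult.right_neutral star_mult star_star)

lemma scaleC_one [simp]: "1 *\<^sub>C x = (x::'a::cstar_algebra)"
  using scaleC_of_real[of 1 x] by simp

lemma scaleC_zero_left [simp]: "0 *\<^sub>C x = (0::'a::cstar_algebra)"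
  using scaleC_of_real[of 0 x] by simp

lemma scaleC_zero_right [simp]: "c *\<^sub>C 0 = (0::'a::cstar_algebra)"
  using scaleC_add_right[of c 0 "0::'a"] by simp

lemma scaleC_minus_right [simp]: "c *\<^sub>C (- x) = - (c *\<^sub>C (x::'a::cstar_algebra))"
  using scaleC_add_right[of c x "-x"] by (simp add: eq_neg_iff_add_eq_0 add.commute)

lemma scaleC_minus_left [simp]: "(- c) *\<^sub>C x = - (c *\<^sub>C (x::'a::cstar_algebra))"
  using scaleC_add_left[of c "-c" x] by (simp add: eq_neg_iff_add_eq_0 add.commute)

lemma scaleC_diff_right: "c *\<^sub>C (x - y) = c *\<^sub>C x - c *\<^sub>C (y::'a::cstar_algebra)"
  using scaleC_add_right[of c x "-y"] by simp

lemma scaleC_sum_right: "c *\<^sub>C (\<Sum>i\<in>I. f i) = (\<Sum>i\<in>I. c *\<^sub>C (f i::'a::cstar_algebra))"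
  by (induction I rule: infinite_finite_induct) (auto simp: scaleC_add_right)

lemma scaleC_sum_left: "(\<Sum>i\<in>I. c i) *\<^sub>C x = (\<Sum>i\<in>I. c i *\<^sub>C (x::'a::cstar_algebra))"
  by (induction I rule: infinite_finite_induct) (auto simp: scaleC_add_left)

lemma scaleR_scaleC: "r *\<^sub>R x = complex_of_real r *\<^sub>C (x::'a::cstar_algebra)"
  by (simp add: scaleC_of_real)

lemma star_zero [simp]: "star (0::'a::cstar_algebra) = 0"
  using star_add[of 0 "0::'a"] by simp

lemma star_minus: "star (- x) = - star (x::'a::cstar_algebra)"
  using star_add[of x "-x"] by (simp add: eq_neg_iff_add_eq_0 add.commute)

lemma star_diff: "star (x - y) = star x - star (y::'a::cstar_algebra)"
  using star_add[of x "-y"] by (simp add: star_minus)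

lemma star_sum: "star (\<Sum>i\<in>I. f i) = (\<Sum>i\<in>I. star (f i::'a::cstar_algebra))"
  by (induction I rule: infinite_finite_induct) (auto simp: star_add)

lemma star_scaleR: "star (r *\<^sub>R x) = r *\<^sub>R star (x::'a::cstar_algebra)"
  by (simp add: scaleR_scaleC star_scaleC)

lemma star_power: "star (x ^ n) = star (x::'a::cstar_algebra) ^ n"
  by (induction n) (auto simp: star_mult power_commutes)

lemma norm_star [simp]: "norm (star x) = norm (x::'a::cstar_algebra)"
proof -
  have *: "norm x \<le> norm (star x)" for x :: 'a
  proof (cases "x = 0")
    case False
    have "norm x * norm x \<le> norm (star x) * norm x"
      using cstar_identity[of x] norm_mult_ineq[of "star x" x] by (simp add: power2_eq_square)
    thus ?thesis using False by simp
  qed simp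
  from *[of x] *[of "star x"] show ?thesis by (simp add: star_star)
qed

lemma bounded_linear_star: "bounded_linear (star :: 'a::cstar_algebra \<Rightarrow> 'a)"
  by (rule bounded_linear_intro[where K = 1]) (auto simp: star_add star_scaleR)

lemma bounded_linear_scaleC: "bounded_linear (\<lambda>x::'a::cstar_algebra. c *\<^sub>C x)"
  by (rule bounded_linear_intro[where K = "cmod c"])
     (auto simp: scaleC_add_right scaleR_scaleC scaleC_scaleC norm_scaleC mult.commute)

lemma tendsto_star [tendsto_intros]:
  "(f \<longlongrightarrow> l) F \<Longrightarrow> ((\<lambda>x. star (f x)) \<longlongrightarrow> star (l::'a::cstar_algebra)) F"
  by (rule bounded_linear.tendsto[OF bounded_linear_star])

lemma tendsto_scaleC [tendsto_intros]:
  "(f \<longlongrightarrow> l) F \<Longrightarrow> ((\<lambda>x. c *\<^sub>C f x) \<longlongrightarrow> c *\<^sub>C (l::'a::cstar_algebra)) F"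
  by (rule bounded_linear.tendsto[OF bounded_linear_scaleC])

lemma complex_scaleC [simp]: "c *\<^sub>C z = c * (z::complex)"
  by (simp add: scaleC_complex_def)

lemma complex_star [simp]: "star z = cnj z"
  by (simp add: star_complex_def)

lemma bounded_clinear_linear: "bounded_clinear F \<Longrightarrow> bounded_linear F"
  by (simp add: bounded_clinear_def)

lemma bounded_clinear_simps:
  assumes "bounded_clinear F"
  shows "F (x + y) = F x + F y" "F (c *\<^sub>C x) = c *\<^sub>C F x" "F (x - y) = F x - F y" "F (- x) = - F x"
    "F 0 = 0" "F (\<Sum>i\<in>I. g i) = (\<Sum>i\<in>I. F (g i))"
    "F (\<Sum>i\<leftarrow>xs. h i) = (\<Sum>i\<leftarrow>xs. F (h i))" "F (r *\<^sub>R x) = r *\<^sub>R F x"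
proof -
  interpret bounded_linear F using assms by (rule bounded_clinear_linear)
  show "F (x + y) = F x + F y" "F (x - y) = F x - F y" "F (- x) = - F x"
    "F 0 = 0" "F (\<Sum>i\<in>I. g i) = (\<Sum>i\<in>I. F (g i))" "F (r *\<^sub>R x) = r *\<^sub>R F x"
    by (simp_all add: add diff neg zero sum scaleR)
  show "F (c *\<^sub>C x) = c *\<^sub>C F x" using assms by (simp add: bounded_clinear_def)
  show "F (\<Sum>i\<leftarrow>xs. h i) = (\<Sum>i\<leftarrow>xs. F (h i))"
    by (induction xs) (auto simp: zero add)
qed

lemma bounded_clinear_tendsto:
  "bounded_clinear F \<Longrightarrow> (f \<longlongrightarrow> l) net \<Longrightarrow> ((\<lambda>x. F (f x)) \<longlongrightarrow> F l) net"
  by (rule bounded_linear.tendsto[OF bounded_clinear_linear])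

lemma bounded_clinearI:
  assumes "\<And>x y. F (x + y) = F x + F y" "\<And>c x. F (c *\<^sub>C x) = c *\<^sub>C F x"
    and "\<And>x. norm (F x) \<le> K * norm x"
  shows "bounded_clinear F"
  unfolding bounded_clinear_def
  by (auto intro!: bounded_linear_intro[where K = K] simp: assms scaleR_scaleC mult.commute)

lemma bounded_clinear_compose:
  "bounded_clinear F \<Longrightarrow> bounded_clinear G \<Longrightarrow> bounded_clinear (\<lambda>x. F (G x))"
  unfolding bounded_clinear_def by (auto intro: bounded_linear_compose)

lemma bounded_clinear_mult:
  assumes "bounded_clinear F" shows "bounded_clinear (\<lambda>x. F (a * x * b))"
proof -
  have "bounded_linear (\<lambda>x. a * x * b)"
    by (intro bounded_linear_compose[OF bounded_linear_mult_left] bounded_linear_mult_right)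
  thus ?thesis using assms unfolding bounded_clinear_def
    by (auto intro: bounded_linear_compose simp: scaleC_mult_left scaleC_mult_right)
qed

section \<open>Bounded maps determined on, and extended from, dense sets\<close>

lemma dense_sequence:
  assumes "closure (range f) = (UNIV :: 'a::real_normed_vector set)"
  obtains s where "(\<lambda>n. f (s n)) \<longlonglongrightarrow> x"
proof -
  have "x \<in> closure (range f)" using assms by simp
  then obtain t where t: "\<forall>n. t n \<in> range f" "t \<longlonglongrightarrow> x" unfolding closure_sequential by blast
  hence "\<forall>n. \<exists>i. t n = f i" by (auto simp: image_iff)
  from choice[OF this] obtain s where "\<forall>n. t n = f (s n)" by blast
  hence "t = (\<lambda>n. f (s n))" by auto
  thus ?thesis using t that by blast
qed

lemma dense_bounded_clinear_eqI:
  assumes "closure (range f) = UNIV" "bounded_clinear F" "bounded_clinear G"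
    "\<And>i. F (f i) = G (f i)"
  shows "F = G"
proof
  fix x
  obtain s where s: "(\<lambda>n. f (s n)) \<longlonglongrightarrow> x" using dense_sequence[OF assms(1)] .
  show "F x = G x"
    using bounded_clinear_tendsto[OF assms(2) s] bounded_clinear_tendsto[OF assms(3) s]
    by (intro LIMSEQ_unique[of "\<lambda>n. F (f (s n))"]) (auto simp: assms(4))
qed

text \<open>The indices are formal expressions (free polynomials, lists of tensors), on which
  \<open>f\<close> is usually far from injective. Applied to differences, the norm bound makes
  \<open>g\<close> a well-defined Lipschitz function of the value of \<open>f\<close>, and uniform
  continuity extends it to the closure.\<close>

lemma bounded_clinear_extension:
  fixes f :: "'i \<Rightarrow> 'a::cstar_algebra" and g :: "'i \<Rightarrow> 'b::cstar_algebra"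
  assumes add: "\<And>i j. \<exists>k. f k = f i + f j \<and> g k = g i + g j"
    and scale: "\<And>c i. \<exists>k. f k = c *\<^sub>C f i \<and> g k = c *\<^sub>C g i"
    and bound: "\<And>i. norm (g i) \<le> K * norm (f i)"
    and dense: "closure (range f) = UNIV"
  obtains F where "bounded_clinear F" "\<And>i. F (f i) = g i" "\<And>x. norm (F x) \<le> K * norm x"
proof -
  have diff: "\<exists>k. f k = f i - f j \<and> g k = g i - g j" for i j
  proof -
    obtain l where l: "f l = (-1) *\<^sub>C f j" "g l = (-1) *\<^sub>C g j" using scale by blast
    obtain k where "f k = f i + f l" "g k = g i + g l" using add by blast
    thus ?thesis using l by (intro exI[of _ k]) simp
  qed
  have dist: "dist (g i) (g j) \<le> K * dist (f i) (f j)" for i j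
    using diff[of i j] bound unfolding dist_norm by metis
  define G where "G = (\<lambda>x. g (SOME i. f i = x))"
  have G: "G (f i) = g i" for i
  proof -
    have "f (SOME j. f j = f i) = f i" by (rule someI) (rule refl)
    hence "dist (G (f i)) (g i) \<le> 0" unfolding G_def by (metis dist dist_self mult_zero_right)
    thus ?thesis by simp
  qed
  \<comment> \<open>A Lipschitz constant must be nonnegative, and nothing is assumed about the sign
    of \<open>K\<close>.\<close>
  have "(max K 0)-lipschitz_on (range f) G"
  proof (rule lipschitz_onI)
    fix x y assume "x \<in> range f" "y \<in> range f"
    then obtain i j where ij: "x = f i" "y = f j" by auto
    have "K * dist (f i) (f j) \<le> max K 0 * dist (f i) (f j)" by (intro mult_right_mono) auto
    thus "dist (G x) (G y) \<le> max K 0 * dist x y" using dist[of i j] by (simp add: ij G)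
  qed simp
  hence "uniformly_continuous_on (range f) G" by (rule lipschitz_on_uniformly_continuous)
  then obtain F where F: "uniformly_continuous_on UNIV F" "\<And>x. x \<in> range f \<Longrightarrow> G x = F x"
    using uniformly_continuous_on_extension_on_closure[of "range f" G] dense by metis
  have Ff: "F (f i) = g i" for i using F(2)[of "f i"] G by auto
  have lim: "(\<lambda>n. g (s n)) \<longlonglongrightarrow> F x" if "(\<lambda>n. f (s n)) \<longlonglongrightarrow> x" for s x
  proof -
    have "isCont F x" using F(1) uniformly_continuous_imp_continuous continuous_on_eq_continuous_at
      by (metis UNIV_I open_UNIV)
    hence "(\<lambda>n. F (f (s n))) \<longlonglongrightarrow> F x" using that by (rule isCont_tendsto_compose)
    thus ?thesis by (simp add: Ff)
  qed
  have "bounded_clinear F" and nF: "norm (F x) \<le> K * norm x" for x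
  proof -
    show n: "norm (F x) \<le> K * norm x" for x
    proof -
      obtain s where s: "(\<lambda>n. f (s n)) \<longlonglongrightarrow> x" using dense_sequence[OF dense] .
      show ?thesis
        by (rule LIMSEQ_le[OF tendsto_norm[OF lim[OF s]] tendsto_mult[OF tendsto_const tendsto_norm[OF s]]])
           (use bound in auto)
    qed
    show "bounded_clinear F"
    proof (rule bounded_clinearI[OF _ _ n])
      fix x y
      obtain s where s: "(\<lambda>n. f (s n)) \<longlonglongrightarrow> x" using dense_sequence[OF dense] .
      obtain t where t: "(\<lambda>n. f (t n)) \<longlonglongrightarrow> y" using dense_sequence[OF dense] .
      obtain k where k: "\<And>n. f (k n) = f (s n) + f (t n)" "\<And>n. g (k n) = g (s n) + g (t n)"
        using choice[of "\<lambda>n k. f k = f (s n) + f (t n) \<and> g k = g (s n) + g (t n)"] add by blast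
      have "(\<lambda>n. f (k n)) \<longlonglongrightarrow> x + y" unfolding k by (intro tendsto_intros s t)
      from lim[OF this] show "F (x + y) = F x + F y" unfolding k
        using tendsto_add[OF lim[OF s] lim[OF t]] by (rule LIMSEQ_unique)
    next
      fix c x
      obtain s where s: "(\<lambda>n. f (s n)) \<longlonglongrightarrow> x" using dense_sequence[OF dense] .
      obtain k where k: "\<And>n. f (k n) = c *\<^sub>C f (s n)" "\<And>n. g (k n) = c *\<^sub>C g (s n)"
        using choice[of "\<lambda>n k. f k = c *\<^sub>C f (s n) \<and> g k = c *\<^sub>C g (s n)"] scale by blast
      have "(\<lambda>n. f (k n)) \<longlonglongrightarrow> c *\<^sub>C x" unfolding k by (intro tendsto_intros s)
      from lim[OF this] show "F (c *\<^sub>C x) = c *\<^sub>C F x" unfolding k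
        using tendsto_scaleC[OF lim[OF s]] by (rule LIMSEQ_unique)
    qed
  qed
  thus ?thesis using that Ff nF by blast
qed

text \<open>The four numbers are the values of a sesquilinear form that is nonnegative at every
  \<open>x + c y\<close>. Stated without vectors, this gives Hermitian symmetry and Cauchy-Schwarz
  for functionals on C*-algebras, on the free algebra and on formal tensors alike.\<close>

lemma hermitian_form_values:
  fixes A B C D :: complex
  assumes "\<And>c. A + c * B + cnj c * C + (cnj c * c) * D \<in> \<real>\<^sub>\<ge>\<^sub>0"
  shows "C = cnj B" "(cmod B)\<^sup>2 \<le> Re A * Re D"
proof -
  have A: "Im A = 0" "Re A \<ge> 0" using assms[of 0] by (auto simp: complex_nonneg_Reals_iff)
  have 1: "Im (B + C) + Im D = 0" "-Im (B + C) + Im D = 0" "Re B - Re C + Im D = 0"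
    using assms[of 1] assms[of "-1"] assms[of \<i>] A by (auto simp: complex_nonneg_Reals_iff)
  show C: "C = cnj B" using 1 by (simp add: complex_eq_iff)
  have key: "0 \<le> Re A + 2 * Re (c * B) + (cmod c)\<^sup>2 * Re D" for c
  proof -
    have "0 \<le> Re (A + c * B + cnj c * C + (cnj c * c) * D)"
      using assms[of c] by (simp add: complex_nonneg_Reals_iff)
    also have "\<dots> = Re A + 2 * Re (c * B) + (cmod c)\<^sup>2 * Re D"
    proof -
      have "cnj c * c = complex_of_real ((cmod c)\<^sup>2)"
        by (metis complex_norm_square mult.commute of_real_power)
      thus ?thesis by (simp add: C)
    qed
    finally show ?thesis .
  qed
  \<comment> \<open>The phase of \<open>c\<close> is chosen opposite to that of
    \<open>cnj B\<close>, which leaves a real quadratic in \<open>t\<close>; the cases below choose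
    \<open>t\<close> at its minimum, or so large that a failing sign becomes visible.\<close>
  have key2: "0 \<le> Re A - 2 * t * (cmod B)\<^sup>2 + t\<^sup>2 * (cmod B)\<^sup>2 * Re D" for t :: real
  proof -
    have "cnj B * B = complex_of_real ((cmod B)\<^sup>2)"
      by (metis complex_norm_square mult.commute of_real_power)
    hence "- complex_of_real t * cnj B * B = complex_of_real (- t * (cmod B)\<^sup>2)"
      by (simp add: mult.assoc)
    hence "Re (- complex_of_real t * cnj B * B) = - t * (cmod B)\<^sup>2"
      by (metis Re_complex_of_real)
    moreover have "(cmod (- of_real t * cnj B))\<^sup>2 = t\<^sup>2 * (cmod B)\<^sup>2"
      by (simp add: norm_mult power_mult_distrib)
    ultimately show ?thesis using key[of "- of_real t * cnj B"] by simp
  qed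
  show "(cmod B)\<^sup>2 \<le> Re A * Re D"
  proof (cases "B = 0 \<or> Re D > 0")
    case True
    have "Re D \<ge> 0"
    proof (rule ccontr)
      assume "\<not> Re D \<ge> 0"
      hence D: "Re D < 0" and B: "B = 0" using True by auto
      define t where "t = 1 + Re A / (- Re D)"
      have t: "t \<ge> 1" "t * (- Re D) = Re A - Re D"
        using D A by (simp_all add: t_def divide_nonneg_neg field_simps)
      have "0 \<le> Re A + t\<^sup>2 * Re D" using key[of "of_real t"] by (simp add: B)
      moreover have "t * (- Re D) \<le> t\<^sup>2 * (- Re D)"
        using t D unfolding power2_eq_square by (intro mult_right_mono) auto
      ultimately show False using t D by simp
    qed
    show ?thesis
    proof (cases "B = 0")
      case True thus ?thesis using A \<open>Re D \<ge> 0\<close> by simp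
    next
      case False
      hence D: "Re D > 0" using True by auto
      show ?thesis using key2[of "1 / Re D"] D by (simp add: field_simps power2_eq_square)
    qed
  next
    case False
    hence B: "(cmod B)\<^sup>2 > 0" and D: "Re D \<le> 0" by auto
    define t where "t = (Re A + 1) / (cmod B)\<^sup>2"
    have "t * (cmod B)\<^sup>2 = Re A + 1" using B by (simp add: t_def)
    moreover have "t\<^sup>2 * (cmod B)\<^sup>2 * Re D \<le> 0" using D by (intro mult_nonneg_nonpos) auto
    ultimately have False using key2[of t] A by (simp add: mult.assoc)
    thus ?thesis ..
  qed
qed

section \<open>Positive functionals and the Schur product theorem\<close>

definition pos_fun :: "('a::cstar_algebra \<Rightarrow> complex) \<Rightarrow> bool"
  where "pos_fun \<phi> \<longleftrightarrow> bounded_clinear \<phi> \<and> (\<forall>x. \<phi> (star x * x) \<in> \<real>\<^sub>\<ge>\<^sub>0)"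

lemma state_pos_fun: "state \<phi> \<Longrightarrow> pos_fun \<phi>"
  by (simp add: state_def pos_fun_def)

lemma pos_fun_bcl: "pos_fun \<phi> \<Longrightarrow> bounded_clinear \<phi>"
  by (simp add: pos_fun_def)

lemma state_bcl: "state \<phi> \<Longrightarrow> bounded_clinear \<phi>"
  by (simp add: state_def)

lemmas pos_fun_linear = bounded_clinear_simps[OF pos_fun_bcl]
  and state_linear = bounded_clinear_simps[OF state_bcl]

lemma state_one: "state \<phi> \<Longrightarrow> \<phi> 1 = 1"
  by (simp add: state_def)

lemma pos_fun_real: "pos_fun \<phi> \<Longrightarrow> Im (\<phi> (star x * x)) = 0" "pos_fun \<phi> \<Longrightarrow> 0 \<le> Re (\<phi> (star x * x))"
  by (auto simp: pos_fun_def complex_nonneg_Reals_iff)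

lemma pos_fun_form:
  assumes "pos_fun \<phi>"
  shows pos_fun_form_herm: "\<phi> (star y * x) = cnj (\<phi> (star x * y))"
    and pos_fun_CS: "(cmod (\<phi> (star x * y)))\<^sup>2 \<le> Re (\<phi> (star x * x)) * Re (\<phi> (star y * y))"
proof -
  note lin = pos_fun_linear[OF assms]
  have "\<phi> (star x * x) + c * \<phi> (star x * y) + cnj c * \<phi> (star y * x) + (cnj c * c) * \<phi> (star y * y) \<in> \<real>\<^sub>\<ge>\<^sub>0" for c
  proof -
    have "\<phi> (star (x + c *\<^sub>C y) * (x + c *\<^sub>C y)) \<in> \<real>\<^sub>\<ge>\<^sub>0" using assms by (simp add: pos_fun_def)
    also have "\<phi> (star (x + c *\<^sub>C y) * (x + c *\<^sub>C y)) =
        \<phi> (star x * x) + c * \<phi> (star x * y) + cnj c * \<phi> (star y * x) + (cnj c * c) * \<phi> (star y * y)"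
      by (simp add: star_add star_scaleC distrib_left distrib_right scaleC_mult_left scaleC_mult_right
          lin algebra_simps)
    finally show ?thesis .
  qed
  from hermitian_form_values[OF this]
  show "\<phi> (star y * x) = cnj (\<phi> (star x * y))"
    "(cmod (\<phi> (star x * y)))\<^sup>2 \<le> Re (\<phi> (star x * x)) * Re (\<phi> (star y * y))" by auto
qed

lemma pos_fun_star: "pos_fun \<phi> \<Longrightarrow> \<phi> (star x) = cnj (\<phi> x)"
  using pos_fun_form_herm[of \<phi> x 1] by simp

lemma pos_fun_one: "pos_fun \<phi> \<Longrightarrow> 0 \<le> Re (\<phi> 1)" "pos_fun \<phi> \<Longrightarrow> Im (\<phi> 1) = 0"
  using pos_fun_real[of \<phi> 1] by simp_all

lemma pos_fun_compress:
  assumes "pos_fun \<phi>"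
  shows "pos_fun (\<lambda>x. \<phi> (star y * x * y))"
proof -
  have "\<phi> (star y * (star x * x) * y) \<in> \<real>\<^sub>\<ge>\<^sub>0" for x
    using assms[unfolded pos_fun_def] by (metis mult.assoc star_mult)
  thus ?thesis using bounded_clinear_mult[OF pos_fun_bcl[OF assms]] by (simp add: pos_fun_def)
qed

text \<open>If \<open>b 0\<close> exceeded \<open>c * r\<close>, the ratio of \<open>b k\<close> to
  \<open>c * r ^ (2 ^ k)\<close> would be above 1 and at least square at every step. It would grow
  without bound, although it never exceeds \<open>M / c\<close>.\<close>

lemma square_iteration_bound:
  fixes b :: "nat \<Rightarrow> real"
  assumes "0 \<le> c" "0 \<le> r" "\<And>k. 0 \<le> b k" "\<And>k. (b k)\<^sup>2 \<le> c * b (Suc k)" "\<And>k. b k \<le> M * r ^ (2 ^ k)"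
  shows "b 0 \<le> c * r"
proof (rule ccontr)
  assume less: "\<not> b 0 \<le> c * r"
  have "0 \<le> c * r" using assms by simp
  hence "b 0 > 0" using less by linarith
  have "c \<noteq> 0" using assms(4)[of 0] \<open>b 0 > 0\<close> by auto
  moreover have "r \<noteq> 0" using assms(5)[of 0] \<open>b 0 > 0\<close> by auto
  ultimately have cr: "c > 0" "r > 0" using assms by auto
  define \<beta> where "\<beta> k = b k / (c * r ^ (2 ^ k))" for k
  have "\<beta> 0 > 1" using less cr by (simp add: \<beta>_def field_simps)
  have step: "(\<beta> k)\<^sup>2 \<le> \<beta> (Suc k)" for k
  proof -
    have "(\<beta> k)\<^sup>2 = (b k)\<^sup>2 / (c\<^sup>2 * r ^ (2 ^ Suc k))"
      by (simp add: \<beta>_def power_divide power_mult_distrib flip: power_mult) (simp add: mult.commute)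
    also have "\<dots> \<le> c * b (Suc k) / (c\<^sup>2 * r ^ (2 ^ Suc k))"
      using assms(4) cr by (intro divide_right_mono) auto
    also have "\<dots> = \<beta> (Suc k)" using cr by (simp add: \<beta>_def power2_eq_square)
    finally show ?thesis .
  qed
  have pow: "\<beta> 0 ^ (2 ^ k) \<le> \<beta> k" for k
  proof (induction k)
    case (Suc k)
    have "\<beta> 0 ^ (2 ^ Suc k) = (\<beta> 0 ^ (2 ^ k))\<^sup>2" by (simp flip: power_mult) (simp add: mult.commute)
    also have "\<dots> \<le> (\<beta> k)\<^sup>2" using Suc \<open>\<beta> 0 > 1\<close> by (intro power_mono) auto
    finally show ?case using step[of k] by linarith
  qed simp
  have upper: "\<beta> k \<le> M / c" for k
  proof -
    have "b k \<le> M * r ^ (2 ^ k)" by (rule assms)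
    thus ?thesis using cr by (simp add: \<beta>_def field_simps)
  qed
  obtain n where n: "M / c < \<beta> 0 ^ n" using real_arch_pow[OF \<open>\<beta> 0 > 1\<close>] by blast
  have "\<beta> 0 ^ n \<le> \<beta> 0 ^ (2 ^ n)" using \<open>\<beta> 0 > 1\<close> by (intro power_increasing) auto
  thus False using pow[of n] upper[of n] n by linarith
qed

text \<open>Cauchy-Schwarz against \<open>1\<close>, iterated along the powers
  \<open>h ^ (2 ^ k)\<close>, takes the place of functional calculus: whatever constant
  \<open>M\<close> continuity supplies is washed out, and only \<open>\<phi> 1\<close>
  remains.\<close>

lemma pos_fun_bound_selfadjoint:
  assumes "pos_fun \<phi>" "star h = h"
  shows "cmod (\<phi> h) \<le> Re (\<phi> 1) * norm h"
proof -
  interpret bounded_linear \<phi> using assms(1) by (intro bounded_clinear_linear pos_fun_bcl)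
  obtain M where M: "\<And>x. cmod (\<phi> x) \<le> norm x * M" and "M \<ge> 0" using nonneg_bounded by blast
  have "cmod (\<phi> (h ^ (2 ^ 0))) \<le> Re (\<phi> 1) * norm h"
  proof (rule square_iteration_bound[where b = "\<lambda>k. cmod (\<phi> (h ^ (2 ^ k)))" and M = M])
    fix k
    have "(cmod (\<phi> (star 1 * h ^ (2 ^ k))))\<^sup>2 \<le> Re (\<phi> (star 1 * 1)) * Re (\<phi> (star (h ^ (2 ^ k)) * h ^ (2 ^ k)))"
      by (rule pos_fun_CS[OF assms(1)])
    also have "star (h ^ (2 ^ k)) * h ^ (2 ^ k) = h ^ (2 ^ Suc k)"
      by (simp add: star_power assms(2) mult_2 flip: power_add)
    also have "Re (\<phi> (star 1 * 1)) * Re (\<phi> (h ^ (2 ^ Suc k))) \<le> Re (\<phi> 1) * cmod (\<phi> (h ^ (2 ^ Suc k)))"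
      using pos_fun_one[OF assms(1)] complex_Re_le_cmod by (auto intro!: mult_left_mono)
    finally show "(cmod (\<phi> (h ^ (2 ^ k))))\<^sup>2 \<le> Re (\<phi> 1) * cmod (\<phi> (h ^ (2 ^ Suc k)))" by simp
    have "cmod (\<phi> (h ^ (2 ^ k))) \<le> norm (h ^ (2 ^ k)) * M" by (rule M)
    also have "\<dots> \<le> norm h ^ (2 ^ k) * M" by (intro mult_right_mono norm_power_ineq \<open>M \<ge> 0\<close>)
    finally show "cmod (\<phi> (h ^ (2 ^ k))) \<le> M * norm h ^ (2 ^ k)" by (simp add: mult.commute)
  qed (use pos_fun_one[OF assms(1)] in auto)
  thus ?thesis by simp
qed

lemma pos_fun_bound:
  assumes "pos_fun \<phi>"
  shows "cmod (\<phi> x) \<le> Re (\<phi> 1) * norm x"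
proof (rule power2_le_imp_le)
  have "(cmod (\<phi> x))\<^sup>2 \<le> Re (\<phi> 1) * Re (\<phi> (star x * x))"
    using pos_fun_CS[OF assms, of 1 x] by simp
  also have "\<dots> \<le> Re (\<phi> 1) * (Re (\<phi> 1) * norm (star x * x))"
    using pos_fun_bound_selfadjoint[OF assms, of "star x * x"] pos_fun_one[OF assms]
      complex_Re_le_cmod[of "\<phi> (star x * x)"]
    by (intro mult_left_mono) (auto simp: star_mult star_star)
  also have "\<dots> = (Re (\<phi> 1) * norm x)\<^sup>2" by (simp add: cstar_identity power2_eq_square)
  finally show "(cmod (\<phi> x))\<^sup>2 \<le> (Re (\<phi> 1) * norm x)\<^sup>2" .
qed (use pos_fun_one[OF assms] in auto)

lemma state_bound: "state \<phi> \<Longrightarrow> cmod (\<phi> x) \<le> norm x"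
  using pos_fun_bound[OF state_pos_fun] by (fastforce simp: state_def)

lemma pos_fun_mult_bound:
  assumes "pos_fun \<phi>"
  shows "Re (\<phi> (star y * (star a * a) * y)) \<le> (norm a)\<^sup>2 * Re (\<phi> (star y * y))"
  using pos_fun_bound[OF pos_fun_compress[OF assms], of y "star a * a"]
    complex_Re_le_cmod[of "\<phi> (star y * (star a * a) * y)"]
  by (simp add: cstar_identity mult.commute)

text \<open>Semi-inner products on the algebra. Forms are used instead of functionals because the
  inequality between \<open>star a * a\<close> and the square of \<open>norm a\<close> enters as a
  positive difference of two of them.\<close>

definition psd_form :: "('a::cstar_algebra \<Rightarrow> 'a \<Rightarrow> complex) \<Rightarrow> bool"
  where "psd_form s \<longleftrightarrow> (\<forall>x y z. s x (y + z) = s x y + s x z) \<and> (\<forall>c x y. s x (c *\<^sub>C y) = c * s x y) \<and>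
    (\<forall>x y. s y x = cnj (s x y)) \<and> (\<forall>x. 0 \<le> Re (s x x))"

lemma psd_form_simps:
  assumes "psd_form s"
  shows "s x (y + z) = s x y + s x z" "s (y + z) x = s y x + s z x"
    "s x (c *\<^sub>C y) = c * s x y" "s (c *\<^sub>C y) x = cnj c * s y x" "s x (- y) = - s x y" "s (- y) x = - s y x"
    "s x (y - z) = s x y - s x z" "s (y - z) x = s y x - s z x" "s x 0 = 0" "s 0 x = 0"
proof -
  have s: "s x (y + z) = s x y + s x z" "s x (c *\<^sub>C y) = c * s x y" "s x y = cnj (s y x)" for x y z c
    using assms unfolding psd_form_def by blast+
  show "s x (y + z) = s x y + s x z" "s x (c *\<^sub>C y) = c * s x y" by (rule s)+
  show 1: "s (y + z) x = s y x + s z x" for x y z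
    using s(3)[of "y + z" x] s(3)[of y x] s(3)[of z x] by (simp add: s(1))
  show 2: "s (c *\<^sub>C y) x = cnj c * s y x" for x y c
    using s(3)[of "c *\<^sub>C y" x] s(3)[of y x] by (simp add: s(2))
  show 3: "s x (- y) = - s x y" for x y using s(2)[of x "-1" y] by simp
  show 4: "s (- y) x = - s y x" for x y using 2[of "-1" y x] by simp
  show "s x (y - z) = s x y - s x z" using s(1)[of x y "-z"] by (simp add: 3)
  show "s (y - z) x = s y x - s z x" using 1[of y "-z" x] by (simp add: 4)
  show "s x 0 = 0" using s(2)[of x 0 0] by simp
  show "s 0 x = 0" using 2[of 0 0 x] by simp
qed

lemma psd_form_sum:
  assumes "psd_form s"
  shows "s (\<Sum>i\<in>I. f i) (\<Sum>j\<in>J. g j) = (\<Sum>i\<in>I. \<Sum>j\<in>J. s (f i) (g j))"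
proof -
  have "s x (\<Sum>j\<in>J. g j) = (\<Sum>j\<in>J. s x (g j))" for x
    by (induction J rule: infinite_finite_induct) (auto simp: psd_form_simps[OF assms])
  moreover have "s (\<Sum>i\<in>I. f i) x = (\<Sum>i\<in>I. s (f i) x)" for x
    by (induction I rule: infinite_finite_induct) (auto simp: psd_form_simps[OF assms])
  hence "s (\<Sum>i\<in>I. f i) (\<Sum>j\<in>J. g j) = (\<Sum>i\<in>I. s (f i) (\<Sum>j\<in>J. g j))" .
  ultimately show ?thesis by (simp only:)
qed

lemma psd_form_real:
  assumes "psd_form s"
  shows "s x x = of_real (Re (s x x))" "0 \<le> Re (s x x)"
proof -
  have "s x x = cnj (s x x)" using assms unfolding psd_form_def by blast
  hence "Im (s x x) = 0" by (metis cnj.simps(2) neg_equal_zero)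
  thus "s x x = of_real (Re (s x x))" by (simp add: complex_eq_iff)
  show "0 \<le> Re (s x x)" using assms unfolding psd_form_def by blast
qed

lemma psd_form_null:
  assumes "psd_form s" "s x x = 0"
  shows "s x y = 0"
proof -
  have "s x x + c * s x y + cnj c * s y x + (cnj c * c) * s y y \<in> \<real>\<^sub>\<ge>\<^sub>0" for c
  proof -
    have "s (x + c *\<^sub>C y) (x + c *\<^sub>C y) \<in> \<real>\<^sub>\<ge>\<^sub>0"
      by (subst psd_form_real(1)[OF assms(1)]) (simp add: psd_form_real(2)[OF assms(1)])
    thus ?thesis by (simp add: psd_form_simps[OF assms(1)] algebra_simps)
  qed
  from hermitian_form_values(2)[OF this] assms(2) show ?thesis by simp
qed

text \<open>One step of Gram-Schmidt on the vectors \<open>a\<^sub>i\<close> splits off the positive contribution of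
  \<open>a\<^sub>p\<close>.\<close>

lemma psd_form_schur:
  assumes "psd_form s" "psd_form t" "finite I"
  shows "0 \<le> Re (\<Sum>i\<in>I. \<Sum>j\<in>I. s (a i) (a j) * t (b i) (b j))"
  using assms(3)
proof (induction I arbitrary: a rule: finite_induct)
  case (insert p I)
  note s = psd_form_simps[OF assms(1)] and t = psd_form_simps[OF assms(2)]
  define m where "m = s (a p) (a p)"
  \<comment> \<open>For \<open>m = 0\<close> the quotient is \<open>0\<close> by convention; then
    \<open>a p\<close> is a null vector and already orthogonal to every \<open>a i\<close>.\<close>
  define \<tau> where "\<tau> i = s (a p) (a i) / m" for i
  define a' where "a' i = a i - \<tau> i *\<^sub>C a p" for i
  define z where "z = (\<Sum>i\<in>insert p I. \<tau> i *\<^sub>C b i)"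
  have orth: "s (a p) (a' i) = 0" for i
  proof (cases "m = 0")
    case True
    thus ?thesis using psd_form_null[OF assms(1), of "a p"] by (simp add: m_def)
  next
    case False
    thus ?thesis by (simp add: a'_def s \<tau>_def flip: m_def)
  qed
  have orth': "s (a' i) (a p) = 0" for i
    using orth[of i] assms(1) by (metis complex_cnj_zero psd_form_def)
  have split: "s (a i) (a j) = s (a' i) (a' j) + cnj (\<tau> i) * \<tau> j * m" for i j
  proof -
    have "s (a i) (a j) = s (a' i + \<tau> i *\<^sub>C a p) (a' j + \<tau> j *\<^sub>C a p)" by (simp add: a'_def)
    also have "\<dots> = s (a' i) (a' j) + cnj (\<tau> i) * \<tau> j * m"
      unfolding s by (simp add: orth orth' m_def)
    finally show ?thesis .
  qed
  \<comment> \<open>The reduced pivot vector is null, so its row and column drop out and the double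
    sum shrinks to \<open>I\<close>, where the induction hypothesis applies to
    \<open>a'\<close>.\<close>
  have zero: "s (a' p) (a' j) = 0" "s (a' j) (a' p) = 0" for j
  proof -
    have "s (a' p) (a' j) = s (a p) (a' j) - cnj (\<tau> p) * s (a p) (a' j)" by (simp add: a'_def[of p] s)
    thus "s (a' p) (a' j) = 0" by (simp add: orth)
    thus "s (a' j) (a' p) = 0" using assms(1) by (metis complex_cnj_zero psd_form_def)
  qed
  have "(\<Sum>i\<in>insert p I. \<Sum>j\<in>insert p I. s (a i) (a j) * t (b i) (b j)) =
      (\<Sum>i\<in>insert p I. \<Sum>j\<in>insert p I. s (a' i) (a' j) * t (b i) (b j)) +
      m * (\<Sum>i\<in>insert p I. \<Sum>j\<in>insert p I. cnj (\<tau> i) * (\<tau> j * t (b i) (b j)))"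
    unfolding split sum_distrib_left distrib_right sum.distrib by (simp add: mult_ac)
  also have "(\<Sum>i\<in>insert p I. \<Sum>j\<in>insert p I. s (a' i) (a' j) * t (b i) (b j)) =
      (\<Sum>i\<in>I. \<Sum>j\<in>I. s (a' i) (a' j) * t (b i) (b j))"
    using insert.hyps by (simp add: zero)
  also have "(\<Sum>i\<in>insert p I. \<Sum>j\<in>insert p I. cnj (\<tau> i) * (\<tau> j * t (b i) (b j))) = t z z"
    unfolding z_def psd_form_sum[OF assms(2)] t by (simp add: mult_ac)
  finally have eq: "(\<Sum>i\<in>insert p I. \<Sum>j\<in>insert p I. s (a i) (a j) * t (b i) (b j)) =
      (\<Sum>i\<in>I. \<Sum>j\<in>I. s (a' i) (a' j) * t (b i) (b j)) + m * t z z" .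
  have "m * t z z = of_real (Re m * Re (t z z))"
    using psd_form_real(1)[OF assms(1), of "a p"] psd_form_real(1)[OF assms(2), of z]
    unfolding m_def by simp
  hence "Re (m * t z z) \<ge> 0"
    using psd_form_real(2)[OF assms(1), of "a p"] psd_form_real(2)[OF assms(2), of z]
    by (simp add: m_def)
  thus ?case unfolding eq using insert.IH[of a'] by simp
qed simp

lemma psd_form_pos_fun:
  assumes "pos_fun \<phi>"
  shows "psd_form (\<lambda>x y. \<phi> (star x * y))"
  unfolding psd_form_def
  by (intro conjI allI pos_fun_form_herm[OF assms] pos_fun_real[OF assms])
     (simp_all add: distrib_left scaleC_mult_right pos_fun_linear[OF assms])

lemma psd_form_mult:
  assumes "pos_fun \<phi>"
  shows "psd_form (\<lambda>x y. \<phi> (star x * (star a * a) * y))"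
proof -
  have *: "star x * (star a * a) * y = star (a * x) * (a * y)" for x y
    by (simp add: star_mult mult.assoc)
  show ?thesis unfolding psd_form_def *
    by (intro conjI allI pos_fun_form_herm[OF assms] pos_fun_real[OF assms])
       (simp_all add: distrib_left scaleC_mult_right pos_fun_linear[OF assms])
qed

lemma psd_form_mult_diff:
  assumes "pos_fun \<phi>"
  shows "psd_form (\<lambda>x y. of_real ((norm a)\<^sup>2) * \<phi> (star x * y) - \<phi> (star x * (star a * a) * y))"
proof -
  have 1: "psd_form (\<lambda>x y. \<phi> (star x * y))" and 2: "psd_form (\<lambda>x y. \<phi> (star x * (star a * a) * y))"
    by (rule psd_form_pos_fun[OF assms] psd_form_mult[OF assms])+
  show ?thesis unfolding psd_form_def
  proof (intro conjI allI)
    fix x y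
    have "\<phi> (star y * x) = cnj (\<phi> (star x * y))"
      "\<phi> (star y * (star a * a) * x) = cnj (\<phi> (star x * (star a * a) * y))"
      using 1 2 unfolding psd_form_def by blast+
    thus "of_real ((norm a)\<^sup>2) * \<phi> (star y * x) - \<phi> (star y * (star a * a) * x) =
      cnj (of_real ((norm a)\<^sup>2) * \<phi> (star x * y) - \<phi> (star x * (star a * a) * y))" by simp
  next
    fix x y z c
    let ?d = "\<lambda>x y. of_real ((norm a)\<^sup>2) * \<phi> (star x * y) - \<phi> (star x * (star a * a) * y)"
    show "?d x (y + z) = ?d x y + ?d x z"
      unfolding psd_form_simps(1)[OF 1] psd_form_simps(1)[OF 2] by (simp only: distrib_left) simp
    show "?d x (c *\<^sub>C y) = c * ?d x y"
      by (simp only: psd_form_simps(3)[OF 1] psd_form_simps(3)[OF 2] right_diff_distrib) simp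
    show "0 \<le> Re (?d x x)" using pos_fun_mult_bound[OF assms, of x a] by simp
  qed
qed

section \<open>Tensor products of forms on formal sums of elementary tensors\<close>

definition tform ::
    "('a::cstar_algebra \<Rightarrow> 'a \<Rightarrow> complex) \<Rightarrow> ('a \<Rightarrow> 'a \<Rightarrow> complex) \<Rightarrow> 'a tensors \<Rightarrow> 'a tensors \<Rightarrow> complex"
  where "tform s t xs ys = (\<Sum>x\<leftarrow>xs. \<Sum>y\<leftarrow>ys. s (fst x) (fst y) * t (snd x) (snd y))"

lemma tfun_append: "tfun \<phi> \<psi> (xs @ ys) = tfun \<phi> \<psi> xs + tfun \<phi> \<psi> ys"
  by (simp add: tfun_def)

lemma tmult_Cons: "tmult (x # xs) zs = map (\<lambda>y. (fst x * fst y, snd x * snd y)) zs @ tmult xs zs"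
  by (simp add: tmult_def case_prod_unfold)

lemma tform_tfun: "tform (\<lambda>x y. \<phi> (star x * y)) (\<lambda>x y. \<psi> (star x * y)) xs ys = tfun \<phi> \<psi> (tmult (tstar xs) ys)"
proof (induction xs)
  case (Cons x xs)
  have "tfun \<phi> \<psi> (map (\<lambda>y. (a * fst y, b * snd y)) ys) = (\<Sum>y\<leftarrow>ys. \<phi> (a * fst y) * \<psi> (b * snd y))" for a b
    by (induction ys) (auto simp: tfun_def)
  moreover have "tstar (x # xs) = (star (fst x), star (snd x)) # tstar xs"
    by (simp add: tstar_def case_prod_unfold)
  ultimately show ?case using Cons by (simp add: tform_def tmult_Cons tfun_append)
qed (simp add: tform_def tfun_def tstar_def tmult_def)

lemma tform_pos:
  assumes "psd_form s" "psd_form t"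
  shows "0 \<le> Re (tform s t xs xs)"
proof -
  have "tform s t xs xs = (\<Sum>i\<in>{0..<length xs}. \<Sum>j\<in>{0..<length xs}.
      s (fst (xs ! i)) (fst (xs ! j)) * t (snd (xs ! i)) (snd (xs ! j)))"
    by (simp add: tform_def sum_list_sum_nth)
  thus ?thesis
    using psd_form_schur[OF assms, of "{0..<length xs}" "\<lambda>i. fst (xs ! i)" "\<lambda>i. snd (xs ! i)"] by simp
qed

lemma tform_append:
  "tform s t (xs @ ys) zs = tform s t xs zs + tform s t ys zs"
  "tform s t zs (xs @ ys) = tform s t zs xs + tform s t zs ys"
  by (simp_all add: tform_def sum_list_addf)

lemma tform_scale:
  assumes "psd_form s"
  shows "tform s t (map (map_prod (\<lambda>a. c *\<^sub>C a) id) xs) ys = cnj c * tform s t xs ys"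
    and "tform s t xs (map (map_prod (\<lambda>a. c *\<^sub>C a) id) ys) = c * tform s t xs ys"
  by (simp_all add: tform_def psd_form_simps[OF assms] o_def map_prod_def case_prod_unfold
      mult.assoc sum_list_const_mult)

lemma tform_herm:
  assumes "psd_form s" "psd_form t"
  shows "tform s t ys xs = cnj (tform s t xs ys)"
proof -
  have eq: "tform s t xs ys = (\<Sum>i\<in>{0..<length xs}. \<Sum>j\<in>{0..<length ys}.
      s (fst (xs ! i)) (fst (ys ! j)) * t (snd (xs ! i)) (snd (ys ! j)))" for xs ys
    by (simp add: tform_def sum_list_sum_nth)
  have s: "s x y = cnj (s y x)" "t x y = cnj (t y x)" for x y
    using assms unfolding psd_form_def by blast+
  show ?thesis unfolding eq cnj_sum
    by (subst sum.swap) (intro sum.cong refl, metis complex_cnj_mult s)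
qed

lemma tform_CS:
  assumes "psd_form s" "psd_form t"
  shows "(cmod (tform s t xs ys))\<^sup>2 \<le> Re (tform s t xs xs) * Re (tform s t ys ys)"
proof -
  let ?G = "tform s t"
  have "?G xs xs + c * ?G xs ys + cnj c * ?G ys xs + (cnj c * c) * ?G ys ys \<in> \<real>\<^sub>\<ge>\<^sub>0" for c
  proof -
    let ?z = "xs @ map (map_prod (\<lambda>a. c *\<^sub>C a) id) ys"
    have "Im (?G ?z ?z) = 0" using tform_herm[OF assms, of ?z ?z]
      by (metis cnj.simps(2) neg_equal_zero)
    hence "?G ?z ?z \<in> \<real>\<^sub>\<ge>\<^sub>0" using tform_pos[OF assms, of ?z] by (simp add: complex_nonneg_Reals_iff)
    thus ?thesis by (simp add: tform_append tform_scale[OF assms(1)] algebra_simps)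
  qed
  from hermitian_form_values(2)[OF this] show ?thesis .
qed

lemma tform_parallelogram:
  assumes "psd_form s" "psd_form t"
  shows "Re (tform s t (xs @ ys) (xs @ ys)) \<le> 2 * Re (tform s t xs xs) + 2 * Re (tform s t ys ys)"
  using tform_pos[OF assms, of "xs @ map (map_prod (\<lambda>a. (-1) *\<^sub>C a) id) ys"]
  by (simp add: tform_append tform_scale[OF assms(1)] del: scaleC_minus_left)

text \<open>Left multiplication is bounded in all product GNS representations at once; a constant
  independent of the states is what makes the supremum in \<open>spatial_norm\<close> one of a
  bounded set. One elementary tensor is handled by operator inequalities in each factor, sums by the
  parallelogram inequality.\<close>

lemma tform_mult_bound:
  fixes xs :: "'a::cstar_algebra tensors"
  obtains C where "C \<ge> 0" "\<And>\<phi> \<psi> ys. pos_fun \<phi> \<Longrightarrow> pos_fun \<psi> \<Longrightarrow>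
    Re (tform (\<lambda>x y. \<phi> (star x * y)) (\<lambda>x y. \<psi> (star x * y)) (tmult xs ys) (tmult xs ys)) \<le>
    C * Re (tform (\<lambda>x y. \<phi> (star x * y)) (\<lambda>x y. \<psi> (star x * y)) ys ys)"
proof -
  let ?G = "\<lambda>\<phi> \<psi>. tform (\<lambda>x y. \<phi> (star x * y)) (\<lambda>x y. \<psi> (star x * y))"
  have "\<exists>C\<ge>0. \<forall>\<phi> \<psi> ys. pos_fun \<phi> \<and> pos_fun \<psi> \<longrightarrow>
    Re (?G \<phi> \<psi> (tmult xs ys) (tmult xs ys)) \<le> C * Re (?G \<phi> \<psi> ys ys)"
  proof (induction xs)
    case Nil
    show ?case by (intro exI[of _ 0]) (auto simp: tmult_def tform_def)
  next
    case (Cons x xs)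
    then obtain C where C: "C \<ge> 0" "\<And>\<phi> \<psi> ys. pos_fun \<phi> \<Longrightarrow> pos_fun \<psi> \<Longrightarrow>
      Re (?G \<phi> \<psi> (tmult xs ys) (tmult xs ys)) \<le> C * Re (?G \<phi> \<psi> ys ys)" by blast
    obtain a b where x: "x = (a, b)" by fastforce
    define D where "D = (norm a)\<^sup>2 * (norm b)\<^sup>2"
    have one: "Re (?G \<phi> \<psi> (map (\<lambda>y. (a * fst y, b * snd y)) ys) (map (\<lambda>y. (a * fst y, b * snd y)) ys))
      \<le> D * Re (?G \<phi> \<psi> ys ys)" if \<phi>: "pos_fun \<phi>" and \<psi>: "pos_fun \<psi>" for \<phi> \<psi> ys
    proof -
      let ?p = "\<lambda>x y. \<phi> (star x * y)" and ?q = "\<lambda>x y. \<psi> (star x * y)"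
      let ?pa = "\<lambda>x y. \<phi> (star x * (star a * a) * y)" and ?qb = "\<lambda>x y. \<psi> (star x * (star b * b) * y)"
      let ?pd = "\<lambda>x y. of_real ((norm a)\<^sup>2) * ?p x y - ?pa x y"
      let ?qd = "\<lambda>x y. of_real ((norm b)\<^sup>2) * ?q x y - ?qb x y"
      have "?G \<phi> \<psi> (map (\<lambda>y. (a * fst y, b * snd y)) ys) (map (\<lambda>y. (a * fst y, b * snd y)) ys) =
        tform ?pa ?qb ys ys" by (simp add: tform_def o_def star_mult mult.assoc)
      \<comment> \<open>Replacing one factor at a time splits the excess of \<open>D\<close> times
        the form over the compressed form into two products of positive forms.\<close>
      moreover have "of_real D * ?G \<phi> \<psi> ys ys =
        tform ?pa ?qb ys ys + of_real ((norm b)\<^sup>2) * tform ?pd ?q ys ys + tform ?pa ?qd ys ys"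
        unfolding tform_def D_def sum_list_const_mult[symmetric] sum_list_addf[symmetric]
        by (simp add: algebra_simps)
      moreover have "0 \<le> Re (tform ?pd ?q ys ys)" "0 \<le> Re (tform ?pa ?qd ys ys)"
        by (intro tform_pos psd_form_mult_diff psd_form_pos_fun psd_form_mult \<phi> \<psi>)+
      ultimately have "Re (of_real D * ?G \<phi> \<psi> ys ys) \<ge>
        Re (?G \<phi> \<psi> (map (\<lambda>y. (a * fst y, b * snd y)) ys) (map (\<lambda>y. (a * fst y, b * snd y)) ys))"
        by simp
      thus ?thesis by simp
    qed
    have "Re (?G \<phi> \<psi> (tmult (x # xs) ys) (tmult (x # xs) ys)) \<le> (2 * D + 2 * C) * Re (?G \<phi> \<psi> ys ys)"
      if \<phi>: "pos_fun \<phi>" and \<psi>: "pos_fun \<psi>" for \<phi> \<psi> ys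
    proof -
      have "Re (?G \<phi> \<psi> (tmult (x # xs) ys) (tmult (x # xs) ys)) \<le>
        2 * Re (?G \<phi> \<psi> (map (\<lambda>y. (a * fst y, b * snd y)) ys) (map (\<lambda>y. (a * fst y, b * snd y)) ys)) +
        2 * Re (?G \<phi> \<psi> (tmult xs ys) (tmult xs ys))"
        unfolding tmult_Cons x fst_conv snd_conv
        by (intro tform_parallelogram psd_form_pos_fun \<phi> \<psi>)
      also have "\<dots> \<le> 2 * (D * Re (?G \<phi> \<psi> ys ys)) + 2 * (C * Re (?G \<phi> \<psi> ys ys))"
        using one[OF \<phi> \<psi>] C(2)[OF \<phi> \<psi>] by (intro add_mono mult_left_mono) auto
      finally show ?thesis by (simp add: algebra_simps)
    qed
    moreover have "2 * D + 2 * C \<ge> 0" using C by (simp add: D_def)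
    ultimately show ?case by blast
  qed
  thus ?thesis using that by blast
qed

section \<open>The free *-algebra and its universal norm\<close>

lemma free_alg_induct [case_names zero add]:
  assumes "P 0" "\<And>x w c. P x \<Longrightarrow> P (x + Poly_Mapping.single w c)"
  shows "P (x :: free_alg)"
proof (induction x rule: update_induct)
  case (update f a b)
  have "Poly_Mapping.update a b f = f + Poly_Mapping.single a b"
    using update.hyps by (intro poly_mapping_eqI)
      (auto simp: lookup_update lookup_add lookup_single when_def in_keys_iff)
  thus ?case using assms(2) update.IH by simp
qed (use assms in simp_all)

definition lin_ext :: "(letters \<Rightarrow> 'b::cstar_algebra) \<Rightarrow> free_alg \<Rightarrow> 'b"
  where "lin_ext h x = (\<Sum>w\<in>Poly_Mapping.keys x. Poly_Mapping.lookup x w *\<^sub>C h w)"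

lemma lin_ext_superset:
  assumes "finite S" "Poly_Mapping.keys x \<subseteq> S"
  shows "lin_ext h x = (\<Sum>w\<in>S. Poly_Mapping.lookup x w *\<^sub>C h w)"
  unfolding lin_ext_def by (rule sum.mono_neutral_left) (use assms in \<open>auto simp: in_keys_iff\<close>)

lemma lin_ext_zero [simp]: "lin_ext h 0 = 0"
  by (simp add: lin_ext_def)

lemma lin_ext_single [simp]: "lin_ext h (Poly_Mapping.single w c) = c *\<^sub>C h w"
  by (cases "c = 0") (simp_all add: lin_ext_def)

lemma lin_ext_add: "lin_ext h (x + y) = lin_ext h x + lin_ext h y"
proof -
  let ?S = "Poly_Mapping.keys x \<union> Poly_Mapping.keys y"
  have "Poly_Mapping.keys (x + y) \<subseteq> ?S" by (rule keys_add)
  thus ?thesis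
    by (simp add: lin_ext_superset[of ?S] lookup_add scaleC_add_left sum.distrib)
qed

lemma lin_ext_fconst_mult: "lin_ext h (fconst c * x) = c *\<^sub>C lin_ext h x"
  by (induction x rule: free_alg_induct)
     (simp_all add: distrib_left mult_single lin_ext_add scaleC_add_right scaleC_scaleC)

lemma fconst_mult_commute: "x * fconst c = fconst c * x"
  by (induction x rule: free_alg_induct) (simp_all add: distrib_left distrib_right mult_single mult.commute)

lemma single_eq_fconst_mult: "Poly_Mapping.single w c = fconst c * Poly_Mapping.single w 1"
  by (simp add: mult_single)

lemma fstar_single [simp]: "fstar (Poly_Mapping.single w c) = Poly_Mapping.single (word_star w) (cnj c)"
  by (cases "c = 0") (simp_all add: fstar_def)

lemma fstar_zero [simp]: "fstar 0 = 0"
  by (simp add: fstar_def)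

lemma fstar_add: "fstar (x + y) = fstar x + fstar y"
proof -
  let ?S = "Poly_Mapping.keys x \<union> Poly_Mapping.keys y"
  have S: "fstar z = (\<Sum>w\<in>?S. Poly_Mapping.single (word_star w) (cnj (Poly_Mapping.lookup z w)))"
    if "Poly_Mapping.keys z \<subseteq> ?S" for z
    unfolding fstar_def by (rule sum.mono_neutral_left) (use that in \<open>auto simp: in_keys_iff\<close>)
  have "Poly_Mapping.keys (x + y) \<subseteq> ?S" by (rule keys_add)
  thus ?thesis by (simp add: S lookup_add single_add sum.distrib)
qed

lemma word_star_zero [simp]: "word_star 0 = 0"
  by (simp add: word_star_def zero_letters_def)

lemma word_star_add: "word_star (u + v) = word_star v + word_star u"
  by (simp add: word_star_def plus_letters_def)

lemma letter_star_letter_star [simp]: "letter_star (letter_star l) = l"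
  by (cases l) simp_all

lemma word_star_word_star [simp]: "word_star (word_star w) = w"
  by (simp add: word_star_def rev_map o_def)

lemma fstar_mult: "fstar (x * y) = fstar y * fstar x"
proof (induction x rule: free_alg_induct)
  case (add x w c)
  have "fstar (Poly_Mapping.single w c * y) = fstar y * fstar (Poly_Mapping.single w c)"
    by (induction y rule: free_alg_induct)
       (simp_all add: distrib_left distrib_right fstar_add mult_single word_star_add mult.commute[of "cnj c"])
  thus ?case using add by (simp add: distrib_left distrib_right fstar_add)
qed simp

lemma fstar_fstar [simp]: "fstar (fstar x) = x"
  by (induction x rule: free_alg_induct) (simp_all add: fstar_add)

lemma fstar_one [simp]: "fstar 1 = 1"
  using fstar_single[of 0 1] by simp

lemma fstar_minus: "fstar (- x) = - fstar x"
  using fstar_add[of x "-x"] by (simp add: eq_neg_iff_add_eq_0 add.commute)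

lemma eval_free_lin_ext: "eval_free a g = lin_ext (\<lambda>w. prod_list (map (eval_letter a g) (letters_of w)))"
  by (rule ext) (simp add: eval_free_def lin_ext_def)

lemma eval_free_add: "eval_free a g (x + y) = eval_free a g x + eval_free a g y"
  by (simp add: eval_free_lin_ext lin_ext_add)

lemma eval_free_zero [simp]: "eval_free a g 0 = 0"
  by (simp add: eval_free_lin_ext)

lemma eval_free_single:
  "eval_free a g (Poly_Mapping.single (Word ls) c) = c *\<^sub>C prod_list (map (eval_letter a g) ls)"
  by (simp add: eval_free_lin_ext)

lemma eval_free_fconst_mult: "eval_free a g (fconst c * x) = c *\<^sub>C eval_free a g x"
  by (simp add: eval_free_lin_ext lin_ext_fconst_mult)

lemma eval_free_fconst: "eval_free a g (fconst c) = c *\<^sub>C 1"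
  by (simp add: eval_free_single zero_letters_def)

lemma eval_free_one [simp]: "eval_free a g 1 = 1"
  using eval_free_single[of a g "[]" 1] by (simp flip: zero_letters_def)

lemma eval_free_fgen [simp]: "eval_free a g (fgen l) = eval_letter a g l"
  by (simp add: eval_free_single)

lemma eval_free_minus: "eval_free a g (- x) = - eval_free a g x"
  using eval_free_add[of a g x "-x"] by (simp add: eq_neg_iff_add_eq_0 add.commute)

lemma eval_free_diff: "eval_free a g (x - y) = eval_free a g x - eval_free a g y"
  using eval_free_add[of a g x "-y"] by (simp add: eval_free_minus)

lemma eval_free_mult: "eval_free a g (x * y) = eval_free a g x * eval_free a g y"
proof (induction x rule: free_alg_induct)
  case (add x w c)
  have "eval_free a g (Poly_Mapping.single w c * y) = eval_free a g (Poly_Mapping.single w c) * eval_free a g y"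
    by (induction y rule: free_alg_induct)
       (simp_all add: distrib_left eval_free_add mult_single eval_free_lin_ext plus_letters_def
          scaleC_mult_left scaleC_mult_right scaleC_scaleC lin_ext_add mult.commute[of c])
  thus ?case using add by (simp add: distrib_right eval_free_add)
qed simp

lemma eval_letter_star: "eval_letter a g (letter_star l) = star (eval_letter a g l)"
  by (cases l) (simp_all add: star_star)

lemma eval_free_fstar: "eval_free a g (fstar x) = star (eval_free a g x)"
proof (induction x rule: free_alg_induct)
  case (add x w c)
  have "prod_list (map (eval_letter a g) (rev (map letter_star ls))) =
      star (prod_list (map (eval_letter a g) ls))" for ls
    by (induction ls) (simp_all add: star_mult eval_letter_star)
  hence "eval_free a g (fstar (Poly_Mapping.single w c)) = star (eval_free a g (Poly_Mapping.single w c))"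
    by (cases w) (simp add: word_star_def eval_free_single star_scaleC)
  thus ?case using add by (simp add: fstar_add eval_free_add star_add)
qed simp

section \<open>Defining relations, states of the polynomial algebra and finiteness of the universal
  norm\<close>

definition su_relations :: "real \<Rightarrow> 'b::cstar_algebra \<Rightarrow> 'b \<Rightarrow> bool"
  where "su_relations q a g \<longleftrightarrow> a * g = q *\<^sub>R (g * a) \<and> a * star g = q *\<^sub>R (star g * a) \<and>
    star g * g = g * star g \<and> star g * g + star a * a = 1 \<and>
    a * star a - star a * a = (1 - q\<^sup>2) *\<^sub>R (star g * g)"

lemma su_relations_iff_relators: "su_relations q a g \<longleftrightarrow> (\<forall>r\<in>relators q. eval_free a g r = 0)"
  by (simp add: su_relations_def relators_def Let_def eval_free_diff eval_free_add eval_free_mult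
      eval_free_fconst scaleC_mult_left scaleR_scaleC)

lemma eval_free_rel_ideal:
  assumes "su_relations q a g" "x \<in> rel_ideal q"
  shows "eval_free a g x = 0"
  using assms(2) by induction
    (use assms(1) in \<open>auto simp: su_relations_iff_relators eval_free_add eval_free_mult eval_free_fstar\<close>)

lemma pol_state_eval_free:
  assumes "su_relations q a g" "state F"
  shows "pol_state q (\<lambda>x. F (eval_free a g x))"
  unfolding pol_state_def
  using assms eval_free_rel_ideal[OF assms(1)]
  by (auto simp: eval_free_add eval_free_fconst scaleC_mult_left eval_free_mult eval_free_fstar state_def
      state_linear[OF assms(2)])

lemma pol_state_simps:
  assumes "pol_state q \<phi>"
  shows "\<phi> (x + y) = \<phi> x + \<phi> y" "\<phi> (fconst c * x) = c * \<phi> x" "\<phi> 1 = 1" "\<phi> 0 = 0"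
    "\<phi> (- x) = - \<phi> x" "\<phi> (x - y) = \<phi> x - \<phi> y" "x \<in> rel_ideal q \<Longrightarrow> \<phi> x = 0" "\<phi> (fstar x * x) \<in> \<real>\<^sub>\<ge>\<^sub>0"
    "0 \<le> Re (\<phi> (fstar x * x))" "\<phi> (fconst c * x * y) = c * \<phi> (x * y)" "\<phi> (x * (fconst c * y)) = c * \<phi> (x * y)"
    "\<phi> (x * fconst c * y) = c * \<phi> (x * y)"
proof -
  show a: "\<phi> (x + y) = \<phi> x + \<phi> y" and c: "\<phi> (fconst c * x) = c * \<phi> x" and "\<phi> 1 = 1"
    and "x \<in> rel_ideal q \<Longrightarrow> \<phi> x = 0" and p: "\<phi> (fstar x * x) \<in> \<real>\<^sub>\<ge>\<^sub>0" for x y c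
    using assms by (auto simp: pol_state_def)
  show z: "\<phi> 0 = 0" using a[of 0 0] by simp
  show m: "\<phi> (- x) = - \<phi> x" for x using a[of x "-x"] z by (simp add: eq_neg_iff_add_eq_0 add.commute)
  show "\<phi> (x - y) = \<phi> x - \<phi> y" using a[of x "-y"] m by simp
  show "0 \<le> Re (\<phi> (fstar x * x))" using p[of x] by (simp add: complex_nonneg_Reals_iff)
  show "\<phi> (fconst c * x * y) = c * \<phi> (x * y)" using c[of c "x * y"] by (simp add: mult.assoc)
  show "\<phi> (x * fconst c * y) = c * \<phi> (x * y)"
    using c[of c "x * y"] by (simp add: fconst_mult_commute mult.assoc)
  thus "\<phi> (x * (fconst c * y)) = c * \<phi> (x * y)" by (simp add: mult.assoc)
qed

lemma fstar_fconst_mult: "fstar (fconst c * x) = fconst (cnj c) * fstar x"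
  by (simp add: fstar_mult fconst_mult_commute)

lemma pol_state_CS_one:
  assumes "pol_state q \<phi>"
  shows "(cmod (\<phi> x))\<^sup>2 \<le> Re (\<phi> (fstar x * x))"
proof -
  note s = pol_state_simps[OF assms]
  have "1 + c * \<phi> x + cnj c * \<phi> (fstar x) + (cnj c * c) * \<phi> (fstar x * x) \<in> \<real>\<^sub>\<ge>\<^sub>0" for c
    using s(8)[of "1 + fconst c * x"]
    by (simp add: fstar_add fstar_fconst_mult distrib_left distrib_right s algebra_simps)
  from hermitian_form_values(2)[OF this] show ?thesis by simp
qed

lemma pol_state_compress:
  assumes "pol_state q \<phi>" "\<phi> (fstar y * y) = 1"
  shows "pol_state q (\<lambda>x. \<phi> (fstar y * x * y))"
proof -
  note s = pol_state_simps[OF assms(1)]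
  have "\<phi> (fstar y * (fstar x * x) * y) \<in> \<real>\<^sub>\<ge>\<^sub>0" for x
    using s(8)[of "x * y"] by (simp add: fstar_mult mult.assoc)
  moreover have "\<phi> (fstar y * x * y) = 0" if "x \<in> rel_ideal q" for x
    using that by (intro s rel_ideal.mult_left rel_ideal.mult_right)
  moreover have "\<phi> (fstar y * (fconst c * x) * y) = c * \<phi> (fstar y * x * y)" for c x
    using s(12)[of "fstar y" c "x * y"] by (simp add: mult.assoc)
  ultimately show ?thesis
    by (auto simp: pol_state_def distrib_left distrib_right s assms(2))
qed

lemma relator_expect:
  assumes "pol_state q \<phi>"
  shows "\<phi> (fstar y * (fgen Gamma_Star * fgen Gamma) * y) + \<phi> (fstar y * (fgen Alpha_Star * fgen Alpha) * y)
      = \<phi> (fstar y * y)"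
    and "\<phi> (fstar y * (fgen Gamma_Star * fgen Gamma) * y) = \<phi> (fstar y * (fgen Gamma * fgen Gamma_Star) * y)"
    and "\<phi> (fstar y * (fgen Alpha * fgen Alpha_Star) * y) = \<phi> (fstar y * (fgen Alpha_Star * fgen Alpha) * y)
      + of_real (1 - q\<^sup>2) * \<phi> (fstar y * (fgen Gamma_Star * fgen Gamma) * y)"
proof -
  note s = pol_state_simps[OF assms]
  have z: "\<phi> (fstar y * r * y) = 0" if "r \<in> relators q" for r
    using that by (intro s rel_ideal.mult_left rel_ideal.mult_right rel_ideal.relator)
  let ?a = "fgen Alpha" and ?a' = "fgen Alpha_Star" and ?c = "fgen Gamma" and ?c' = "fgen Gamma_Star"
  have "\<phi> (fstar y * (?c' * ?c + ?a' * ?a - 1) * y) = 0"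
    by (rule z) (simp add: relators_def Let_def)
  thus "\<phi> (fstar y * (?c' * ?c) * y) + \<phi> (fstar y * (?a' * ?a) * y) = \<phi> (fstar y * y)"
    by (simp only: right_diff_distrib left_diff_distrib distrib_left distrib_right s mult_1_right) simp
  have "\<phi> (fstar y * (?c' * ?c - ?c * ?c') * y) = 0"
    by (rule z) (simp add: relators_def Let_def)
  thus "\<phi> (fstar y * (?c' * ?c) * y) = \<phi> (fstar y * (?c * ?c') * y)"
    by (simp only: right_diff_distrib left_diff_distrib s) simp
  have "\<phi> (fstar y * (?a * ?a' - ?a' * ?a - fconst (of_real (1 - q\<^sup>2)) * (?c' * ?c)) * y) = 0"
    by (rule z) (simp add: relators_def Let_def)
  moreover have "\<phi> (fstar y * (fconst c * (?c' * ?c)) * y) = c * \<phi> (fstar y * (?c' * ?c) * y)" for c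
    using s(12)[of "fstar y" c "(?c' * ?c) * y"] by (simp only: mult.assoc)
  ultimately show "\<phi> (fstar y * (?a * ?a') * y) = \<phi> (fstar y * (?a' * ?a) * y)
      + of_real (1 - q\<^sup>2) * \<phi> (fstar y * (?c' * ?c) * y)"
    by (simp only: right_diff_distrib left_diff_distrib s) (simp add: diff_eq_eq add.commute)
qed

lemma word_star_letter: "word_star (Word [l]) = Word [letter_star l]"
  by (simp add: word_star_def)

text \<open>Every letter acts as a contraction: \<open>\<alpha>\<close> and \<open>\<gamma>\<close>
  because \<open>star \<gamma> * \<gamma> + star \<alpha> * \<alpha> = 1\<close>,
  \<open>star \<gamma>\<close> because \<open>\<gamma>\<close> is normal, and
  \<open>star \<alpha>\<close> because the correction
  \<open>(1 - q\<^sup>2) *\<^sub>R (star \<gamma> * \<gamma>)\<close> is at most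
  \<open>star \<gamma> * \<gamma>\<close>.\<close>

lemma pol_state_letter_bound:
  assumes "pol_state q \<phi>"
  shows "Re (\<phi> (fstar (fgen l * y) * (fgen l * y))) \<le> Re (\<phi> (fstar y * y))"
proof -
  let ?Q = "\<lambda>l. Re (\<phi> (fstar y * (fgen (letter_star l) * fgen l) * y))"
  have eq: "Re (\<phi> (fstar (fgen l * y) * (fgen l * y))) = ?Q l" for l
    by (simp only: fstar_mult fstar_single word_star_letter complex_cnj_one mult.assoc)
  have pos: "0 \<le> ?Q l" for l
    using pol_state_simps(9)[OF assms, of "fgen l * y"] by (simp only: eq)
  have 1: "?Q Gamma + ?Q Alpha = Re (\<phi> (fstar y * y))"
    unfolding relator_expect(1)[OF assms, symmetric] by simp
  have 2: "?Q Gamma_Star = ?Q Gamma" using relator_expect(2)[OF assms, of y] by simp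
  have 3: "?Q Alpha_Star = ?Q Alpha + (1 - q\<^sup>2) * ?Q Gamma"
    using relator_expect(3)[OF assms, of y] by (simp del: of_real_diff of_real_power)
  have "(1 - q\<^sup>2) * ?Q Gamma \<le> 1 * ?Q Gamma" by (rule mult_right_mono[OF _ pos]) simp
  hence "?Q l \<le> Re (\<phi> (fstar y * y))"
    using 1 2 3 pos[of Gamma] pos[of Alpha] by (cases l) simp_all
  thus ?thesis by (simp only: eq)
qed

text \<open>\<open>K\<close> depends on \<open>x\<close> alone, so the set whose supremum defines
  \<open>universal_norm\<close> is bounded above. Words are contractions, and each added monomial
  enlarges the constant through the parallelogram inequality.\<close>

lemma universal_bound:
  obtains K where "\<And>\<phi> y. pol_state q \<phi> \<Longrightarrow> Re (\<phi> (fstar (x * y) * (x * y))) \<le> K * Re (\<phi> (fstar y * y))"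
proof -
  have word: "Re (\<phi> (fstar (Poly_Mapping.single (Word ls) 1 * y) * (Poly_Mapping.single (Word ls) 1 * y)))
      \<le> Re (\<phi> (fstar y * y))" if "pol_state q \<phi>" for \<phi> y ls
  proof (induction ls)
    case Nil
    have "Poly_Mapping.single (Word []) (1::complex) = 1" by (simp flip: zero_letters_def)
    thus ?case by simp
  next
    case (Cons l ls)
    have "Poly_Mapping.single (Word (l # ls)) (1::complex) = fgen l * Poly_Mapping.single (Word ls) 1"
      by (simp add: mult_single plus_letters_def)
    hence "Poly_Mapping.single (Word (l # ls)) (1::complex) * y = fgen l * (Poly_Mapping.single (Word ls) 1 * y)"
      by (simp only: mult.assoc)
    thus ?case using pol_state_letter_bound[OF that, of l "Poly_Mapping.single (Word ls) 1 * y"] Cons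
      by simp
  qed
  have "\<exists>K. \<forall>\<phi> y. pol_state q \<phi> \<longrightarrow> Re (\<phi> (fstar (x * y) * (x * y))) \<le> K * Re (\<phi> (fstar y * y))"
  proof (induction x rule: free_alg_induct)
    case zero
    show ?case by (intro exI[of _ 0]) (auto simp: pol_state_simps)
  next
    case (add x w c)
    then obtain K where K: "\<And>\<phi> y. pol_state q \<phi> \<Longrightarrow>
      Re (\<phi> (fstar (x * y) * (x * y))) \<le> K * Re (\<phi> (fstar y * y))" by blast
    have "Re (\<phi> (fstar ((x + Poly_Mapping.single w c) * y) * ((x + Poly_Mapping.single w c) * y)))
      \<le> (2 * K + 2 * (cmod c)\<^sup>2) * Re (\<phi> (fstar y * y))" if \<phi>: "pol_state q \<phi>" for \<phi> y
    proof -
      note s = pol_state_simps[OF \<phi>]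
      let ?w = "Poly_Mapping.single w (1::complex)"
      define u v where "u = x * y" and "v = Poly_Mapping.single w c * y"
      have "v = fconst c * (?w * y)"
        unfolding v_def by (subst single_eq_fconst_mult) (simp only: mult.assoc)
      hence "\<phi> (fstar v * v) = cnj c * c * \<phi> (fstar (?w * y) * (?w * y))"
        by (simp only: fstar_fconst_mult s mult.assoc)
      hence "Re (\<phi> (fstar v * v)) = (cmod c)\<^sup>2 * Re (\<phi> (fstar (?w * y) * (?w * y)))"
      proof -
        have "cnj c * c = complex_of_real ((cmod c)\<^sup>2)"
          by (metis complex_norm_square mult.commute of_real_power)
        thus ?thesis using \<open>\<phi> (fstar v * v) = _\<close> by simp
      qed
      also have "\<dots> \<le> (cmod c)\<^sup>2 * Re (\<phi> (fstar y * y))"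
        using word[OF \<phi>, of "letters_of w" y] by (intro mult_left_mono) auto
      finally have v: "Re (\<phi> (fstar v * v)) \<le> (cmod c)\<^sup>2 * Re (\<phi> (fstar y * y))" .
      have "0 \<le> Re (\<phi> (fstar (u - v) * (u - v)))" by (rule s)
      moreover have "fstar (u - v) = fstar u - fstar v"
        using fstar_add[of u "-v"] by (simp add: fstar_minus)
      ultimately have "Re (\<phi> (fstar (u + v) * (u + v))) \<le> 2 * Re (\<phi> (fstar u * u)) + 2 * Re (\<phi> (fstar v * v))"
        by (simp add: fstar_add algebra_simps s)
      also have "\<dots> \<le> 2 * (K * Re (\<phi> (fstar y * y))) + 2 * ((cmod c)\<^sup>2 * Re (\<phi> (fstar y * y)))"
        using K[OF \<phi>, of y] v by (simp add: u_def)
      finally show ?thesis by (simp add: u_def v_def algebra_simps)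
    qed
    thus ?case by blast
  qed
  thus ?thesis using that by blast
qed

lemma universal_norm_bdd:
  "bdd_above {sqrt (Re (\<phi> (fstar (x * y) * (x * y)))) | \<phi> y. pol_state q \<phi> \<and> \<phi> (fstar y * y) = 1}"
proof -
  obtain K where K: "\<And>\<phi> y. pol_state q \<phi> \<Longrightarrow> Re (\<phi> (fstar (x * y) * (x * y))) \<le> K * Re (\<phi> (fstar y * y))"
    using universal_bound[of q x] by blast
  show ?thesis
  proof (rule bdd_aboveI[of _ "sqrt K"], elim CollectE exE conjE)
    fix r \<phi> y
    assume "r = sqrt (Re (\<phi> (fstar (x * y) * (x * y))))" "pol_state q \<phi>" "\<phi> (fstar y * y) = 1"
    thus "r \<le> sqrt K" using K[of \<phi> y] by simp
  qed
qed

lemma pol_state_le_universal_norm: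
  assumes "pol_state q \<phi>"
  shows "sqrt (Re (\<phi> (fstar x * x))) \<le> universal_norm q x" "cmod (\<phi> x) \<le> universal_norm q x"
proof -
  have "\<phi> 1 = 1" using assms by (rule pol_state_simps)
  show 1: "sqrt (Re (\<phi> (fstar x * x))) \<le> universal_norm q x"
    unfolding universal_norm_def
    by (rule cSup_upper[OF _ universal_norm_bdd], rule CollectI, rule exI[of _ \<phi>], rule exI[of _ 1])
       (simp add: assms \<open>\<phi> 1 = 1\<close>)
  have "cmod (\<phi> x) \<le> sqrt (Re (\<phi> (fstar x * x)))"
    by (rule real_le_rsqrt[OF pol_state_CS_one[OF assms]])
  thus "cmod (\<phi> x) \<le> universal_norm q x" using 1 by linarith
qed

section \<open>The universal C*-algebra\<close>

lemma star_hom_simps: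
  assumes "star_hom f"
  shows "bounded_clinear f" "f 1 = 1" "f (x * y) = f x * f y" "f (star x) = star (f x)"
  using assms by (auto simp: star_hom_def)

lemmas star_hom_linear = bounded_clinear_simps[OF star_hom_simps(1)]

lemma star_hom_eval_free:
  assumes "star_hom f"
  shows "f (eval_free a g x) = eval_free (f a) (f g) x"
proof (induction x rule: free_alg_induct)
  case zero
  show ?case by (simp add: star_hom_linear[OF assms])
next
  case (add x w c)
  have l: "f (eval_letter a g l) = eval_letter (f a) (f g) l" for l
    by (cases l) (simp_all add: star_hom_simps[OF assms])
  have "f (prod_list (map (eval_letter a g) ls)) = prod_list (map (eval_letter (f a) (f g)) ls)" for ls
    by (induction ls) (simp_all add: star_hom_simps[OF assms] l)
  thus ?case using add
    by (cases w) (simp add: eval_free_add eval_free_single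
        star_hom_linear[OF assms])
qed

lemma nonneg_Reals_limit:
  assumes "(f \<longlongrightarrow> l) F" "F \<noteq> bot" "eventually (\<lambda>x. f x \<in> \<real>\<^sub>\<ge>\<^sub>0) F"
  shows "l \<in> (\<real>\<^sub>\<ge>\<^sub>0 :: complex set)"
  by (rule Lim_in_closed_set[OF closed_nonneg_Reals_complex assms(3,2,1)])

lemma state_dense:
  assumes "bounded_clinear \<Phi>" "closure (range f) = UNIV" "\<And>i. \<Phi> (star (f i) * f i) \<in> \<real>\<^sub>\<ge>\<^sub>0" "\<Phi> 1 = 1"
  shows "state \<Phi>"
  unfolding state_def
proof (intro conjI allI)
  fix x
  obtain s where s: "(\<lambda>n. f (s n)) \<longlonglongrightarrow> x" using dense_sequence[OF assms(2)] .
  have "(\<lambda>n. \<Phi> (star (f (s n)) * f (s n))) \<longlonglongrightarrow> \<Phi> (star x * x)"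
    by (intro bounded_clinear_tendsto[OF assms(1)] tendsto_intros s)
  thus "\<Phi> (star x * x) \<in> \<real>\<^sub>\<ge>\<^sub>0"
    by (rule nonneg_Reals_limit) (simp_all add: assms(3))
qed (use assms in auto)

lemma state_compress:
  assumes "state \<phi>" "\<phi> (star y * y) = 1"
  shows "state (\<lambda>x. \<phi> (star y * x * y))"
  using pos_fun_compress[OF state_pos_fun[OF assms(1)], of y] assms(2)
  by (simp add: state_def pos_fun_def)

lemma state_complex_id: "state (\<lambda>z::complex. z)"
proof -
  have "bounded_clinear (\<lambda>z::complex. z)" by (rule bounded_clinearI[where K = 1]) auto
  moreover have "cnj z * z \<in> \<real>\<^sub>\<ge>\<^sub>0" for z
    by (simp add: complex_nonneg_Reals_iff)
  ultimately show ?thesis by (simp add: state_def)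
qed

lemma bounded_clinear_scaleC_fun: "bounded_clinear f \<Longrightarrow> bounded_clinear (\<lambda>x. c *\<^sub>C f x)"
  unfolding bounded_clinear_def
  by (auto intro: bounded_linear_compose[OF bounded_linear_scaleC] simp: scaleC_scaleC mult.commute)

lemma pos_fun_normalize:
  assumes "pos_fun \<mu>" "Re (\<mu> 1) \<noteq> 0"
  shows "state (\<lambda>x. \<mu> x / \<mu> 1)"
proof -
  have m: "\<mu> 1 = of_real (Re (\<mu> 1))" "Re (\<mu> 1) > 0"
    using pos_fun_one[OF assms(1)] assms(2) by (auto simp: complex_eq_iff)
  have "bounded_clinear (\<lambda>x. \<mu> x / \<mu> 1)"
    using bounded_clinear_scaleC_fun[OF pos_fun_bcl[OF assms(1)], of "1 / \<mu> 1"] by simp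
  moreover have "\<mu> (star x * x) / \<mu> 1 \<in> \<real>\<^sub>\<ge>\<^sub>0" for x
  proof -
    have "\<mu> 1 \<in> \<real>\<^sub>\<ge>\<^sub>0" using m by (metis less_imp_le nonneg_Reals_of_real_iff)
    thus ?thesis using assms(1) by (auto simp: pos_fun_def intro: nonneg_Reals_divide_I)
  qed
  moreover have "\<mu> 1 / \<mu> 1 = 1" using assms(2) by auto
  ultimately show ?thesis by (simp add: state_def)
qed

lemma universal_norm_le:
  assumes "pol_state q \<phi>"
    and "\<And>\<phi> y. pol_state q \<phi> \<Longrightarrow> \<phi> (fstar y * y) = 1 \<Longrightarrow> sqrt (Re (\<phi> (fstar (x * y) * (x * y)))) \<le> B"
  shows "universal_norm q x \<le> B"
  unfolding universal_norm_def
proof (rule cSup_least)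
  have "\<phi> (fstar 1 * 1) = 1" using assms(1) by (simp add: pol_state_simps(3))
  thus "{sqrt (Re (\<phi> (fstar (x * y) * (x * y)))) | \<phi> y. pol_state q \<phi> \<and> \<phi> (fstar y * y) = 1} \<noteq> {}"
    using assms(1) by blast
qed (use assms(2) in blast)

locale csuq2 =
  fixes q :: real and \<alpha> \<gamma> :: "'a::cstar_algebra"
  assumes q_range: "q \<in> {-1<..<0} \<union> {0<..<1}"
    and universal: "is_CSUq2 q \<alpha> \<gamma>"
begin

lemma q_nonzero: "q \<noteq> 0" and q_square: "0 < q\<^sup>2" "q\<^sup>2 < 1"
proof -
  have "\<bar>q\<bar> < 1" "q \<noteq> 0" using q_range by auto
  thus "q \<noteq> 0" "0 < q\<^sup>2" "q\<^sup>2 < 1" by (auto simp: abs_square_less_1)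
qed

abbreviation ev :: "free_alg \<Rightarrow> 'a"
  where "ev \<equiv> eval_free \<alpha> \<gamma>"

lemma norm_ev: "norm (ev x) = universal_norm q x"
  and dense_ev: "closure (range ev) = UNIV"
  using universal by (auto simp: is_CSUq2_def)

text \<open>Without states, the supremum defining the norm would be taken over the empty set for
  every element, and \<open>1\<close> would have the same norm as \<open>0\<close>.\<close>

lemma pol_state_exists: "\<exists>\<phi>. pol_state q \<phi>"
proof (rule ccontr)
  assume *: "\<not> ?thesis"
  have "norm (ev 1) = norm (ev 0)" unfolding norm_ev universal_norm_def using * by simp
  thus False by simp
qed

lemma ev_rel_ideal:
  assumes "x \<in> rel_ideal q" shows "ev x = 0"
proof -
  obtain \<phi> where "pol_state q \<phi>" using pol_state_exists by blast
  hence "universal_norm q x \<le> 0"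
  proof (rule universal_norm_le)
    fix \<psi> y assume \<psi>: "pol_state q \<psi>"
    have "fstar (x * y) * (x * y) \<in> rel_ideal q"
      by (intro rel_ideal.mult_left rel_ideal.mult_right assms)
    thus "sqrt (Re (\<psi> (fstar (x * y) * (x * y)))) \<le> 0" by (simp add: pol_state_simps(7)[OF \<psi>])
  qed
  thus ?thesis by (simp flip: norm_ev)
qed

lemma relations: "su_relations q \<alpha> \<gamma>"
  unfolding su_relations_iff_relators using ev_rel_ideal rel_ideal.relator by blast

lemma state_extension:
  assumes "pol_state q \<phi>"
  obtains \<Phi> where "state \<Phi>" "\<And>x. \<Phi> (ev x) = \<phi> x"
proof -
  obtain \<Phi> where \<Phi>: "bounded_clinear \<Phi>" "\<And>x. \<Phi> (ev x) = \<phi> x"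
  proof (rule bounded_clinear_extension[of ev \<phi> 1])
    fix x y c
    show "\<exists>z. ev z = ev x + ev y \<and> \<phi> z = \<phi> x + \<phi> y"
      by (rule exI[of _ "x + y"]) (simp add: eval_free_add pol_state_simps[OF assms])
    show "\<exists>z. ev z = c *\<^sub>C ev x \<and> \<phi> z = c *\<^sub>C \<phi> x"
      by (rule exI[of _ "fconst c * x"]) (simp add: eval_free_fconst_mult pol_state_simps[OF assms])
    show "norm (\<phi> x) \<le> 1 * norm (ev x)"
      using pol_state_le_universal_norm(2)[OF assms] by (simp add: norm_ev)
  qed (use dense_ev in auto)
  have "\<Phi> (star (ev x) * ev x) \<in> \<real>\<^sub>\<ge>\<^sub>0" for x
    using pol_state_simps(8)[OF assms, of x] \<Phi>(2)[of "fstar x * x"]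
    by (simp add: eval_free_mult eval_free_fstar)
  moreover have "\<Phi> 1 = 1" using \<Phi>(2)[of 1] by (simp add: pol_state_simps(3)[OF assms])
  ultimately have "state \<Phi>" by (intro state_dense[OF \<Phi>(1) dense_ev])
  thus ?thesis using \<Phi> that by blast
qed

lemma state_exists: "\<exists>\<phi>::'a \<Rightarrow> complex. state \<phi>"
  using pol_state_exists state_extension by metis

text \<open>The universal property, reduced to a norm estimate on polynomials. It serves twice: for
  the comultiplication and for the characters that evaluate at points of the circle.\<close>

lemma star_hom_extension:
  fixes a g :: "'c::cstar_algebra"
  assumes "\<And>x. norm (eval_free a g x) \<le> norm (ev x)"
  obtains D where "star_hom D" "D \<alpha> = a" "D \<gamma> = g"
proof -
  let ?e = "eval_free a g"
  obtain D where D: "bounded_clinear D" "\<And>x. D (ev x) = ?e x"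
  proof (rule bounded_clinear_extension[of ev ?e 1])
    fix x y c
    show "\<exists>z. ev z = ev x + ev y \<and> ?e z = ?e x + ?e y"
      by (rule exI[of _ "x + y"]) (simp add: eval_free_add)
    show "\<exists>z. ev z = c *\<^sub>C ev x \<and> ?e z = c *\<^sub>C ?e x"
      by (rule exI[of _ "fconst c * x"]) (simp add: eval_free_fconst_mult)
  qed (use dense_ev assms in auto)
  have "star_hom D" unfolding star_hom_def
  proof (intro conjI allI)
    show "D 1 = 1" using D(2)[of 1] by simp
    fix x y
    obtain s where s: "(\<lambda>n. ev (s n)) \<longlonglongrightarrow> x" using dense_sequence[OF dense_ev] .
    obtain t where t: "(\<lambda>n. ev (t n)) \<longlonglongrightarrow> y" using dense_sequence[OF dense_ev] .
    have "(\<lambda>n. D (ev (s n) * ev (t n))) \<longlonglongrightarrow> D (x * y)"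
      by (intro bounded_clinear_tendsto[OF D(1)] tendsto_intros s t)
    moreover have "(\<lambda>n. D (ev (s n)) * D (ev (t n))) \<longlonglongrightarrow> D x * D y"
      by (intro bounded_clinear_tendsto[OF D(1)] tendsto_intros s t)
    moreover have "D (ev (s n) * ev (t n)) = D (ev (s n)) * D (ev (t n))" for n
      using D(2)[of "s n * t n"] by (simp add: eval_free_mult D(2))
    ultimately show "D (x * y) = D x * D y" by (simp add: LIMSEQ_unique)
    have "(\<lambda>n. D (star (ev (s n)))) \<longlonglongrightarrow> D (star x)"
      by (intro bounded_clinear_tendsto[OF D(1)] tendsto_intros s)
    moreover have "(\<lambda>n. star (D (ev (s n)))) \<longlonglongrightarrow> star (D x)"
      by (intro tendsto_star bounded_clinear_tendsto[OF D(1)] s)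
    moreover have "D (star (ev (s n))) = star (D (ev (s n)))" for n
      using D(2)[of "fstar (s n)"] by (simp add: eval_free_fstar D(2))
    ultimately show "D (star x) = star (D x)" by (simp add: LIMSEQ_unique)
  qed (rule D)
  moreover have "D \<alpha> = a" "D \<gamma> = g" using D(2)[of "fgen Alpha"] D(2)[of "fgen Gamma"] by simp_all
  ultimately show ?thesis using that by blast
qed

lemma star_hom_eqI:
  assumes "star_hom D" "star_hom D'" "D \<alpha> = D' \<alpha>" "D \<gamma> = D' \<gamma>"
  shows "D = D'"
  by (rule dense_bounded_clinear_eqI[OF dense_ev star_hom_simps(1)[OF assms(1)] star_hom_simps(1)[OF assms(2)]])
     (simp add: star_hom_eval_free assms)

text \<open>For polynomials, a vector state in a GNS representation is a compression of a state and
  hence again a state of the completed algebra, so the hypothesis controls the supremum that defines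
  the norm. The general case follows by density, with the error \<open>\<delta> n\<close> uniform in
  the state.\<close>

lemma norm_le_if_states_le:
  fixes y :: 'a
  assumes "\<And>\<rho>. state \<rho> \<Longrightarrow> Re (\<rho> (star y * y)) \<le> B\<^sup>2" "0 \<le> B"
  shows "norm y \<le> B"
proof -
  have poly: "norm (ev x) \<le> sqrt C" if C: "\<And>\<rho>. state \<rho> \<Longrightarrow> Re (\<rho> (star (ev x) * ev x)) \<le> C" for x C
  proof -
    obtain \<phi>0 where "pol_state q \<phi>0" using pol_state_exists by blast
    thus ?thesis unfolding norm_ev
    proof (rule universal_norm_le)
      fix \<phi> y assume r: "pol_state q \<phi>" "\<phi> (fstar y * y) = 1"
      obtain \<Phi> where \<Phi>: "state \<Phi>" "\<And>x. \<Phi> (ev x) = \<phi> (fstar y * x * y)"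
        using state_extension[OF pol_state_compress[OF r]] by blast
      have "\<Phi> (star (ev x) * ev x) = \<phi> (fstar (x * y) * (x * y))"
        using \<Phi>(2)[of "fstar x * x"] by (simp add: eval_free_mult eval_free_fstar fstar_mult mult.assoc)
      thus "sqrt (Re (\<phi> (fstar (x * y) * (x * y)))) \<le> sqrt C" using C[OF \<Phi>(1)] by simp
    qed
  qed
  obtain s where s: "(\<lambda>n. ev (s n)) \<longlonglongrightarrow> y" using dense_sequence[OF dense_ev] .
  define \<delta> where "\<delta> n = norm (star (ev (s n)) * ev (s n) - star y * y)" for n
  have "(\<lambda>n. star (ev (s n)) * ev (s n) - star y * y) \<longlonglongrightarrow> star y * y - star y * y"
    by (intro tendsto_intros s)
  hence \<delta>: "\<delta> \<longlonglongrightarrow> 0" unfolding \<delta>_def using tendsto_norm by fastforce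
  have "norm (ev (s n)) \<le> sqrt (B\<^sup>2 + \<delta> n)" for n
  proof (rule poly)
    fix \<rho> :: "'a \<Rightarrow> complex" assume \<rho>: "state \<rho>"
    have "Re (\<rho> (star (ev (s n)) * ev (s n))) =
      Re (\<rho> (star y * y)) + Re (\<rho> (star (ev (s n)) * ev (s n) - star y * y))"
      by (simp add: state_linear[OF \<rho>])
    also have "Re (\<rho> (star (ev (s n)) * ev (s n) - star y * y)) \<le> \<delta> n"
      unfolding \<delta>_def using complex_Re_le_cmod state_bound[OF \<rho>] order_trans by blast
    finally show "Re (\<rho> (star (ev (s n)) * ev (s n))) \<le> B\<^sup>2 + \<delta> n" using assms(1)[OF \<rho>] by linarith
  qed
  moreover have "(\<lambda>n. sqrt (B\<^sup>2 + \<delta> n)) \<longlonglongrightarrow> sqrt (B\<^sup>2 + 0)"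
    by (intro tendsto_intros \<delta>)
  ultimately have "norm y \<le> sqrt (B\<^sup>2 + 0)"
    using LIMSEQ_le[OF tendsto_norm[OF s]] by blast
  thus ?thesis using assms(2) by simp
qed

text \<open>Polarization: compressing a state by \<open>y + c *\<^sub>C 1\<close> gives another
  functional vanishing at \<open>y\<close>. Comparing \<open>c = 0\<close>, \<open>c = 1\<close> and
  \<open>c = \<i>\<close> isolates \<open>\<rho> (star y * y) = 0\<close>, and these values bound
  the norm.\<close>

lemma states_separate:
  fixes y :: 'a
  assumes "\<And>\<rho>. state \<rho> \<Longrightarrow> \<rho> y = 0"
  shows "y = 0"
proof -
  have pos: "\<mu> y = 0" if "pos_fun \<mu>" for \<mu>
  proof (cases "Re (\<mu> 1) = 0")
    case True
    thus ?thesis using pos_fun_bound[OF that, of y] by simp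
  next
    case False
    thus ?thesis using assms[OF pos_fun_normalize[OF that False]] by auto
  qed
  have "norm y \<le> 0"
  proof (rule norm_le_if_states_le)
    fix \<rho> :: "'a \<Rightarrow> complex" assume \<rho>: "state \<rho>"
    have *: "\<rho> (star y * y * y) + c * \<rho> (star y * y) + cnj c * \<rho> (y * y) = 0" for c
    proof -
      have "\<rho> (star (y + c *\<^sub>C 1) * y * (y + c *\<^sub>C 1)) = 0"
        by (rule pos) (rule pos_fun_compress[OF state_pos_fun[OF \<rho>]])
      thus ?thesis
        by (simp add: star_add star_scaleC distrib_left distrib_right scaleC_mult_left scaleC_mult_right
            state_linear[OF \<rho>] assms[OF \<rho>] mult.assoc add_ac)
    qed
    have 1: "\<rho> (star y * y) + \<rho> (y * y) = 0" using *[of 1] *[of 0] by simp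
    have 2: "\<i> * \<rho> (star y * y) - \<i> * \<rho> (y * y) = 0" using *[of \<i>] *[of 0] by simp
    hence "\<rho> (star y * y) = \<rho> (y * y)" by simp
    thus "Re (\<rho> (star y * y)) \<le> 0\<^sup>2" using 1 by simp
  qed simp
  thus ?thesis by simp
qed

lemma star_hom_character:
  assumes "cmod w = 1"
  obtains e where "star_hom e" "e \<alpha> = w" "e \<gamma> = (0::complex)"
proof (rule star_hom_extension)
  have "w * cnj w = 1" using assms by (simp add: complex_norm_square[symmetric])
  hence "su_relations q w 0" by (simp add: su_relations_def mult.commute)
  hence "pol_state q (\<lambda>x. eval_free w 0 x)" using pol_state_eval_free state_complex_id by blast
  thus "cmod (eval_free w 0 x) \<le> norm (ev x)" for x
    unfolding norm_ev by (rule pol_state_le_universal_norm)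
qed (use that in blast)

text \<open>The relations oriented as rewrite rules: \<open>star \<alpha>\<close> moves to the left,
  \<open>\<alpha>\<close> to the right, \<open>star \<gamma>\<close> before \<open>\<gamma>\<close>,
  and adjacent \<open>\<alpha>\<close> and \<open>star \<alpha>\<close> are eliminated.
  Simplification with them settles the identities between generators below.\<close>

lemma normal_order:
  "\<alpha> * \<gamma> = q *\<^sub>R (\<gamma> * \<alpha>)" "\<alpha> * star \<gamma> = q *\<^sub>R (star \<gamma> * \<alpha>)" "\<gamma> * star \<gamma> = star \<gamma> * \<gamma>"
  "star \<alpha> * \<alpha> = 1 - star \<gamma> * \<gamma>" "\<alpha> * star \<alpha> = 1 - q\<^sup>2 *\<^sub>R (star \<gamma> * \<gamma>)"
  "star \<gamma> * star \<alpha> = q *\<^sub>R (star \<alpha> * star \<gamma>)" "\<gamma> * star \<alpha> = q *\<^sub>R (star \<alpha> * \<gamma>)"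
proof -
  note r = relations[unfolded su_relations_def]
  show "\<alpha> * \<gamma> = q *\<^sub>R (\<gamma> * \<alpha>)" "\<alpha> * star \<gamma> = q *\<^sub>R (star \<gamma> * \<alpha>)" "\<gamma> * star \<gamma> = star \<gamma> * \<gamma>"
    using r by simp_all
  have "star \<gamma> * \<gamma> + star \<alpha> * \<alpha> = 1" using r by blast
  thus 1: "star \<alpha> * \<alpha> = 1 - star \<gamma> * \<gamma>" by (simp add: eq_diff_eq add.commute)
  show "\<alpha> * star \<alpha> = 1 - q\<^sup>2 *\<^sub>R (star \<gamma> * \<gamma>)"
  proof -
    have "\<alpha> * star \<alpha> - star \<alpha> * \<alpha> = (1 - q\<^sup>2) *\<^sub>R (star \<gamma> * \<gamma>)" using r by blast
    thus ?thesis by (simp add: 1 diff_eq_eq scaleR_diff_left)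
  qed
  show "star \<gamma> * star \<alpha> = q *\<^sub>R (star \<alpha> * star \<gamma>)" "\<gamma> * star \<alpha> = q *\<^sub>R (star \<alpha> * \<gamma>)"
    using r by (metis star_mult star_scaleR, metis star_mult star_scaleR star_star)
qed

end

section \<open>Product states and the comultiplication\<close>

locale csuq2_tensor = csuq2 q \<alpha> \<gamma> for q :: real and \<alpha> \<gamma> :: "'a::cstar_algebra" +
  fixes tens :: "'a \<Rightarrow> 'a \<Rightarrow> 'b::cstar_algebra"
  assumes spatial: "is_spatial_tensor tens"
begin

lemma tens_simps:
  "tens (a + a') b = tens a b + tens a' b" "tens a (b + b') = tens a b + tens a b'"
  "tens (c *\<^sub>C a) b = c *\<^sub>C tens a b" "tens a (c *\<^sub>C b) = c *\<^sub>C tens a b"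
  "tens 1 1 = 1" "tens a b * tens a' b' = tens (a * a') (b * b')" "star (tens a b) = tens (star a) (star b)"
  using spatial by (auto simp: is_spatial_tensor_def)

lemma tens_simps':
  "tens (r *\<^sub>R a) b = r *\<^sub>R tens a b" "tens a (r *\<^sub>R b) = r *\<^sub>R tens a b"
  "tens (- a) b = - tens a b" "tens a (- b) = - tens a b"
  "tens (a - a') b = tens a b - tens a' b" "tens a (b - b') = tens a b - tens a b'"
  "tens 0 b = 0" "tens a 0 = 0"
proof -
  show "tens (r *\<^sub>R a) b = r *\<^sub>R tens a b" "tens a (r *\<^sub>R b) = r *\<^sub>R tens a b" for r a b
    by (simp_all add: scaleR_scaleC tens_simps)
  show 1: "tens (- a) b = - tens a b" "tens a (- b) = - tens a b" for a b
    using tens_simps(3)[of "-1" a b] tens_simps(4)[of a "-1" b] by simp_all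
  show "tens (a - a') b = tens a b - tens a' b" "tens a (b - b') = tens a b - tens a b'"
    using tens_simps(1)[of a "-a'" b] tens_simps(2)[of a b "-b'"] by (simp_all add: 1)
  show "tens 0 b = 0" "tens a 0 = 0"
    using tens_simps(3)[of 0 0 b] tens_simps(4)[of a 0 0] by simp_all
qed

definition T :: "'a tensors \<Rightarrow> 'b"
  where "T xs = (\<Sum>(a, b)\<leftarrow>xs. tens a b)"

lemma T_simps: "T [] = 0" "T (x # xs) = tens (fst x) (snd x) + T xs" "T (xs @ ys) = T xs + T ys"
  by (simp_all add: T_def case_prod_unfold)

lemma T_tmult: "T (tmult xs ys) = T xs * T ys"
proof (induction xs)
  case (Cons x xs)
  have "T (map (\<lambda>y. (fst x * fst y, snd x * snd y)) ys) = tens (fst x) (snd x) * T ys"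
    by (induction ys) (simp_all add: T_simps distrib_left tens_simps)
  thus ?case using Cons by (simp add: tmult_Cons T_simps distrib_right)
qed (simp add: T_simps tmult_def)

lemma T_tstar: "T (tstar xs) = star (T xs)"
  by (induction xs) (simp_all add: tstar_def T_simps case_prod_unfold star_add tens_simps)

lemma T_scale: "T (map (map_prod (\<lambda>a. c *\<^sub>C a) id) xs) = c *\<^sub>C T xs"
  by (induction xs) (simp_all add: T_simps tens_simps scaleC_add_right)

lemma norm_T: "norm (T xs) = spatial_norm xs" and dense_T: "closure (range T) = UNIV"
  using spatial by (auto simp: is_spatial_tensor_def T_def[abs_def])

lemma tensor_eqI:
  assumes "bounded_clinear F" "bounded_clinear G" "\<And>a b. F (tens a b) = G (tens a b)"
  shows "F = G"
proof (rule dense_bounded_clinear_eqI[OF dense_T assms(1,2)])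
  show "F (T xs) = G (T xs)" for xs
    by (induction xs) (simp_all add: T_simps assms(3) bounded_clinear_simps[OF assms(1)]
        bounded_clinear_simps[OF assms(2)])
qed

lemma tensor_lift_eqI:
  assumes "bounded_clinear F" "\<And>a b. F (tens a b) = B a b"
  shows "tensor_lift tens B = F"
  unfolding tensor_lift_def
  by (rule the_equality) (simp_all add: assms tensor_eqI)

lemma spatial_norm_upper:
  assumes "state \<phi>" "state \<psi>" "tfun \<phi> \<psi> (tmult (tstar ys) ys) = 1"
  shows "sqrt (Re (tfun \<phi> \<psi> (tmult (tstar (tmult xs ys)) (tmult xs ys)))) \<le> spatial_norm xs"
  unfolding spatial_norm_def
proof (rule cSup_upper)
  obtain C where C: "C \<ge> 0" "\<And>\<phi> \<psi> ys. pos_fun \<phi> \<Longrightarrow> pos_fun \<psi> \<Longrightarrow>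
    Re (tfun \<phi> \<psi> (tmult (tstar (tmult xs ys)) (tmult xs ys))) \<le> C * Re (tfun \<phi> \<psi> (tmult (tstar ys) ys))"
    using tform_mult_bound[of xs] unfolding tform_tfun by metis
  show "bdd_above {sqrt (Re (tfun \<phi> \<psi> (tmult (tstar (tmult xs ys)) (tmult xs ys)))) | \<phi> \<psi> ys.
      state \<phi> \<and> state \<psi> \<and> tfun \<phi> \<psi> (tmult (tstar ys) ys) = 1}"
  proof (rule bdd_aboveI[of _ "sqrt C"], elim CollectE exE conjE)
    fix r \<phi> \<psi> ys
    assume "r = sqrt (Re (tfun \<phi> \<psi> (tmult (tstar (tmult xs ys)) (tmult xs ys))))" "state \<phi>" "state \<psi>"
      "tfun \<phi> \<psi> (tmult (tstar ys) ys) = 1"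
    thus "r \<le> sqrt C" using C(2)[of \<phi> \<psi> ys] by (simp add: state_pos_fun)
  qed
qed (use assms in blast)

text \<open>Positivity on formal sums is the Schur product theorem, and boundedness is
  Cauchy-Schwarz against the unit tensor, whose GNS vector already occurs in the supremum of
  \<open>spatial_norm\<close>.\<close>

lemma product_state_exists:
  assumes "state \<phi>" "state \<psi>"
  obtains F where "state F" "\<And>a b. F (tens a b) = \<phi> a * \<psi> b"
proof -
  note lin = state_linear[OF assms(1)]
  let ?s = "\<lambda>x y. \<phi> (star x * y)" and ?t = "\<lambda>x y. \<psi> (star x * y)"
  have psd: "psd_form ?s" "psd_form ?t"
    by (intro psd_form_pos_fun state_pos_fun assms)+
  have ones: "tfun \<phi> \<psi> [(1, 1)] = 1" using assms by (simp add: tfun_def state_one)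
  obtain F where F: "bounded_clinear F" "\<And>xs. F (T xs) = tfun \<phi> \<psi> xs"
  proof (rule bounded_clinear_extension[of T "tfun \<phi> \<psi>" 1])
    fix xs ys :: "'a tensors" and c
    show "\<exists>zs. T zs = T xs + T ys \<and> tfun \<phi> \<psi> zs = tfun \<phi> \<psi> xs + tfun \<phi> \<psi> ys"
      by (rule exI[of _ "xs @ ys"]) (simp add: T_simps tfun_append)
    have "tfun \<phi> \<psi> (map (map_prod (\<lambda>a. c *\<^sub>C a) id) xs) = c * tfun \<phi> \<psi> xs"
      by (induction xs) (simp_all add: tfun_def lin case_prod_unfold algebra_simps)
    thus "\<exists>zs. T zs = c *\<^sub>C T xs \<and> tfun \<phi> \<psi> zs = c *\<^sub>C tfun \<phi> \<psi> xs"
      by (intro exI[of _ "map (map_prod (\<lambda>a. c *\<^sub>C a) id) xs"]) (simp add: T_scale)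
    have one: "tmult xs [(1, 1)] = xs" for xs :: "'a tensors" by (induction xs) (simp_all add: tmult_def)
    have one': "tmult (tstar [(1, 1)]) xs = xs" for xs :: "'a tensors" by (simp add: tmult_def tstar_def)
    have "(cmod (tform ?s ?t [(1, 1)] xs))\<^sup>2 \<le> Re (tform ?s ?t [(1, 1)] [(1, 1)]) * Re (tform ?s ?t xs xs)"
      by (rule tform_CS[OF psd])
    hence "cmod (tfun \<phi> \<psi> xs) \<le> sqrt (Re (tfun \<phi> \<psi> (tmult (tstar xs) xs)))"
      unfolding tform_tfun one' by (intro real_le_rsqrt) (simp add: ones)
    also have "\<dots> \<le> spatial_norm xs"
      using spatial_norm_upper[OF assms, of "[(1, 1)]" xs] by (simp add: one one' ones tstar_def)
    finally show "norm (tfun \<phi> \<psi> xs) \<le> 1 * norm (T xs)" by (simp add: norm_T)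
  qed (auto simp: dense_T)
  have FT: "F (tens a b) = \<phi> a * \<psi> b" for a b using F(2)[of "[(a, b)]"] by (simp add: T_simps tfun_def)
  have "state F"
  proof (rule state_dense[OF F(1) dense_T])
    fix xs
    have "F (star (T xs) * T xs) = tform ?s ?t xs xs"
      unfolding tform_tfun by (simp add: T_tmult T_tstar flip: F(2))
    moreover have "Im (tform ?s ?t xs xs) = 0" using tform_herm[OF psd, of xs xs]
      by (metis cnj.simps(2) neg_equal_zero)
    ultimately show "F (star (T xs) * T xs) \<in> \<real>\<^sub>\<ge>\<^sub>0"
      using tform_pos[OF psd, of xs] by (simp add: complex_nonneg_Reals_iff)
  next
    show "F 1 = 1" using FT[of 1 1] assms by (simp add: tens_simps state_one)
  qed
  thus ?thesis using FT that by blast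
qed

definition product_state :: "('a \<Rightarrow> complex) \<Rightarrow> ('a \<Rightarrow> complex) \<Rightarrow> 'b \<Rightarrow> complex"
  where "product_state \<phi> \<psi> = tensor_lift tens (\<lambda>a b. \<phi> a * \<psi> b)"

lemma product_state:
  assumes "state \<phi>" "state \<psi>"
  shows "state (product_state \<phi> \<psi>)" "product_state \<phi> \<psi> (tens a b) = \<phi> a * \<psi> b"
proof -
  obtain F where F: "state F" "\<And>a b. F (tens a b) = \<phi> a * \<psi> b"
    using product_state_exists[OF assms] by blast
  have "product_state \<phi> \<psi> = F"
    unfolding product_state_def using F by (intro tensor_lift_eqI) (auto simp: state_bcl)
  thus "state (product_state \<phi> \<psi>)" "product_state \<phi> \<psi> (tens a b) = \<phi> a * \<psi> b" using F by auto
qed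

lemma product_state_T: "state \<phi> \<Longrightarrow> state \<psi> \<Longrightarrow> product_state \<phi> \<psi> (T xs) = tfun \<phi> \<psi> xs"
  by (induction xs) (auto simp: T_simps tfun_def case_prod_unfold product_state
      state_linear[OF product_state(1)])

lemma slice_bound:
  assumes "state P" "z \<in> \<real>\<^sub>\<ge>\<^sub>0" "P (star w * w) = z" "P (star w * t) = z"
  shows "Re z \<le> (norm (t::'b))\<^sup>2"
proof -
  have "(cmod (P (star w * t)))\<^sup>2 \<le> Re (P (star w * w)) * Re (P (star t * t))"
    by (rule pos_fun_CS[OF state_pos_fun[OF assms(1)]])
  also have "\<dots> \<le> Re (P (star w * w)) * (norm t)\<^sup>2"
    using state_bound[OF assms(1), of "star t * t"] complex_Re_le_cmod[of "P (star t * t)"] assms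
    by (intro mult_left_mono) (auto simp: cstar_identity complex_nonneg_Reals_iff)
  finally have "(Re z)\<^sup>2 \<le> Re z * (norm t)\<^sup>2"
    using assms(2) by (simp add: assms(3,4) cmod_power2 complex_nonneg_Reals_iff)
  thus ?thesis by (cases "Re z = 0")
    (use assms(2) in \<open>auto simp: power2_eq_square complex_nonneg_Reals_iff\<close>)
qed

text \<open>The norm of a slice \<open>g\<close> of a tensor \<open>t\<close> is tested by states
  \<open>\<rho>\<close>. Here \<open>P\<close> is a product of \<open>\<rho>\<close> with the sliced
  state, and \<open>e\<close> embeds \<open>z\<close> into the other leg. At \<open>z = g\<close>
  Cauchy-Schwarz for \<open>P\<close> bounds the value of \<open>\<rho>\<close> at
  \<open>star g * g\<close> by the squared norm of \<open>t\<close>.\<close>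

lemma slice_extension:
  fixes B :: "'a \<Rightarrow> 'a \<Rightarrow> 'a"
  assumes scale: "\<And>c a b. B (c *\<^sub>C a) b = c *\<^sub>C B a b"
    and dominated: "\<And>\<rho>. state \<rho> \<Longrightarrow> \<exists>P e. state P \<and> (\<forall>z a b. P (star (e z) * tens a b) = \<rho> (star z * B a b)) \<and>
      (\<forall>z. P (star (e z) * e z) = \<rho> (star z * z))"
  obtains F where "bounded_clinear F" "\<And>a b. F (tens a b) = B a b"
proof -
  define g where "g xs = (\<Sum>x\<leftarrow>xs. B (fst x) (snd x))" for xs
  obtain F where F: "bounded_clinear F" "\<And>xs. F (T xs) = g xs"
  proof (rule bounded_clinear_extension[of T g 1])
    fix xs ys :: "'a tensors" and c
    show "\<exists>zs. T zs = T xs + T ys \<and> g zs = g xs + g ys"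
      by (rule exI[of _ "xs @ ys"]) (simp add: T_simps g_def)
    have "g (map (map_prod (\<lambda>a. c *\<^sub>C a) id) xs) = c *\<^sub>C g xs"
      by (induction xs) (simp_all add: g_def scale scaleC_add_right)
    thus "\<exists>zs. T zs = c *\<^sub>C T xs \<and> g zs = c *\<^sub>C g xs"
      by (intro exI[of _ "map (map_prod (\<lambda>a. c *\<^sub>C a) id) xs"]) (simp add: T_scale)
    have "norm (g xs) \<le> norm (T xs)"
    proof (rule norm_le_if_states_le)
      fix \<rho> :: "'a \<Rightarrow> complex" assume \<rho>: "state \<rho>"
      obtain P e where P: "state P" "\<And>z a b. P (star (e z) * tens a b) = \<rho> (star z * B a b)"
        "\<And>z. P (star (e z) * e z) = \<rho> (star z * z)" using dominated[OF \<rho>] by blast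
      have "P (star (e z) * T xs) = \<rho> (star z * g xs)" for z
        by (induction xs) (simp_all add: T_simps g_def distrib_left P state_linear[OF P(1)] state_linear[OF \<rho>])
      thus "Re (\<rho> (star (g xs) * g xs)) \<le> (norm (T xs))\<^sup>2"
        by (intro slice_bound[OF P(1), where w = "e (g xs)"]) (use \<rho> in \<open>simp_all add: state_def P\<close>)
    qed simp
    thus "norm (g xs) \<le> 1 * norm (T xs)" by simp
  qed (auto simp: dense_T)
  have "F (tens a b) = B a b" for a b using F(2)[of "[(a, b)]"] by (simp add: T_simps g_def)
  thus ?thesis using F that by blast
qed

lemma left_slice:
  assumes "state h"
  obtains F where "bounded_clinear F" "\<And>a b. F (tens a b) = h a *\<^sub>C b"
proof (rule slice_extension)
  show "\<exists>P e. state P \<and> (\<forall>z a b. P (star (e z) * tens a b) = \<rho> (star z * h a *\<^sub>C b)) \<and>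
      (\<forall>z. P (star (e z) * e z) = \<rho> (star z * z))" if "state \<rho>" for \<rho>
    by (rule exI[of _ "product_state h \<rho>"], rule exI[of _ "tens 1"])
       (simp add: product_state[OF assms that] tens_simps state_linear[OF that] scaleC_mult_right state_one[OF assms])
qed (simp_all add: state_linear[OF assms] scaleC_scaleC that)

lemma right_slice:
  assumes "state h"
  obtains F where "bounded_clinear F" "\<And>a b. F (tens a b) = h b *\<^sub>C a"
proof (rule slice_extension)
  show "\<exists>P e. state P \<and> (\<forall>z a b. P (star (e z) * tens a b) = \<rho> (star z * h b *\<^sub>C a)) \<and>
      (\<forall>z. P (star (e z) * e z) = \<rho> (star z * z))" if "state \<rho>" for \<rho>
    by (rule exI[of _ "product_state \<rho> h"], rule exI[of _ "\<lambda>z. tens z 1"])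
       (simp add: product_state[OF that assms] tens_simps state_linear[OF that] scaleC_mult_right state_one[OF assms] mult.commute)
qed (simp_all add: scaleC_scaleC mult.commute that)

section \<open>Construction of the comultiplication\<close>

definition \<delta>\<alpha> :: 'b where "\<delta>\<alpha> = tens \<alpha> \<alpha> - q *\<^sub>R tens (star \<gamma>) \<gamma>"
definition \<delta>\<gamma> :: 'b where "\<delta>\<gamma> = tens \<gamma> \<alpha> + tens (star \<alpha>) \<gamma>"

lemma su_relations_comult: "su_relations q \<delta>\<alpha> \<delta>\<gamma>"
  unfolding su_relations_def \<delta>\<alpha>_def \<delta>\<gamma>_def
  by (simp add: star_add star_diff star_scaleR star_star tens_simps tens_simps' algebra_simps normal_order
      scaleR_add_right scaleR_diff_right power2_eq_square)

text \<open>Images of polynomials stay in the algebraic tensor product, the only place where the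
  norm has an explicit description.\<close>

lemma eval_free_comult_range: "eval_free \<delta>\<alpha> \<delta>\<gamma> x \<in> range T"
proof -
  have cl: "a + b \<in> range T" "a * b \<in> range T" "star a \<in> range T" "c *\<^sub>C a \<in> range T"
    if "a \<in> range T" "b \<in> range T" for a b c
    using that by (auto simp flip: T_simps(3) T_tmult T_tstar T_scale)
  have tens: "tens a b \<in> range T" for a b
    by (rule range_eqI[of _ _ "[(a, b)]"]) (simp add: T_simps)
  have "\<delta>\<alpha> = tens \<alpha> \<alpha> + tens (- (q *\<^sub>R star \<gamma>)) \<gamma>" by (simp add: \<delta>\<alpha>_def tens_simps')
  hence gens: "\<delta>\<alpha> \<in> range T" "\<delta>\<gamma> \<in> range T" by (simp_all add: \<delta>\<gamma>_def cl tens)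
  have letter: "eval_letter \<delta>\<alpha> \<delta>\<gamma> l \<in> range T" for l
    by (cases l) (simp_all add: gens cl(3)[OF gens(1) gens(1)] cl(3)[OF gens(2) gens(2)])
  have word: "prod_list (map (eval_letter \<delta>\<alpha> \<delta>\<gamma>) ls) \<in> range T" for ls
    by (induction ls) (use tens[of 1 1] in \<open>simp_all add: letter cl(2) tens_simps\<close>)
  show ?thesis
  proof (induction x rule: free_alg_induct)
    case zero
    show ?case by (rule range_eqI[of _ _ "[]"]) (simp add: T_simps)
  next
    case (add x w c)
    thus ?case by (cases w) (simp add: eval_free_add eval_free_single cl(1) cl(4)[OF word word])
  qed
qed

text \<open>A vector state in a product GNS representation, pulled back along the prospective
  comultiplication, is a state of the polynomial algebra. So the supremum for the spatial norm is
  bounded by the one for the universal norm.\<close>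

lemma norm_eval_free_comult: "norm (eval_free \<delta>\<alpha> \<delta>\<gamma> x) \<le> norm (ev x)"
proof -
  obtain xs where xs: "eval_free \<delta>\<alpha> \<delta>\<gamma> x = T xs" using eval_free_comult_range[of x] by blast
  have "spatial_norm xs \<le> universal_norm q x"
    unfolding spatial_norm_def
  proof (rule cSup_least)
    obtain \<phi> :: "'a \<Rightarrow> complex" where "state \<phi>" using state_exists by blast
    moreover from this have "tfun \<phi> \<phi> (tmult (tstar [(1, 1)]) [(1, 1)]) = 1"
      by (simp add: tmult_def tstar_def tfun_def state_one)
    ultimately show "{sqrt (Re (tfun \<phi> \<psi> (tmult (tstar (tmult xs ys)) (tmult xs ys)))) | \<phi> \<psi> ys.
      state \<phi> \<and> state \<psi> \<and> tfun \<phi> \<psi> (tmult (tstar ys) ys) = 1} \<noteq> {}" by blast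
  next
    fix r assume "r \<in> {sqrt (Re (tfun \<phi> \<psi> (tmult (tstar (tmult xs ys)) (tmult xs ys)))) | \<phi> \<psi> ys.
      state \<phi> \<and> state \<psi> \<and> tfun \<phi> \<psi> (tmult (tstar ys) ys) = 1}"
    then obtain \<phi> \<psi> ys where r: "r = sqrt (Re (tfun \<phi> \<psi> (tmult (tstar (tmult xs ys)) (tmult xs ys))))"
      and st: "state \<phi>" "state \<psi>" and one: "tfun \<phi> \<psi> (tmult (tstar ys) ys) = 1" by blast
    let ?P = "\<lambda>z. product_state \<phi> \<psi> (star (T ys) * z * T ys)"
    have "state ?P" using one
      by (intro state_compress product_state(1) st) (simp add: T_tmult T_tstar flip: product_state_T[OF st])
    hence "pol_state q (\<lambda>z. ?P (eval_free \<delta>\<alpha> \<delta>\<gamma> z))"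
      by (intro pol_state_eval_free su_relations_comult)
    from pol_state_le_universal_norm(1)[OF this, of x]
    show "r \<le> universal_norm q x"
      unfolding r product_state_T[OF st, symmetric]
      by (simp add: T_tmult T_tstar eval_free_mult eval_free_fstar xs star_mult mult.assoc)
  qed
  thus ?thesis by (simp add: xs norm_T norm_ev)
qed

abbreviation \<Delta> :: "'a \<Rightarrow> 'b" where "\<Delta> \<equiv> comult q tens \<alpha> \<gamma>"

lemma comult: "star_hom \<Delta>" "\<Delta> \<alpha> = tens \<alpha> \<alpha> - q *\<^sub>R tens (star \<gamma>) \<gamma>" "\<Delta> \<gamma> = tens \<gamma> \<alpha> + tens (star \<alpha>) \<gamma>"
proof -
  obtain D where D: "star_hom D" "D \<alpha> = \<delta>\<alpha>" "D \<gamma> = \<delta>\<gamma>"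
    using star_hom_extension[OF norm_eval_free_comult] .
  have "star_hom \<Delta> \<and> \<Delta> \<alpha> = tens \<alpha> \<alpha> - q *\<^sub>R tens (star \<gamma>) \<gamma> \<and> \<Delta> \<gamma> = tens \<gamma> \<alpha> + tens (star \<alpha>) \<gamma>"
    unfolding comult_def
  proof (rule theI[where a = D])
    show "star_hom D \<and> D \<alpha> = tens \<alpha> \<alpha> - q *\<^sub>R tens (star \<gamma>) \<gamma> \<and> D \<gamma> = tens \<gamma> \<alpha> + tens (star \<alpha>) \<gamma>"
      using D by (simp add: \<delta>\<alpha>_def \<delta>\<gamma>_def)
    fix D' :: "'a \<Rightarrow> 'b"
    assume "star_hom D' \<and> D' \<alpha> = tens \<alpha> \<alpha> - q *\<^sub>R tens (star \<gamma>) \<gamma> \<and>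
      D' \<gamma> = tens \<gamma> \<alpha> + tens (star \<alpha>) \<gamma>"
    thus "D' = D" using D by (intro star_hom_eqI) (auto simp: \<delta>\<alpha>_def \<delta>\<gamma>_def)
  qed
  thus "star_hom \<Delta>" "\<Delta> \<alpha> = tens \<alpha> \<alpha> - q *\<^sub>R tens (star \<gamma>) \<gamma>" "\<Delta> \<gamma> = tens \<gamma> \<alpha> + tens (star \<alpha>) \<gamma>"
    by auto
qed

end

section \<open>Tensor powers of the fundamental corepresentation\<close>

abbreviation null :: "('a::cstar_algebra \<Rightarrow> complex) \<Rightarrow> 'a \<Rightarrow> bool"
  where "null \<phi> x \<equiv> \<phi> (star x * x) = 0"

lemma null_mult:
  assumes "pos_fun \<phi>" "null \<phi> x"
  shows "\<phi> (y * x) = 0"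
  using pos_fun_CS[OF assms(1), of "star y" x] assms(2) by (simp add: star_star)

lemma null_left_ideal:
  assumes "pos_fun \<phi>" "null \<phi> x"
  shows "null \<phi> (y * x)"
  using null_mult[OF assms, of "star x * star y * y"] by (simp add: star_mult mult.assoc)

lemma null_scale:
  assumes "pos_fun \<phi>" "null \<phi> (c *\<^sub>C x)" "c \<noteq> 0"
  shows "null \<phi> x"
  using null_left_ideal[OF assms(1,2), of "(1 / c) *\<^sub>C 1"] assms(3)
  by (simp add: scaleC_mult_left scaleC_scaleC)

text \<open>In the sum over \<open>I\<close> of \<open>\<phi>\<close> at the squared moduli of the
  stated differences, the quadratic term equals the squared length of \<open>\<xi>\<close> because
  \<open>W\<close> is isometric, and both cross terms equal it by \<open>fixed\<close>. The sum is
  therefore \<open>0\<close>, and its terms are nonnegative.\<close>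

lemma null_sum_isometry:
  fixes W :: "'i \<Rightarrow> 'i \<Rightarrow> 'a::cstar_algebra"
  assumes \<phi>: "state \<phi>" and fin: "finite S"
    and iso: "\<And>K L. K \<in> S \<Longrightarrow> L \<in> S \<Longrightarrow> (\<Sum>I\<in>S. star (W I K) * W I L) = (if K = L then 1 else 0)"
    and fixed: "(\<Sum>I\<in>S. cnj (\<xi> I) * (\<Sum>K\<in>S. \<xi> K * \<phi> (W I K))) = (\<Sum>I\<in>S. cnj (\<xi> I) * \<xi> I)"
    and I: "I \<in> S"
  shows "null \<phi> ((\<Sum>K\<in>S. \<xi> K *\<^sub>C W I K) - \<xi> I *\<^sub>C 1)"
proof -
  note lin = state_linear[OF \<phi>]
  define X where "X I = (\<Sum>K\<in>S. \<xi> K *\<^sub>C W I K)" for I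
  define n where "n = (\<Sum>I\<in>S. cnj (\<xi> I) * \<xi> I)"
  have "(\<Sum>I\<in>S. star (X I) * X I) = (\<Sum>I\<in>S. \<Sum>K\<in>S. \<Sum>L\<in>S. (cnj (\<xi> K) * \<xi> L) *\<^sub>C (star (W I K) * W I L))"
    by (simp add: X_def star_sum star_scaleC sum_product scaleC_mult_left scaleC_mult_right scaleC_scaleC mult.commute)
  also have "\<dots> = (\<Sum>K\<in>S. \<Sum>I\<in>S. \<Sum>L\<in>S. (cnj (\<xi> K) * \<xi> L) *\<^sub>C (star (W I K) * W I L))"
    by (rule sum.swap)
  also have "\<dots> = (\<Sum>K\<in>S. \<Sum>L\<in>S. \<Sum>I\<in>S. (cnj (\<xi> K) * \<xi> L) *\<^sub>C (star (W I K) * W I L))"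
    by (intro sum.cong refl sum.swap)
  also have "\<dots> = (\<Sum>K\<in>S. \<Sum>L\<in>S. (cnj (\<xi> K) * \<xi> L) *\<^sub>C (if K = L then 1 else 0))"
    by (intro sum.cong refl) (simp add: iso flip: scaleC_sum_right)
  also have "\<dots> = (\<Sum>K\<in>S. (cnj (\<xi> K) * \<xi> K) *\<^sub>C 1)"
    by (intro sum.cong refl) (simp add: fin if_distrib cong: if_cong)
  finally have "\<phi> (\<Sum>I\<in>S. star (X I) * X I) = \<phi> (\<Sum>K\<in>S. (cnj (\<xi> K) * \<xi> K) *\<^sub>C 1)" by simp
  hence XX: "(\<Sum>I\<in>S. \<phi> (star (X I) * X I)) = n"
    unfolding lin(6) by (simp add: n_def lin state_one[OF \<phi>])
  have "(\<Sum>I\<in>S. cnj (\<xi> I) * \<phi> (X I)) = n"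
    unfolding n_def fixed[symmetric] by (simp add: X_def lin)
  moreover from this have "cnj (\<Sum>I\<in>S. cnj (\<xi> I) * \<phi> (X I)) = cnj n" by simp
  hence "(\<Sum>I\<in>S. \<xi> I * \<phi> (star (X I))) = n"
    by (simp add: cnj_sum pos_fun_star[OF state_pos_fun[OF \<phi>]] n_def mult.commute)
  moreover have "\<phi> (star (X I - \<xi> I *\<^sub>C 1) * (X I - \<xi> I *\<^sub>C 1)) =
    \<phi> (star (X I) * X I) - \<xi> I * \<phi> (star (X I)) - cnj (\<xi> I) * \<phi> (X I) + cnj (\<xi> I) * \<xi> I" for I
    by (simp add: star_diff star_scaleC left_diff_distrib right_diff_distrib scaleC_mult_left
        scaleC_mult_right scaleC_diff_right lin state_one[OF \<phi>])
  ultimately have "(\<Sum>I\<in>S. \<phi> (star (X I - \<xi> I *\<^sub>C 1) * (X I - \<xi> I *\<^sub>C 1))) = 0"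
    using XX by (simp add: sum.distrib sum_subtractf n_def)
  hence "(\<Sum>I\<in>S. Re (\<phi> (star (X I - \<xi> I *\<^sub>C 1) * (X I - \<xi> I *\<^sub>C 1)))) = 0"
    by (simp flip: Re_sum)
  hence "Re (\<phi> (star (X I - \<xi> I *\<^sub>C 1) * (X I - \<xi> I *\<^sub>C 1))) = 0"
    using I fin pos_fun_real(2)[OF state_pos_fun[OF \<phi>]] by (simp add: sum_nonneg_eq_0_iff)
  thus ?thesis using pos_fun_real(1)[OF state_pos_fun[OF \<phi>]] by (simp add: complex_eq_iff X_def)
qed

abbreviation bitlists :: "nat \<Rightarrow> bool list set"
  where "bitlists n \<equiv> {I. length I = n}"

lemma finite_bitlists [simp]: "finite (bitlists n)"
  using finite_lists_length_eq[of "UNIV :: bool set" n] by simp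

lemma sum_bitlists_Suc:
  "(\<Sum>I\<in>bitlists (Suc n). f I) = (\<Sum>I\<in>bitlists n. f (False # I)) + (\<Sum>I\<in>bitlists n. f (True # I))"
proof -
  have "bitlists (Suc n) = (#) False ` bitlists n \<union> (#) True ` bitlists n"
    by (auto simp: length_Suc_conv image_iff)
  moreover have "(#) False ` bitlists n \<inter> (#) True ` bitlists n = {}" by auto
  ultimately show ?thesis by (simp add: sum.union_disjoint sum.reindex)
qed

text \<open>\<open>1 / q\<close> raised to the number of inversions of \<open>K\<close>, that is, of
  pairs with \<open>True\<close> before \<open>False\<close>: the factor collected when
  \<open>K\<close> is sorted by adjacent exchanges.\<close>

fun theta :: "real \<Rightarrow> bool list \<Rightarrow> real" where
  "theta q [] = 1"
| "theta q (False # K) = theta q K"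
| "theta q (True # K) = (1 / q) ^ count_list K False * theta q K"

abbreviation sorted_bits :: "nat \<Rightarrow> nat \<Rightarrow> bool list"
  where "sorted_bits m n \<equiv> replicate m False @ replicate n True"

lemma swap_scaling_move:
  fixes f :: "bool list \<Rightarrow> 'v::real_vector"
  assumes swap: "\<And>K K'. length K + length K' + 2 = n \<Longrightarrow> f (K @ [True, False] @ K') = (1 / q) *\<^sub>R f (K @ [False, True] @ K')"
  shows "i + m + length X + 1 = n \<Longrightarrow>
    f (replicate i False @ True # replicate m False @ X) = (1 / q) ^ m *\<^sub>R f (replicate (i + m) False @ True # X)"
proof (induction m arbitrary: i)
  case (Suc m)
  have "f (replicate i False @ [True, False] @ (replicate m False @ X)) =
      (1 / q) *\<^sub>R f (replicate i False @ [False, True] @ (replicate m False @ X))"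
    by (rule swap) (use Suc.prems in simp)
  also have "replicate i False @ [False, True] @ (replicate m False @ X) =
      replicate (Suc i) False @ True # replicate m False @ X"
    using replicate_app_Cons_same[of i False] by simp
  finally show ?case using Suc.IH[of "Suc i"] Suc.prems by simp
qed simp

text \<open>Stated for an arbitrary vector-valued \<open>f\<close> because it is applied to a
  constant row of \<open>U\<close>, where the exchange rule is exact, and to the difference of two
  idempotent states, where the remainders cancel.\<close>

lemma swap_scaling_sort:
  fixes f :: "bool list \<Rightarrow> 'v::real_vector"
  assumes swap: "\<And>K K'. length K + length K' + 2 = n \<Longrightarrow> f (K @ [True, False] @ K') = (1 / q) *\<^sub>R f (K @ [False, True] @ K')"
    and "length K = n"
  shows "f K = theta q K *\<^sub>R f (sorted_bits (count_list K False) (count_list K True))"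
  using assms
proof (induction K arbitrary: f n)
  case (Cons k K)
  have IH: "f (k # K) = theta q K *\<^sub>R f (k # sorted_bits (count_list K False) (count_list K True))"
  proof (rule Cons.IH[where n = "length K"])
    fix L L' :: "bool list" assume "length L + length L' + 2 = length K"
    thus "f (k # L @ [True, False] @ L') = (1 / q) *\<^sub>R f (k # L @ [False, True] @ L')"
      using Cons.prems(1)[of "k # L" L'] Cons.prems(2) by simp
  qed simp
  show ?case
  proof (cases k)
    case False
    thus ?thesis using IH by simp
  next
    case True
    have len: "count_list K False + count_list K True = length K"
      by (induction K) auto
    have "f (replicate 0 False @ True # replicate (count_list K False) False @ replicate (count_list K True) True) =
        (1 / q) ^ count_list K False *\<^sub>R f (replicate (0 + count_list K False) False @ True # replicate (count_list K True) True)"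
      by (rule swap_scaling_move[of n]) (use Cons.prems len in auto)
    thus ?thesis using IH True by (simp add: mult.commute)
  qed
qed simp

lemma count_list_bits: "count_list K False + count_list K True = length K"
  by (induction K) auto

lemma theta_nonzero: "q \<noteq> 0 \<Longrightarrow> theta q K \<noteq> 0"
  by (induction q K rule: theta.induct) auto

section \<open>Matrix entries of the tensor powers\<close>

context csuq2
begin

text \<open>The fundamental corepresentation with rows
  \<open>\<alpha>, - q *\<^sub>R star \<gamma>\<close> and \<open>\<gamma>, star \<alpha>\<close>, a
  unitary matrix; \<open>False\<close> is the first index and \<open>True\<close> the
  second.\<close>

definition u :: "bool \<Rightarrow> bool \<Rightarrow> 'a"
  where "u i j = (if i then (if j then star \<alpha> else \<gamma>) else (if j then - (q *\<^sub>R star \<gamma>) else \<alpha>))"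

definition U :: "bool list \<Rightarrow> bool list \<Rightarrow> 'a"
  where "U I J = prod_list (map2 u I J)"

lemma U_simps [simp]: "U [] [] = 1" "U (i # I) (j # J) = u i j * U I J"
  by (simp_all add: U_def)

lemma U_append: "length I = length J \<Longrightarrow> U (I @ I') (J @ J') = U I J * U I' J'"
  by (induction I J rule: list_induct2) (simp_all add: mult.assoc)

lemma u_column: "star (u False i) * u False j + star (u True i) * u True j = (if i = j then 1 else 0)"
  by (cases i; cases j) (simp_all add: u_def star_minus star_scaleR star_star normal_order power2_eq_square)

lemma u_row: "u i False * star (u j False) + u i True * star (u j True) = (if i = j then 1 else 0)"
  by (cases i; cases j) (simp_all add: u_def star_minus star_scaleR star_star normal_order power2_eq_square)

lemma U_column:
  "length I = n \<Longrightarrow> length J = n \<Longrightarrow> (\<Sum>K\<in>bitlists n. star (U K I) * U K J) = (if I = J then 1 else 0)"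
proof (induction n arbitrary: I J)
  case (Suc n)
  then obtain i I' j J' where IJ: "I = i # I'" "J = j # J'" "length I' = n" "length J' = n"
    by (auto simp: length_Suc_conv)
  have "(\<Sum>K\<in>bitlists (Suc n). star (U K I) * U K J) =
    (\<Sum>K\<in>bitlists n. star (U K I') * (star (u False i) * u False j + star (u True i) * u True j) * U K J')"
    by (simp add: IJ sum_bitlists_Suc star_mult mult.assoc distrib_left distrib_right flip: sum.distrib)
  also have "\<dots> = (if I = J then 1 else 0)"
    unfolding u_column using Suc.IH[OF IJ(3,4)]
    by (cases "i = j"; cases "I' = J'") (simp_all add: IJ)
  finally show ?case .
qed simp

lemma U_row:
  "length I = n \<Longrightarrow> length J = n \<Longrightarrow> (\<Sum>K\<in>bitlists n. U I K * star (U J K)) = (if I = J then 1 else 0)"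
proof (induction n arbitrary: I J)
  case (Suc n)
  then obtain i I' j J' where IJ: "I = i # I'" "J = j # J'" "length I' = n" "length J' = n"
    by (auto simp: length_Suc_conv)
  have "(\<Sum>K\<in>bitlists (Suc n). U I K * star (U J K)) =
    u i False * (\<Sum>K\<in>bitlists n. U I' K * star (U J' K)) * star (u j False) +
    u i True * (\<Sum>K\<in>bitlists n. U I' K * star (U J' K)) * star (u j True)"
    by (simp add: IJ sum_bitlists_Suc star_mult mult.assoc sum_distrib_left sum_distrib_right)
  also have "\<dots> = (if I = J then 1 else 0)"
    unfolding Suc.IH[OF IJ(3,4)] using u_row[of i j]
    by (cases "i = j"; cases "I' = J'") (simp_all add: IJ)
  finally show ?case .
qed simp

lemma word_eq_U:
  "\<exists>c I J. length I = length J \<and> prod_list (map (eval_letter \<alpha> \<gamma>) ls) = c *\<^sub>C U I J"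
proof (induction ls)
  case Nil
  show ?case by (intro exI[of _ 1] exI[of _ "[]"]) simp
next
  case (Cons l ls)
  then obtain c I J where IH: "length I = length J" "prod_list (map (eval_letter \<alpha> \<gamma>) ls) = c *\<^sub>C U I J" by blast
  have "\<exists>d i j. eval_letter \<alpha> \<gamma> l = d *\<^sub>C u i j"
  proof (cases l)
    case Alpha
    hence "eval_letter \<alpha> \<gamma> l = 1 *\<^sub>C u False False" by (simp add: u_def)
    thus ?thesis by blast
  next
    case Alpha_Star
    hence "eval_letter \<alpha> \<gamma> l = 1 *\<^sub>C u True True" by (simp add: u_def)
    thus ?thesis by blast
  next
    case Gamma
    hence "eval_letter \<alpha> \<gamma> l = 1 *\<^sub>C u True False" by (simp add: u_def)
    thus ?thesis by blast
  next
    case Gamma_Star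
    hence "eval_letter \<alpha> \<gamma> l = of_real (- (1 / q)) *\<^sub>C u False True"
      using q_nonzero by (simp add: u_def scaleC_of_real del: of_real_divide of_real_minus)
    thus ?thesis by blast
  qed
  then obtain d i j where "eval_letter \<alpha> \<gamma> l = d *\<^sub>C u i j" by blast
  hence "prod_list (map (eval_letter \<alpha> \<gamma>) (l # ls)) = (c * d) *\<^sub>C U (i # I) (j # J)"
    using IH by (simp add: scaleC_mult_left scaleC_mult_right scaleC_scaleC)
  thus ?case using IH(1) by (metis length_Cons)
qed

lemma U_eqI:
  assumes "bounded_clinear F" "bounded_clinear G" "\<And>I J. length I = length J \<Longrightarrow> F (U I J) = G (U I J)"
  shows "F = G"
proof (rule dense_bounded_clinear_eqI[OF dense_ev assms(1,2)])
  show "F (ev x) = G (ev x)" for x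
  proof (induction x rule: free_alg_induct)
    case zero
    show ?case by (simp add: bounded_clinear_simps[OF assms(1)] bounded_clinear_simps[OF assms(2)])
  next
    case (add x w c)
    obtain d I J where "length I = length J" "prod_list (map (eval_letter \<alpha> \<gamma>) (letters_of w)) = d *\<^sub>C U I J"
      using word_eq_U by blast
    thus ?case using add
      by (cases w) (simp add: eval_free_add eval_free_single assms(3)
          bounded_clinear_simps[OF assms(1)] bounded_clinear_simps[OF assms(2)])
  qed
qed

lemma u_swap_row: "u i True * u i False = (1 / q) *\<^sub>R (u i False * u i True)"
  using q_nonzero by (cases i) (simp_all add: u_def normal_order)

text \<open>For the products that mix \<open>\<alpha>\<close> and \<open>star \<alpha>\<close> the
  relations leave a scalar \<open>\<kappa>\<close>; inside a longer product it replaces two factors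
  by a number, so the remainder is an entry of a tensor power lower by two.\<close>

lemma u_swap:
  obtains \<kappa> where "u True i * u False j = (1 / q) *\<^sub>R (u False i * u True j) + \<kappa> *\<^sub>R 1"
proof -
  have "\<exists>\<kappa>. u True i * u False j = (1 / q) *\<^sub>R (u False i * u True j) + \<kappa> *\<^sub>R 1"
  proof (cases i; cases j)
    assume "i" "j"
    thus ?thesis using q_nonzero by (intro exI[of _ 0]) (simp add: u_def normal_order)
  next
    assume "i" "\<not> j"
    thus ?thesis using q_nonzero by (intro exI[of _ 1]) (simp add: u_def normal_order)
  next
    assume "\<not> i" "j"
    thus ?thesis using q_nonzero
      by (intro exI[of _ "- (1 / q)"]) (simp add: u_def normal_order scaleR_diff_right power2_eq_square)
  next
    assume "\<not> i" "\<not> j"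
    thus ?thesis using q_nonzero by (intro exI[of _ 0]) (simp add: u_def normal_order)
  qed
  thus ?thesis using that by blast
qed

lemma U_swap_row:
  assumes "length K = n"
  shows "U (replicate n i) K =
    theta q K *\<^sub>R U (replicate n i) (sorted_bits (count_list K False) (count_list K True))"
proof (rule swap_scaling_sort[OF _ assms])
  fix L L' :: "bool list" assume "length L + length L' + 2 = n"
  hence "replicate n i = replicate (length L) i @ [i, i] @ replicate (length L') i"
    by (metis (no_types) add.assoc add.commute append_Cons append_Nil numeral_2_eq_2 replicate_0 replicate_Suc replicate_add)
  thus "U (replicate n i) (L @ [True, False] @ L') = (1 / q) *\<^sub>R U (replicate n i) (L @ [False, True] @ L')"
    by (simp add: U_append u_swap_row mult.assoc flip: mult.assoc[of "u i True" "u i False"])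
qed

text \<open>The fundamental corepresentation is equivalent to its conjugate: the adjoint flips both
  indices up to these factors. Their asymmetry in \<open>i\<close> and \<open>j\<close> is the
  source of the nontrivial squared antipode.\<close>

definition star_sign :: "bool \<Rightarrow> bool \<Rightarrow> real"
  where "star_sign i j = (if i = j then 1 else if i then - (1 / q) else - q)"

lemma star_u: "star (u i j) = star_sign i j *\<^sub>R u (\<not> i) (\<not> j)"
  using q_nonzero by (cases i; cases j) (simp_all add: u_def star_sign_def star_minus star_scaleR star_star)

lemma star_U:
  "length I = length J \<Longrightarrow>
    star (U I J) = prod_list (map2 star_sign I J) *\<^sub>R U (rev (map Not I)) (rev (map Not J))"
  by (induction I J rule: list_induct2) (simp_all add: star_mult star_u U_append mult.commute)

lemma prod_star_sign_rev:
  "length J = length I \<Longrightarrow> prod_list (map2 star_sign (rev (map Not I)) (rev (map Not J))) =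
    prod_list (map2 (\<lambda>j i. star_sign (\<not> i) (\<not> j)) J I)"
  by (induction J I rule: list_induct2) (simp_all add: mult.commute)

text \<open>The two products together are the factor by which the squared antipode scales
  \<open>U I J\<close>, a power of \<open>q\<^sup>2\<close> with the difference of the two counts as
  exponent; the equation has its denominator cleared.\<close>

lemma prod_star_sign:
  "length J = length I \<Longrightarrow>
    prod_list (map2 star_sign J I) * prod_list (map2 star_sign (rev (map Not I)) (rev (map Not J))) *
      (q\<^sup>2) ^ count_list J True = (q\<^sup>2) ^ count_list I True"
  unfolding prod_star_sign_rev
proof (induction J I rule: list_induct2)
  case (Cons j J i I)
  let ?p = "prod_list (map2 star_sign J I) * prod_list (map2 (\<lambda>j i. star_sign (\<not> i) (\<not> j)) J I)"
  have "star_sign j i * star_sign (\<not> i) (\<not> j) * (if j then q\<^sup>2 else 1) = (if i then q\<^sup>2 else 1)"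
    using q_nonzero by (simp add: star_sign_def power2_eq_square)
  hence "(star_sign j i * star_sign (\<not> i) (\<not> j) * (if j then q\<^sup>2 else 1)) * (?p * (q\<^sup>2) ^ count_list J True) =
      (if i then q\<^sup>2 else 1) * (q\<^sup>2) ^ count_list I True"
    using Cons.IH by simp
  thus ?case by (cases i; cases j) (simp_all add: mult_ac)
qed simp

text \<open>By normality of \<open>\<gamma>\<close> both alternatives put a power of the
  self-adjoint \<open>c = star \<gamma> * \<gamma>\<close> into the left kernel, from which square
  roots can be taken: \<open>\<phi>\<close> vanishing at \<open>c ^ (2 ^ Suc k)\<close> says that
  \<open>c ^ (2 ^ k)\<close> is null.\<close>

lemma null_power_gamma:
  assumes \<phi>: "state \<phi>" and n: "n \<ge> 1" and "null \<phi> (\<gamma> ^ n) \<or> null \<phi> (star \<gamma> ^ n)"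
  shows "\<phi> (star \<gamma> * \<gamma>) = 0"
proof -
  note pos = state_pos_fun[OF \<phi>]
  define c where "c = star \<gamma> * \<gamma>"
  have comm: "\<gamma> * star \<gamma> = star \<gamma> * \<gamma>" by (rule normal_order)
  have pow: "(a * b) ^ k = a ^ k * b ^ k" if "a * b = b * a" for a b :: 'a and k
  proof (induction k)
    case (Suc k)
    have "b * a ^ k = a ^ k * b" using power_commuting_commutes[of a b k] that by simp
    thus ?case using Suc by (simp add: mult.assoc) (simp flip: mult.assoc)
  qed simp
  have c: "c ^ k = star \<gamma> ^ k * \<gamma> ^ k" "c ^ k = \<gamma> ^ k * star \<gamma> ^ k" for k
    unfolding c_def using pow[of "star \<gamma>" \<gamma> k] pow[of \<gamma> "star \<gamma>" k] comm by simp_all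
  have "null \<phi> (c ^ n)"
    using assms(3) null_left_ideal[OF pos] c by metis
  \<comment> \<open>The exponent is raised to a power of two so that repeated halving ends exactly
    at \<open>c\<close>.\<close>
  hence big: "null \<phi> (c ^ (2 ^ n))"
    using null_left_ideal[OF pos, of "c ^ n" "c ^ (2 ^ n - n)"] less_exp[of n] by (simp flip: power_add)
  have "null \<phi> (c ^ (2 ^ k)) \<Longrightarrow> null \<phi> c" for k
  proof (induction k)
    case (Suc k)
    have "star c = c" by (simp add: c_def star_mult star_star)
    hence "star (c ^ (2 ^ k)) * c ^ (2 ^ k) = c ^ (2 ^ Suc k)"
      by (simp add: star_power mult_2 flip: power_add)
    moreover have "\<phi> (1 * c ^ (2 ^ Suc k)) = 0" by (rule null_mult[OF pos Suc.prems])
    ultimately show ?case by (intro Suc.IH) simp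
  qed simp
  hence "null \<phi> c" using big by blast
  from null_mult[OF pos this, of 1] show ?thesis by (simp add: c_def)
qed

end

section \<open>Uniqueness of the idempotent state not living on the circle\<close>

context csuq2
begin

text \<open>\<open>\<alpha> * star \<alpha> = 1 - q\<^sup>2 *\<^sub>R c\<close> is bounded below by
  \<open>1 - q\<^sup>2 > 0\<close>, so a factor \<open>star \<alpha>\<close> can be cancelled.
  Multiplying by \<open>\<alpha>\<close> gives the value of \<open>\<phi>\<close> at
  \<open>star v * v\<close> as \<open>q\<^sup>2\<close> times that at
  \<open>star v * (c * v)\<close>, which is no larger than the first, as positivity at
  \<open>\<alpha> * v\<close> shows.\<close>

lemma null_cancel_star_alpha:
  assumes \<phi>: "state \<phi>" and "null \<phi> (\<gamma> ^ a * star \<alpha> ^ b)"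
  shows "null \<phi> (\<gamma> ^ a)"
  using assms(2)
proof (induction b)
  case (Suc b)
  note pos = state_pos_fun[OF \<phi>] and lin = state_linear[OF \<phi>]
  define v where "v = \<gamma> ^ a * star \<alpha> ^ b"
  define c where "c = star \<gamma> * \<gamma>"
  have c\<gamma>: "c * \<gamma> ^ a = \<gamma> ^ a * c"
    using power_commuting_commutes[of \<gamma> c a] normal_order(3) by (simp add: c_def mult.assoc[symmetric])
  have "\<alpha> * \<gamma> ^ a = q ^ a *\<^sub>R (\<gamma> ^ a * \<alpha>)"
  proof (induction a)
    case (Suc a)
    have "\<alpha> * \<gamma> ^ Suc a = (\<alpha> * \<gamma>) * \<gamma> ^ a" by (simp add: mult.assoc)
    also have "\<dots> = q *\<^sub>R (\<gamma> * (\<alpha> * \<gamma> ^ a))" by (simp add: normal_order mult.assoc)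
    finally show ?case using Suc by (simp add: mult.assoc)
  qed simp
  hence "\<alpha> * (\<gamma> ^ a * star \<alpha> ^ Suc b) = q ^ a *\<^sub>R (\<gamma> ^ a * (\<alpha> * star \<alpha>) * star \<alpha> ^ b)"
    by (simp flip: mult.assoc)
  also have "\<gamma> ^ a * (\<alpha> * star \<alpha>) * star \<alpha> ^ b = v - q\<^sup>2 *\<^sub>R (c * v)"
    unfolding normal_order v_def by (simp add: right_diff_distrib left_diff_distrib c\<gamma> flip: c_def mult.assoc)
  finally have "\<phi> (star v * (q ^ a *\<^sub>R (v - q\<^sup>2 *\<^sub>R (c * v)))) = 0"
    using null_mult[OF pos null_left_ideal[OF pos Suc.prems, of \<alpha>], of "star v"] by simp
  hence "\<phi> (star v * v) = q\<^sup>2 *\<^sub>R \<phi> (star v * (c * v))"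
    using q_nonzero by (simp add: lin right_diff_distrib)
  hence 1: "Re (\<phi> (star v * v)) = q\<^sup>2 * Re (\<phi> (star v * (c * v)))" by simp
  have "star (\<alpha> * v) * (\<alpha> * v) = star v * (star \<alpha> * \<alpha>) * v" by (simp add: star_mult mult.assoc)
  also have "\<dots> = star v * v - star v * (c * v)"
    unfolding normal_order by (simp add: c_def right_diff_distrib left_diff_distrib mult.assoc)
  finally have "0 \<le> Re (\<phi> (star v * v)) - Re (\<phi> (star v * (c * v)))"
    using pos_fun_real(2)[OF pos, of "\<alpha> * v"] by (simp add: lin)
  hence "q\<^sup>2 * Re (\<phi> (star v * (c * v))) \<le> q\<^sup>2 * Re (\<phi> (star v * v))" by (simp add: mult_left_mono)
  hence "(1 - q\<^sup>2) * Re (\<phi> (star v * v)) \<le> 0" using 1 by (simp add: algebra_simps)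
  hence "Re (\<phi> (star v * v)) \<le> 0" using q_square by (simp add: mult_le_0_iff)
  hence "Re (\<phi> (star v * v)) = 0" using pos_fun_real(2)[OF pos, of v] by linarith
  hence "null \<phi> v" using pos_fun_real(1)[OF pos, of v] by (simp add: complex_eq_iff)
  thus ?case using Suc.IH by (simp add: v_def)
qed simp

lemma U_row_sorted:
  "U (replicate (m + n) True) (sorted_bits m n) = \<gamma> ^ m * star \<alpha> ^ n"
  "U (replicate n False) (replicate n True) = ((- q) ^ n) *\<^sub>R star \<gamma> ^ n"
proof -
  have 1: "U (replicate n i) (replicate n j) = u i j ^ n" for n i j
    by (induction n) simp_all
  show "U (replicate (m + n) True) (sorted_bits m n) = \<gamma> ^ m * star \<alpha> ^ n"
    unfolding replicate_add by (subst U_append) (simp_all add: 1 u_def)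
  have "u False True = (- q) *\<^sub>R star \<gamma>" by (simp add: u_def)
  hence "u False True ^ n = ((- q) ^ n) *\<^sub>R star \<gamma> ^ n" by (simp only: scaleR_power)
  thus "U (replicate n False) (replicate n True) = ((- q) ^ n) *\<^sub>R star \<gamma> ^ n" unfolding 1 .
qed

lemma split_at_two:
  assumes "length (J :: bool list) = k + k' + 2"
  obtains J1 j j' J2 where "J = J1 @ [j, j'] @ J2" "length J1 = k" "length J2 = k'"
proof -
  obtain j j' J2 where d: "drop k J = j # j' # J2" "length J2 = k'"
    using assms by (cases "drop k J"; cases "tl (drop k J)") (auto dest: arg_cong[of _ _ length])
  have "J = take k J @ [j, j'] @ J2" using d append_take_drop_id[of k J] by simp
  thus ?thesis using that d(2) assms by simp
qed

end

context csuq2_tensor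
begin

lemma comult_u: "\<Delta> (u i j) = tens (u i False) (u False j) + tens (u i True) (u True j)"
  by (cases i; cases j)
     (simp_all add: u_def comult star_hom_simps[OF comult(1)] star_hom_linear[OF comult(1)]
       star_add star_diff star_scaleR star_star tens_simps tens_simps' algebra_simps)

lemma comult_U:
  "length I = n \<Longrightarrow> length J = n \<Longrightarrow> \<Delta> (U I J) = (\<Sum>K\<in>bitlists n. tens (U I K) (U K J))"
proof (induction n arbitrary: I J)
  case 0
  thus ?case by (simp add: star_hom_simps[OF comult(1)] tens_simps)
next
  case (Suc n)
  then obtain i I' j J' where IJ: "I = i # I'" "J = j # J'" "length I' = n" "length J' = n"
    by (auto simp: length_Suc_conv)
  show ?case
    by (simp add: IJ star_hom_simps[OF comult(1)] Suc.IH comult_u sum_bitlists_Suc distrib_right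
        sum_distrib_left tens_simps sum.distrib)
qed

section \<open>Convolution of states as multiplication of matrices\<close>

definition conv :: "('a \<Rightarrow> complex) \<Rightarrow> ('a \<Rightarrow> complex) \<Rightarrow> 'a \<Rightarrow> complex"
  where "conv \<phi> \<psi> x = product_state \<phi> \<psi> (\<Delta> x)"

lemma conv_U:
  assumes "state \<phi>" "state \<psi>" "length I = n" "length J = n"
  shows "conv \<phi> \<psi> (U I J) = (\<Sum>K\<in>bitlists n. \<phi> (U I K) * \<psi> (U K J))"
  by (simp add: conv_def comult_U assms product_state(2)[OF assms(1,2)]
      state_linear[OF product_state(1)[OF assms(1,2)]])

lemma conv_state:
  assumes "state \<phi>" "state \<psi>"
  shows "state (conv \<phi> \<psi>)"
proof -
  note p = product_state(1)[OF assms] and d = star_hom_simps[OF comult(1)]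
  have "bounded_clinear (\<lambda>x. product_state \<phi> \<psi> (\<Delta> x))"
    by (rule bounded_clinear_compose[OF state_bcl[OF p] d(1)])
  thus ?thesis using p by (simp add: conv_def[abs_def] state_def d)
qed

lemma idempotent_state_iff: "idempotent_state tens \<Delta> \<phi> \<longleftrightarrow> state \<phi> \<and> conv \<phi> \<phi> = \<phi>"
  by (simp add: idempotent_state_def conv_def[abs_def] product_state_def o_def)

lemma idempotent_state_U_iff:
  assumes "state \<phi>"
  shows "idempotent_state tens \<Delta> \<phi> \<longleftrightarrow>
    (\<forall>n. \<forall>I\<in>bitlists n. \<forall>J\<in>bitlists n. (\<Sum>K\<in>bitlists n. \<phi> (U I K) * \<phi> (U K J)) = \<phi> (U I J))"
    (is "_ \<longleftrightarrow> ?R")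
proof
  assume "idempotent_state tens \<Delta> \<phi>"
  hence c: "conv \<phi> \<phi> = \<phi>" by (simp add: idempotent_state_iff)
  show ?R
  proof (intro allI ballI)
    fix n and I J :: "bool list" assume "I \<in> bitlists n" "J \<in> bitlists n"
    thus "(\<Sum>K\<in>bitlists n. \<phi> (U I K) * \<phi> (U K J)) = \<phi> (U I J)"
      using conv_U[OF assms assms, of I n J] unfolding c by simp
  qed
next
  assume R: ?R
  have "conv \<phi> \<phi> = \<phi>"
  proof (rule U_eqI)
    fix I J :: "bool list" assume "length I = length J"
    thus "conv \<phi> \<phi> (U I J) = \<phi> (U I J)"
      using R[rule_format, of I "length J" J] conv_U[OF assms assms, of I "length J" J] by simp
  qed (simp_all add: state_bcl assms conv_state)
  thus "idempotent_state tens \<Delta> \<phi>" using assms by (simp add: idempotent_state_iff)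
qed

section \<open>The orthogonal projections attached to an idempotent state\<close>

context
  fixes \<phi> assumes idem: "idempotent_state tens \<Delta> \<phi>"
begin

lemma idem_state: "state \<phi>"
  using idem by (simp add: idempotent_state_def)

lemma idem_U:
  "length I = n \<Longrightarrow> length J = n \<Longrightarrow> (\<Sum>K\<in>bitlists n. \<phi> (U I K) * \<phi> (U K J)) = \<phi> (U I J)"
  using idempotent_state_U_iff[OF idem_state] idem by fast

text \<open>The columns of an idempotent matrix are its fixed vectors; here \<open>\<xi>\<close> is
  the column \<open>J\<close> of \<open>\<phi>(U)\<close>, and \<open>U\<close> is
  isometric.\<close>

lemma idem_null_column:
  assumes "length I = n" "length J = n"
  shows "null \<phi> ((\<Sum>K\<in>bitlists n. \<phi> (U K J) *\<^sub>C U I K) - \<phi> (U I J) *\<^sub>C 1)"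
proof (rule null_sum_isometry[OF idem_state, where W = U and \<xi> = "\<lambda>K. \<phi> (U K J)"])
  have "(\<Sum>K\<in>bitlists n. \<phi> (U K J) * \<phi> (U I K)) = \<phi> (U I J)" if "I \<in> bitlists n" for I
    using idem_U[of I n J] assms that by (simp add: mult.commute)
  thus "(\<Sum>I\<in>bitlists n. cnj (\<phi> (U I J)) * (\<Sum>K\<in>bitlists n. \<phi> (U K J) * \<phi> (U I K))) =
    (\<Sum>I\<in>bitlists n. cnj (\<phi> (U I J)) * \<phi> (U I J))" by simp
qed (simp_all add: U_column assms)

text \<open>The adjoint of \<open>U\<close> is isometric as well, by \<open>U_row\<close>. Pairing
  \<open>\<xi>\<close> with its image under the adjoint matrix gives the conjugate of the pairing
  for \<open>\<phi>(U)\<close>, so the same column is fixed by both.\<close>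

lemma idem_null_column_star:
  assumes "length I = n" "length J = n"
  shows "null \<phi> ((\<Sum>K\<in>bitlists n. \<phi> (U K J) *\<^sub>C star (U K I)) - \<phi> (U I J) *\<^sub>C 1)"
proof (rule null_sum_isometry[OF idem_state, where W = "\<lambda>I K. star (U K I)" and \<xi> = "\<lambda>K. \<phi> (U K J)"])
  have "(\<Sum>I\<in>bitlists n. cnj (\<phi> (U I J)) * (\<Sum>K\<in>bitlists n. \<phi> (U K J) * \<phi> (star (U K I)))) =
    (\<Sum>K\<in>bitlists n. \<Sum>I\<in>bitlists n. cnj (\<phi> (U I J)) * (\<phi> (U K J) * \<phi> (star (U K I))))"
    unfolding sum_distrib_left by (rule sum.swap)
  also have "\<dots> = (\<Sum>K\<in>bitlists n. \<phi> (U K J) * cnj (\<Sum>I\<in>bitlists n. \<phi> (U K I) * \<phi> (U I J)))"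
    by (simp add: sum_distrib_left pos_fun_star[OF state_pos_fun[OF idem_state]] mult_ac)
  also have "\<dots> = (\<Sum>K\<in>bitlists n. cnj (\<phi> (U K J)) * \<phi> (U K J))"
    by (intro sum.cong refl) (simp add: idem_U assms mult.commute)
  finally show "(\<Sum>I\<in>bitlists n. cnj (\<phi> (U I J)) * (\<Sum>K\<in>bitlists n. \<phi> (U K J) * \<phi> (star (U K I)))) =
    (\<Sum>I\<in>bitlists n. cnj (\<phi> (U I J)) * \<phi> (U I J))" .
qed (use assms in \<open>simp_all add: U_row star_star\<close>)

text \<open>Applying \<open>\<phi>\<close> to the null elements for the adjoint says that the matrix
  \<open>P\<close> of \<open>\<phi>\<close> equals its adjoint times \<open>P\<close>, and such a
  product is self-adjoint.\<close>

lemma idem_U_hermitian: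
  assumes "length I = length J"
  shows "\<phi> (U J I) = cnj (\<phi> (U I J))"
proof -
  note pos = state_pos_fun[OF idem_state]
  have *: "(\<Sum>K\<in>bitlists n. \<phi> (U K J) * cnj (\<phi> (U K I))) = \<phi> (U I J)"
    if "length I = n" "length J = n" for I J n
    using null_mult[OF pos idem_null_column_star[OF that], of 1]
    by (simp add: state_linear[OF idem_state] state_one[OF idem_state] pos_fun_star[OF pos])
  have "cnj (\<phi> (U I J)) = (\<Sum>K\<in>bitlists (length J). cnj (\<phi> (U K J)) * \<phi> (U K I))"
    by (subst *[symmetric, of I "length J" J]) (simp_all add: assms)
  also have "\<dots> = \<phi> (U J I)" by (subst *[symmetric, of J "length J" I]) (simp_all add: assms mult.commute)
  finally show ?thesis ..
qed

text \<open>Hermitian matrices of \<open>\<phi>\<close> mean invariance under the antipode, hence under its square, which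
  scales \<open>\<gamma>\<close> and \<open>\<gamma>\<^sup>*\<close> by \<open>q\<^sup>\<plusminus>\<^sup>2\<close>.\<close>

lemma idem_U_balanced:
  assumes "length I = length J" "count_list I True \<noteq> count_list J True"
  shows "\<phi> (U I J) = 0"
proof -
  have step: "\<phi> (U I J) = of_real (prod_list (map2 star_sign J I)) * \<phi> (U (rev (map Not J)) (rev (map Not I)))"
    if "length I = length J" for I J
  proof -
    have "\<phi> (U I J) = \<phi> (star (U J I))"
      using idem_U_hermitian[of J I] that by (simp add: pos_fun_star[OF state_pos_fun[OF idem_state]])
    also have "\<dots> = of_real (prod_list (map2 star_sign J I)) * \<phi> (U (rev (map Not J)) (rev (map Not I)))"
      using that by (simp only: star_U state_linear[OF idem_state] scaleR_scaleC complex_scaleC)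
    finally show ?thesis .
  qed
  \<comment> \<open>The antipode sends \<open>U I J\<close> to \<open>star (U J I)\<close>; doing
    this twice returns to \<open>U I J\<close> with the factor \<open>\<kappa>\<close>, which is
    \<open>1\<close> only when the weights agree.\<close>
  define \<kappa> where "\<kappa> = prod_list (map2 star_sign J I) * prod_list (map2 star_sign (rev (map Not I)) (rev (map Not J)))"
  have reverse: "\<phi> (U (rev (map Not J)) (rev (map Not I))) =
      of_real (prod_list (map2 star_sign (rev (map Not I)) (rev (map Not J)))) * \<phi> (U I J)"
    using step[of "rev (map Not J)" "rev (map Not I)"] assms(1) by (simp add: rev_map o_def)
  have "\<phi> (U I J) = of_real (prod_list (map2 star_sign J I)) * \<phi> (U (rev (map Not J)) (rev (map Not I)))"
    by (rule step[OF assms(1)])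
  also have "\<dots> = of_real \<kappa> * \<phi> (U I J)" by (simp only: reverse \<kappa>_def of_real_mult mult.assoc)
  finally have "\<phi> (U I J) = of_real \<kappa> * \<phi> (U I J)" .
  moreover have "\<kappa> \<noteq> 1"
  proof
    assume "\<kappa> = 1"
    hence eq: "(q\<^sup>2) ^ count_list J True = (q\<^sup>2) ^ count_list I True"
      using prod_star_sign[of J I] assms(1) by (simp add: \<kappa>_def)
    have "q\<^sup>2 \<noteq> 1" using q_square by simp
    from power_inject_exp'[OF this q_square(1)] eq have "count_list J True = count_list I True"
      by (rule iffD1)
    thus False using assms(2) by simp
  qed
  ultimately show ?thesis by simp
qed

text \<open>The linear equation, one for each column, that pins down the values on words of length
  \<open>n\<close> once those on shorter words are known.\<close>

lemma idem_weighted_sum_zero: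
  assumes "\<phi> (star \<gamma> * \<gamma>) \<noteq> 0" and n: "n \<ge> 1" and J: "length J = n"
  shows "(\<Sum>K\<in>{K. length K = n \<and> count_list K True = count_list J True}. of_real (theta q K) * \<phi> (U K J)) = 0"
    (is "?\<Lambda> = 0")
proof (rule ccontr)
  assume \<Lambda>: "?\<Lambda> \<noteq> 0"
  note pos = state_pos_fun[OF idem_state]
  define b a where "b = count_list J True" and "a = count_list J False"
  have ab: "a + b = n" using count_list_bits[of J] J by (simp add: a_def b_def)
  \<comment> \<open>In the relation for column \<open>J\<close>, only \<open>K\<close> of the same
    weight as \<open>J\<close> survive, and in a constant row each of them yields the same monomial
    with factor \<open>theta q K\<close>. The constant term vanishes because the row has another
    weight than \<open>J\<close>.\<close>
  have row: "null \<phi> (U (replicate n i) (sorted_bits a b))"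
    if i: "count_list (replicate n i) True \<noteq> b" for i
  proof -
    let ?V = "U (replicate n i) (sorted_bits a b)"
    let ?S = "{K. length K = n \<and> count_list K True = b}"
    have "(\<Sum>K\<in>bitlists n. \<phi> (U K J) *\<^sub>C U (replicate n i) K) = (\<Sum>K\<in>?S. \<phi> (U K J) *\<^sub>C U (replicate n i) K)"
      by (rule sum.mono_neutral_right) (use J in \<open>auto simp: b_def idem_U_balanced\<close>)
    also have "\<dots> = (\<Sum>K\<in>?S. (of_real (theta q K) * \<phi> (U K J)) *\<^sub>C ?V)"
    proof (rule sum.cong[OF refl])
      fix K assume K: "K \<in> ?S"
      hence "count_list K False = a" using count_list_bits[of K] ab by auto
      thus "\<phi> (U K J) *\<^sub>C U (replicate n i) K = (of_real (theta q K) * \<phi> (U K J)) *\<^sub>C ?V"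
        using K U_swap_row[of K n i] by (simp add: scaleR_scaleC scaleC_scaleC mult.commute)
    qed
    also have "\<dots> = ?\<Lambda> *\<^sub>C ?V"
      unfolding b_def by (rule scaleC_sum_left[symmetric])
    finally have "(\<Sum>K\<in>bitlists n. \<phi> (U K J) *\<^sub>C U (replicate n i) K) = ?\<Lambda> *\<^sub>C ?V" .
    moreover have "\<phi> (U (replicate n i) J) = 0"
      using i J by (intro idem_U_balanced) (simp_all add: b_def)
    ultimately have "null \<phi> (?\<Lambda> *\<^sub>C ?V)"
      using idem_null_column[of "replicate n i" n J] J by simp
    thus ?thesis using null_scale[OF pos _ \<Lambda>] by blast
  qed
  have cnt: "count_list (replicate n i) True = (if i then n else 0)" for n i by (induction n) auto
  show False
  \<comment> \<open>The row of ones differs in weight from \<open>J\<close> only if \<open>J\<close>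
    contains \<open>False\<close>. For \<open>J\<close> consisting of ones the row of zeros takes
    over and yields a multiple of a power of \<open>star \<gamma>\<close>.\<close>
  proof (cases "a \<ge> 1")
    case True
    hence "null \<phi> (U (replicate (a + b) True) (sorted_bits a b))" using row[of True] ab by (simp add: cnt)
    hence "null \<phi> (\<gamma> ^ a * star \<alpha> ^ b)" unfolding U_row_sorted .
    hence "null \<phi> (\<gamma> ^ a)" by (rule null_cancel_star_alpha[OF idem_state])
    thus False using null_power_gamma[OF idem_state True] assms(1) by blast
  next
    case False
    hence "a = 0" "b = n" using ab by auto
    hence "null \<phi> (U (replicate n False) (replicate n True))" using row[of False] n by (simp add: cnt)
    hence "null \<phi> (of_real ((- q) ^ n) *\<^sub>C star \<gamma> ^ n)" unfolding U_row_sorted scaleR_scaleC .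
    hence "null \<phi> (star \<gamma> ^ n)" by (rule null_scale[OF pos]) (simp add: q_nonzero)
    thus False using null_power_gamma[OF idem_state n] assms(1) by blast
  qed
qed

end

lemma idempotent_state_unique:
  assumes "idempotent_state tens \<Delta> \<phi>" "\<phi> (star \<gamma> * \<gamma>) \<noteq> 0"
    and "idempotent_state tens \<Delta> \<psi>" "\<psi> (star \<gamma> * \<gamma>) \<noteq> 0"
  shows "\<phi> = \<psi>"
proof (rule U_eqI)
  note st = idem_state[OF assms(1)] idem_state[OF assms(3)]
  note lin = state_linear[OF st(1)] state_linear[OF st(2)]
  show "bounded_clinear \<phi>" "bounded_clinear \<psi>" using st by (simp_all add: state_bcl)
  have "\<forall>I J. length I = n \<and> length J = n \<longrightarrow> \<phi> (U I J) = \<psi> (U I J)" for n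
  proof (induction n rule: less_induct)
    case (less n)
    show ?case
    proof (cases "n = 0")
      case True
      thus ?thesis by (simp add: state_one st)
    next
      case False
      hence n: "n \<ge> 1" by simp
      show ?thesis
      proof (intro allI impI, elim conjE)
        fix I J :: "bool list" assume I: "length I = n" and J: "length J = n"
        \<comment> \<open>On the shorter words produced by \<open>u_swap\<close> the two states
          agree by induction, so the exchange rule is exact for the difference.\<close>
        define f where "f K = \<phi> (U K J) - \<psi> (U K J)" for K
        have swap: "f (K @ [True, False] @ K') = (1 / q) *\<^sub>R f (K @ [False, True] @ K')"
          if len: "length K + length K' + 2 = n" for K K'
        proof -
          obtain J1 j j' J2 where J': "J = J1 @ [j, j'] @ J2" "length J1 = length K" "length J2 = length K'"
          proof (rule split_at_two)
            show "length J = length K + length K' + 2" using len J by simp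
          qed
          obtain \<kappa> where \<kappa>: "u True j * u False j' = (1 / q) *\<^sub>R (u False j * u True j') + \<kappa> *\<^sub>R 1"
            using u_swap .
          have "U (K @ [True, False] @ K') J = U K J1 * (u True j * u False j') * U K' J2"
            by (simp add: J' U_append mult.assoc)
          also have "\<dots> = (1 / q) *\<^sub>R U (K @ [False, True] @ K') J + \<kappa> *\<^sub>R U (K @ K') (J1 @ J2)"
            unfolding \<kappa> by (simp add: J' U_append mult.assoc distrib_left distrib_right)
          finally have "U (K @ [True, False] @ K') J =
            (1 / q) *\<^sub>R U (K @ [False, True] @ K') J + \<kappa> *\<^sub>R U (K @ K') (J1 @ J2)" .
          moreover have "\<phi> (U (K @ K') (J1 @ J2)) = \<psi> (U (K @ K') (J1 @ J2))"
            using less[of "n - 2"] that J' n by auto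
          ultimately show ?thesis by (simp add: f_def lin algebra_simps)
        qed
        show "\<phi> (U I J) = \<psi> (U I J)"
        proof (cases "count_list I True = count_list J True")
          case False
          thus ?thesis using idem_U_balanced[OF assms(1)] idem_U_balanced[OF assms(3)] I J by simp
        next
          case True
          let ?S = "{K. length K = n \<and> count_list K True = count_list J True}"
          let ?s = "sorted_bits (count_list J False) (count_list J True)"
          have fK: "f K = of_real (theta q K) * f ?s" if "K \<in> ?S" for K
          proof -
            have "count_list K False = count_list J False"
              using count_list_bits[of K] count_list_bits[of J] that J by auto
            moreover have "f K = theta q K *\<^sub>R f (sorted_bits (count_list K False) (count_list K True))"
              by (rule swap_scaling_sort[OF swap]) (use that in auto)
            ultimately show ?thesis using that by (simp add: scaleR_conv_of_real)
          qed
          have fin: "finite ?S" by (rule finite_subset[OF _ finite_bitlists[of n]]) auto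
          \<comment> \<open>The factor \<open>theta q K\<close> enters once from the linear equation
            and once from sorting \<open>K\<close>, so a positive sum of squares multiplies the
            single unknown \<open>f ?s\<close>.\<close>
          have "0 = (\<Sum>K\<in>?S. of_real (theta q K) * f K)"
            using idem_weighted_sum_zero[OF assms(1,2) n J] idem_weighted_sum_zero[OF assms(3,4) n J]
            by (simp add: f_def right_diff_distrib sum_subtractf)
          also have "\<dots> = (\<Sum>K\<in>?S. of_real ((theta q K)\<^sup>2) * f ?s)"
            by (intro sum.cong refl) (simp add: fK power2_eq_square)
          also have "\<dots> = of_real (\<Sum>K\<in>?S. (theta q K)\<^sup>2) * f ?s"
            by (simp add: sum_distrib_right)
          finally have "(\<Sum>K\<in>?S. (theta q K)\<^sup>2) = 0 \<or> f ?s = 0"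
            by (simp only: eq_commute[of 0] mult_eq_0_iff of_real_eq_0_iff)
          moreover have "(\<Sum>K\<in>?S. (theta q K)\<^sup>2) \<noteq> 0"
          proof
            assume "(\<Sum>K\<in>?S. (theta q K)\<^sup>2) = 0"
            hence "(theta q I)\<^sup>2 = 0" using fin True I by (subst (asm) sum_nonneg_eq_0_iff) auto
            thus False using theta_nonzero[OF q_nonzero, of I] by simp
          qed
          ultimately have "f I = 0" using fK[of I] True I by simp
          thus ?thesis by (simp add: f_def)
        qed
      qed
    qed
  qed
  thus "\<phi> (U I J) = \<psi> (U I J)" if "length I = length J" for I J using that by blast
qed

end

section \<open>A representation with nonzero gamma\<close>

definition finite_support :: "(nat \<Rightarrow> complex) \<Rightarrow> bool"
  where "finite_support f \<longleftrightarrow> (\<exists>N. \<forall>n\<ge>N. f n = 0)"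

text \<open>The inner product of square-summable sequences. It is used with a finitely supported
  first argument, so the series is a finite sum, the second argument may be any sequence, and no
  completion is involved.\<close>

definition ip :: "(nat \<Rightarrow> complex) \<Rightarrow> (nat \<Rightarrow> complex) \<Rightarrow> complex"
  where "ip f g = suminf (\<lambda>n. cnj (f n) * g n)"

lemma ip_sums:
  assumes "finite_support f"
  shows "(\<lambda>n. cnj (f n) * g n) sums ip f g"
proof -
  obtain N where "\<forall>n\<ge>N. f n = 0" using assms by (auto simp: finite_support_def)
  hence "summable (\<lambda>n. cnj (f n) * g n)" by (intro summable_finite[of "{..<N}"]) (auto simp: not_less)
  thus ?thesis unfolding ip_def by (rule summable_sums)
qed

lemma ip_eqI: "finite_support f \<Longrightarrow> (\<lambda>n. cnj (f n) * g n) sums z \<Longrightarrow> ip f g = z"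
  using ip_sums sums_unique2 by blast

lemma ip_self:
  assumes "finite_support f"
  shows "ip f f \<in> \<real>\<^sub>\<ge>\<^sub>0" "ip f f = 0 \<Longrightarrow> f n = 0"
proof -
  obtain N where N: "\<forall>n\<ge>N. f n = 0" using assms by (auto simp: finite_support_def)
  have "cnj (f n) * f n = of_real ((cmod (f n))\<^sup>2)" for n
    by (metis complex_norm_square mult.commute of_real_power)
  hence "ip f f = (\<Sum>n\<in>{..<N}. of_real ((cmod (f n))\<^sup>2))"
    unfolding ip_def using N by (subst suminf_finite[of "{..<N}"]) (auto simp: not_less)
  hence *: "ip f f = of_real (\<Sum>n\<in>{..<N}. (cmod (f n))\<^sup>2)" by simp
  show "ip f f \<in> \<real>\<^sub>\<ge>\<^sub>0" unfolding * by (simp add: sum_nonneg del: of_real_sum)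
  show "f n = 0" if "ip f f = 0"
  proof (cases "n < N")
    case True
    have "(\<Sum>n\<in>{..<N}. (cmod (f n))\<^sup>2) = 0" using * that by (metis of_real_eq_0_iff)
    thus ?thesis using True by (simp add: sum_nonneg_eq_0_iff)
  qed (use N in auto)
qed

text \<open>The irreducible representation on \<open>\<ell>\<^sup>2(\<nat>)\<close>:
  \<open>\<alpha> e\<^sub>n = (1 - q\<^sup>2\<^sup>n)\<^sup>1\<^sup>/\<^sup>2 e\<^sub>n\<^sub>-\<^sub>1\<close> and \<open>\<gamma> e\<^sub>n = q\<^sup>n e\<^sub>n\<close>.\<close>

context
  fixes q :: real assumes q_le_1: "q\<^sup>2 \<le> 1"
begin

definition wt :: "nat \<Rightarrow> complex"
  where "wt n = of_real (sqrt (1 - (q\<^sup>2) ^ n))"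

lemma wt_zero [simp]: "wt 0 = 0"
  by (simp add: wt_def)

lemma wt_square: "wt n * wt n = 1 - of_real ((q\<^sup>2) ^ n)"
proof -
  have "(q\<^sup>2) ^ n \<le> 1" by (rule power_le_one) (use q_le_1 in auto)
  hence "sqrt (1 - (q\<^sup>2) ^ n) * sqrt (1 - (q\<^sup>2) ^ n) = 1 - (q\<^sup>2) ^ n" by simp
  thus ?thesis unfolding wt_def of_real_mult[symmetric] by simp
qed

lemma cnj_wt [simp]: "cnj (wt n) = wt n"
  by (simp add: wt_def)

text \<open>At \<open>n = 0\<close> the truncated \<open>n - 1\<close> does no harm because
  \<open>wt 0 = 0\<close>. Both letters for \<open>\<gamma>\<close> act alike since the operator is
  diagonal with real entries.\<close>

fun op :: "letter \<Rightarrow> (nat \<Rightarrow> complex) \<Rightarrow> nat \<Rightarrow> complex" where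
  "op Alpha f n = wt (Suc n) * f (Suc n)"
| "op Alpha_Star f n = wt n * f (n - 1)"
| "op Gamma f n = of_real (q ^ n) * f n"
| "op Gamma_Star f n = of_real (q ^ n) * f n"

definition opw :: "letter list \<Rightarrow> (nat \<Rightarrow> complex) \<Rightarrow> nat \<Rightarrow> complex"
  where "opw ls f = foldr op ls f"

definition rep :: "free_alg \<Rightarrow> (nat \<Rightarrow> complex) \<Rightarrow> nat \<Rightarrow> complex"
  where "rep x f n = lin_ext (\<lambda>w. opw (letters_of w) f n) x"

lemma op_lin: "op l (\<lambda>n. f n + a * g n) = (\<lambda>n. op l f n + a * op l g n)"
  by (rule ext) (cases l; simp add: algebra_simps)

lemma opw_lin: "opw ls (\<lambda>n. f n + a * g n) = (\<lambda>n. opw ls f n + a * opw ls g n)"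
  by (induction ls) (simp_all add: opw_def op_lin)

lemma opw_zero: "opw ls (\<lambda>n. 0) = (\<lambda>n. 0)"
  using opw_lin[of ls "\<lambda>n. 0" "-1" "\<lambda>n. 0"] by (auto simp: fun_eq_iff)

lemma opw_append: "opw (ls @ ls') f = opw ls (opw ls' f)"
  by (simp add: opw_def)

lemma rep_add: "rep (x + Poly_Mapping.single w c) f = (\<lambda>n. rep x f n + c * opw (letters_of w) f n)"
  by (rule ext) (simp add: rep_def lin_ext_add)

lemma rep_zero [simp]: "rep 0 f = (\<lambda>n. 0)"
  by (rule ext) (simp add: rep_def)

lemma rep_plus: "rep (x + y) f n = rep x f n + rep y f n"
  by (simp add: rep_def lin_ext_add)

lemma rep_fconst: "rep (fconst c * x) f n = c * rep x f n"
  by (simp add: rep_def lin_ext_fconst_mult)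

lemma rep_minus: "rep (- x) f n = - rep x f n"
  using rep_plus[of x "-x" f n] by (simp add: eq_neg_iff_add_eq_0 add.commute)

lemma rep_diff: "rep (x - y) f n = rep x f n - rep y f n"
  using rep_plus[of x "-y" f n] by (simp add: rep_minus)

lemma rep_single: "rep (Poly_Mapping.single w c) f n = c * opw (letters_of w) f n"
  by (simp add: rep_def)

lemma rep_one: "rep 1 f = f"
proof -
  have one: "(1 :: free_alg) = Poly_Mapping.single (Word []) 1" by (simp flip: zero_letters_def)
  have "rep 1 f n = f n" for n unfolding one rep_single by (simp add: opw_def)
  thus ?thesis by blast
qed

lemma rep_mult: "rep (x * y) f = rep x (rep y f)"
proof (induction x rule: free_alg_induct)
  case (add x w c)
  have "rep (Poly_Mapping.single w c * y) f = (\<lambda>n. c * opw (letters_of w) (rep y f) n)"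
  proof (induction y rule: free_alg_induct)
    case (add y v d)
    show ?case
      by (rule ext) (simp add: distrib_left rep_plus add mult_single rep_single plus_letters_def rep_add
          opw_lin opw_append algebra_simps)
  qed (simp add: opw_zero)
  thus ?case using add by (simp add: distrib_right fun_eq_iff rep_plus rep_single)
qed (simp add: fun_eq_iff)

lemma rep_fgen: "rep (fgen l) f = op l f"
  by (rule ext) (simp add: rep_single opw_def)

lemma rep_const: "rep (fconst c) f n = c * f n"
  using rep_fconst[of c 1 f n] by (simp add: rep_one)

lemma finite_support_op:
  assumes "finite_support f" shows "finite_support (op l f)"
proof -
  obtain N where "\<forall>n\<ge>N. f n = 0" using assms by (auto simp: finite_support_def)
  hence "\<forall>n\<ge>Suc N. op l f n = 0" by (cases l) auto
  thus ?thesis unfolding finite_support_def by blast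
qed

lemma finite_support_opw: "finite_support f \<Longrightarrow> finite_support (opw ls f)"
  by (induction ls) (simp_all add: opw_def finite_support_op)

lemma finite_support_lin:
  assumes "finite_support f" "finite_support g"
  shows "finite_support (\<lambda>n. f n + c * g n)"
proof -
  obtain N M where "\<forall>n\<ge>N. f n = 0" "\<forall>n\<ge>M. g n = 0" using assms by (auto simp: finite_support_def)
  hence "\<forall>n\<ge>max N M. f n + c * g n = 0" by auto
  thus ?thesis unfolding finite_support_def by blast
qed

lemma finite_support_rep: "finite_support f \<Longrightarrow> finite_support (rep x f)"
  by (induction x rule: free_alg_induct)
     (simp_all add: rep_add finite_support_lin finite_support_opw, simp add: finite_support_def)

lemma op_adjoint:
  assumes "finite_support f"
  shows "ip (op l f) g = ip f (op (letter_star l) g)"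
proof (rule ip_eqI[OF finite_support_op[OF assms]])
  have f: "(\<lambda>n. cnj (f n) * op (letter_star l) g n) sums ip f (op (letter_star l) g)"
    by (rule ip_sums[OF assms])
  show "(\<lambda>n. cnj (op l f n) * g n) sums ip f (op (letter_star l) g)"
  proof (cases l)
    case Alpha
    have "(\<lambda>n. cnj (f (Suc n)) * op Alpha_Star g (Suc n)) sums (ip f (op Alpha_Star g) - cnj (f 0) * op Alpha_Star g 0)"
      using f unfolding Alpha letter_star.simps by (subst sums_Suc_iff) simp
    thus ?thesis by (simp add: Alpha mult_ac)
  next
    case Alpha_Star
    have "(\<lambda>n. cnj (op Alpha_Star f (Suc n)) * g (Suc n)) sums ip f (op Alpha g)"
      using f by (simp add: Alpha_Star mult_ac)
    hence "(\<lambda>n. cnj (op Alpha_Star f n) * g n) sums (ip f (op Alpha g) + cnj (op Alpha_Star f 0) * g 0)"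
      by (subst (asm) sums_Suc_iff) simp
    thus ?thesis by (simp add: Alpha_Star)
  qed (use f in \<open>simp_all add: mult_ac\<close>)
qed

lemma opw_adjoint:
  "finite_support f \<Longrightarrow> ip (opw ls f) g = ip f (opw (rev (map letter_star ls)) g)"
proof (induction ls arbitrary: g)
  case (Cons l ls)
  have "ip (opw (l # ls) f) g = ip (op l (opw ls f)) g" by (simp add: opw_def)
  also have "\<dots> = ip f (opw (rev (map letter_star ls)) (op (letter_star l) g))"
    using Cons by (simp add: op_adjoint finite_support_opw)
  also have "\<dots> = ip f (opw (rev (map letter_star (l # ls))) g)"
    by (simp add: opw_append) (simp add: opw_def)
  finally show ?case .
qed (simp add: opw_def)

lemma rep_adjoint: "finite_support f \<Longrightarrow> ip (rep x f) g = ip f (rep (fstar x) g)"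
proof (induction x rule: free_alg_induct)
  case zero
  show ?case by (simp add: ip_def)
next
  case (add x w c)
  have "(\<lambda>n. cnj (rep (x + Poly_Mapping.single w c) f n) * g n) sums
      (ip (rep x f) g + cnj c * ip (opw (letters_of w) f) g)"
  proof -
    have "(\<lambda>n. cnj (rep x f n) * g n + cnj c * (cnj (opw (letters_of w) f n) * g n)) sums
      (ip (rep x f) g + cnj c * ip (opw (letters_of w) f) g)"
      by (intro sums_add sums_mult ip_sums finite_support_rep finite_support_opw add)
    thus ?thesis by (simp add: rep_add algebra_simps)
  qed
  hence 1: "ip (rep (x + Poly_Mapping.single w c) f) g = ip (rep x f) g + cnj c * ip (opw (letters_of w) f) g"
    by (intro ip_eqI finite_support_rep add)
  have "(\<lambda>n. cnj (f n) * rep (fstar x) g n + cnj c * (cnj (f n) * opw (letters_of (word_star w)) g n)) sums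
      (ip f (rep (fstar x) g) + cnj c * ip f (opw (letters_of (word_star w)) g))"
    by (intro sums_add sums_mult ip_sums add)
  hence "(\<lambda>n. cnj (f n) * rep (fstar (x + Poly_Mapping.single w c)) g n) sums
      (ip f (rep (fstar x) g) + cnj c * ip f (opw (letters_of (word_star w)) g))"
    by (simp add: fstar_add rep_add algebra_simps)
  hence 2: "ip f (rep (fstar (x + Poly_Mapping.single w c)) g) =
      ip f (rep (fstar x) g) + cnj c * ip f (opw (letters_of (word_star w)) g)"
    by (intro ip_eqI add)
  show ?case unfolding 1 2 using add by (simp add: opw_adjoint word_star_def)
qed

lemma rep_relators:
  assumes "r \<in> relators q" shows "rep r f n = 0"
proof -
  have sq: "of_real (q ^ n) * (of_real (q ^ n) * z) = of_real ((q\<^sup>2) ^ n) * (z::complex)" for n z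
    by (simp flip: power_mult power_add of_real_mult mult.assoc add: mult_2 power2_eq_square power_mult_distrib)
  have wa: "wt n * (wt (Suc (n - 1)) * f (Suc (n - 1))) = (1 - of_real ((q\<^sup>2) ^ n)) * f n" for n
    by (cases n) (simp_all add: wt_square flip: mult.assoc)
  have wb: "wt (Suc n) * (wt (Suc n) * f n) = (1 - of_real ((q\<^sup>2) ^ Suc n)) * f n" for n
    by (simp only: mult.assoc[symmetric] wt_square)
  show ?thesis
    using assms unfolding relators_def Let_def
    by (elim insertE emptyE; simp only: rep_diff rep_plus rep_mult rep_const rep_fgen rep_one op.simps sq wa wb diff_Suc_1)
       (simp_all add: algebra_simps power2_eq_square)
qed

text \<open>Closure under \<open>fstar\<close> is the delicate case: for
  \<open>g = rep (fstar x) f\<close>, moving the adjoint across gives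
  \<open>ip g g = ip f (rep x g) = 0\<close>, and definiteness of \<open>ip\<close> needs
  \<open>g\<close> finitely supported.\<close>

lemma rep_rel_ideal:
  assumes "x \<in> rel_ideal q"
  shows "finite_support f \<Longrightarrow> rep x f n = 0"
  using assms
proof (induction arbitrary: f n)
  case (mult_left x y)
  hence "rep x f = (\<lambda>n. 0)" by auto
  moreover have "rep y (\<lambda>n. 0) = (\<lambda>n. 0)"
    by (induction y rule: free_alg_induct) (simp_all add: rep_add opw_zero)
  ultimately show ?case by (simp add: rep_mult)
next
  case (star x)
  let ?g = "rep (fstar x) f"
  have fg: "finite_support ?g" using star.prems by (rule finite_support_rep)
  have "ip ?g ?g = ip f (rep x ?g)" using rep_adjoint[OF star.prems, of "fstar x" ?g] by simp
  also have "rep x ?g = (\<lambda>n. 0)" using star.IH[OF fg] by auto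
  finally have "ip ?g ?g = 0" by (simp add: ip_def)
  thus ?case by (rule ip_self(2)[OF fg])
qed (simp_all add: rep_relators rep_plus rep_mult finite_support_rep)

text \<open>The vector state at the first basis vector, which \<open>\<gamma>\<close> leaves
  fixed.\<close>

lemma vacuum_pol_state:
  obtains \<phi> where "pol_state q \<phi>" "\<phi> (fgen Gamma_Star * fgen Gamma) = 1"
proof -
  define e where "e n = (if n = 0 then 1 else 0 :: complex)" for n :: nat
  define \<phi> where "\<phi> x = rep x e 0" for x
  have e: "finite_support e" unfolding finite_support_def e_def by (intro exI[of _ 1]) auto
  have ip_e: "ip e g = g 0" for g
    unfolding ip_def e_def by (subst suminf_finite[of "{0}"]) auto
  have "\<phi> (fstar x * x) \<in> \<real>\<^sub>\<ge>\<^sub>0" for x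
  proof -
    have "\<phi> (fstar x * x) = ip (rep x e) (rep x e)"
      unfolding \<phi>_def ip_e[symmetric] rep_mult using rep_adjoint[OF e, of x "rep x e"] by simp
    thus ?thesis using ip_self(1)[OF finite_support_rep[OF e]] by simp
  qed
  hence "pol_state q \<phi>"
    unfolding pol_state_def using rep_rel_ideal[OF _ e]
    by (auto simp: \<phi>_def rep_plus rep_fconst rep_one) (simp_all add: e_def)
  moreover have "\<phi> (fgen Gamma_Star * fgen Gamma) = 1"
    by (simp add: \<phi>_def rep_mult rep_fgen e_def del: Poly_Mapping.mult_single)
  ultimately show ?thesis using that by blast
qed

end

section \<open>Existence of the Haar state\<close>

text \<open>Weak-star compactness by Tychonoff in a product of discs of radius
  \<open>norm x\<close>. The product runs over all \<open>x\<close>, so no convergent subsequence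
  can be expected; limits are taken along a filter \<open>G\<close> finer than the sequence, and the
  conditions for a state pass to the limit pointwise.\<close>

lemma states_cluster_point:
  fixes A :: "nat \<Rightarrow> 'a::cstar_algebra \<Rightarrow> complex"
  assumes "\<And>n. state (A n)"
  obtains \<phi> G where "state \<phi>" "G \<noteq> bot" "G \<le> filtermap A sequentially" "\<And>x. ((\<lambda>f. f x) \<longlongrightarrow> \<phi> x) G"
proof -
  define S where "S = (PiE UNIV (\<lambda>x::'a. cball (0::complex) (norm x)))"
  have S: "f \<in> S \<longleftrightarrow> (\<forall>x. cmod (f x) \<le> norm x)" for f by (auto simp: S_def)
  have "compactin (product_topology (\<lambda>x::'a. euclidean) UNIV) S"
    unfolding S_def compactin_PiE by simp
  hence "compact S" by (simp add: euclidean_product_topology)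
  moreover have "eventually (\<lambda>f. f \<in> S) (filtermap A sequentially)"
    by (simp add: eventually_filtermap S state_bound assms)
  moreover have "filtermap A sequentially \<noteq> bot" by (simp add: filtermap_bot_iff)
  ultimately obtain \<phi> where \<phi>: "\<phi> \<in> S" "inf (nhds \<phi>) (filtermap A sequentially) \<noteq> bot"
    unfolding compact_filter by blast
  define G where "G = inf (nhds \<phi>) (filtermap A sequentially)"
  have G: "G \<noteq> bot" "G \<le> filtermap A sequentially" using \<phi> by (simp_all add: G_def)
  have lim: "((\<lambda>f. f x) \<longlongrightarrow> \<phi> x) G" for x
  proof -
    have "((\<lambda>f. f x) \<longlongrightarrow> \<phi> x) (nhds \<phi>)"
    proof (rule topological_tendstoI)
      fix V :: "complex set" assume "open V" "\<phi> x \<in> V"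
      moreover from this have "open ((\<lambda>f::'a \<Rightarrow> complex. f x) -` V)"
        by (intro open_vimage continuous_on_product_coordinates)
      ultimately show "eventually (\<lambda>f. f x \<in> V) (nhds \<phi>)"
        by (auto simp: eventually_nhds)
    qed
    thus ?thesis by (rule tendsto_mono[rotated]) (simp add: G_def)
  qed
  have ev: "eventually state G"
    by (rule filter_leD[OF G(2)]) (simp add: eventually_filtermap assms)
  have eq: "a = b" if "(f \<longlongrightarrow> a) G" "(g \<longlongrightarrow> b) G" "\<And>\<rho>. state \<rho> \<Longrightarrow> f \<rho> = g \<rho>" for f g and a b :: complex
  proof -
    have "eventually (\<lambda>\<rho>. f \<rho> = g \<rho>) G" by (rule eventually_mono[OF ev that(3)])
    thus ?thesis using that G(1) by (metis tendsto_cong tendsto_unique)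
  qed
  have "state \<phi>" unfolding state_def
  proof (intro conjI allI bounded_clinearI[where K = 1])
    fix x y c
    show "\<phi> (x + y) = \<phi> x + \<phi> y"
      by (rule eq[OF lim tendsto_add[OF lim lim]]) (simp add: bounded_clinear_simps state_bcl)
    show "\<phi> (c *\<^sub>C x) = c *\<^sub>C \<phi> x"
      by (rule eq[OF lim tendsto_scaleC[OF lim]]) (simp add: bounded_clinear_simps state_bcl)
    show "norm (\<phi> x) \<le> 1 * norm x" using \<phi>(1) by (simp add: S)
    show "\<phi> (star x * x) \<in> \<real>\<^sub>\<ge>\<^sub>0"
      by (rule nonneg_Reals_limit[OF lim G(1)]) (rule eventually_mono[OF ev], simp add: state_def)
    show "\<phi> 1 = 1" by (rule eq[OF lim tendsto_const]) (simp add: state_one)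
  qed
  thus ?thesis using that G lim by blast
qed

lemma state_average:
  assumes "finite K" "K \<noteq> {}" "\<And>k. k \<in> K \<Longrightarrow> state (p k)"
  shows "state (\<lambda>x. (\<Sum>k\<in>K. p k x) / of_nat (card K))"
  unfolding state_def
proof (intro conjI allI bounded_clinearI[where K = 1])
  have c: "card K > 0" using assms by (simp add: card_gt_0_iff)
  note lin = state_linear[OF assms(3)]
  fix x y c
  show "(\<Sum>k\<in>K. p k (x + y)) / of_nat (card K) = (\<Sum>k\<in>K. p k x) / of_nat (card K) + (\<Sum>k\<in>K. p k y) / of_nat (card K)"
    by (simp add: lin sum.distrib add_divide_distrib)
  show "(\<Sum>k\<in>K. p k (c *\<^sub>C x)) / of_nat (card K) = c *\<^sub>C ((\<Sum>k\<in>K. p k x) / of_nat (card K))"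
    by (simp add: lin sum_distrib_left)
  have "cmod (\<Sum>k\<in>K. p k x) \<le> (\<Sum>k\<in>K. norm x)"
    by (rule order_trans[OF norm_sum]) (intro sum_mono state_bound assms)
  thus "norm ((\<Sum>k\<in>K. p k x) / of_nat (card K)) \<le> 1 * norm x"
    using c by (simp add: norm_divide field_simps)
  have "p k (star x * x) \<in> \<real>\<^sub>\<ge>\<^sub>0" if "k \<in> K" for k using assms(3)[OF that] by (simp add: state_def)
  hence "(\<Sum>k\<in>K. p k (star x * x)) \<in> \<real>\<^sub>\<ge>\<^sub>0" by (auto simp: complex_nonneg_Reals_iff intro!: sum_nonneg sum.neutral)
  thus "(\<Sum>k\<in>K. p k (star x * x)) / of_nat (card K) \<in> \<real>\<^sub>\<ge>\<^sub>0"
    by (rule nonneg_Reals_divide_I) simp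
  show "(\<Sum>k\<in>K. p k 1) / of_nat (card K) = 1" using c by (simp add: state_one assms)
qed

context csuq2_tensor
begin

lemma conv_assoc:
  assumes "state \<phi>" "state \<psi>" "state \<omega>"
  shows "conv (conv \<phi> \<psi>) \<omega> = conv \<phi> (conv \<psi> \<omega>)"
proof (rule U_eqI)
  fix I J :: "bool list" assume IJ: "length I = length J"
  let ?B = "bitlists (length J)"
  have "conv (conv \<phi> \<psi>) \<omega> (U I J) = (\<Sum>K\<in>?B. \<Sum>L\<in>?B. \<phi> (U I L) * \<psi> (U L K) * \<omega> (U K J))"
    by (simp add: conv_U[of _ _ _ "length J"] conv_state assms IJ sum_distrib_right)
  also have "\<dots> = (\<Sum>L\<in>?B. \<Sum>K\<in>?B. \<phi> (U I L) * \<psi> (U L K) * \<omega> (U K J))" by (rule sum.swap)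
  also have "\<dots> = conv \<phi> (conv \<psi> \<omega>) (U I J)"
    by (simp add: conv_U[of _ _ _ "length J"] conv_state assms IJ sum_distrib_left mult.assoc)
  finally show "conv (conv \<phi> \<psi>) \<omega> (U I J) = conv \<phi> (conv \<psi> \<omega>) (U I J)" .
qed (intro state_bcl conv_state assms)+

text \<open>A mean ergodic argument: convolving the mean of the powers of \<open>\<psi>\<close> from
  1 to \<open>n + 1\<close> with \<open>\<psi>\<close> shifts it by one power, a change that
  vanishes as \<open>n\<close> grows. A cluster point therefore absorbs \<open>\<psi>\<close>, then
  all powers and means of \<open>\<psi>\<close>, and finally itself.\<close>

lemma idempotent_absorbing:
  assumes \<psi>: "state \<psi>"
  obtains \<phi> where "idempotent_state tens \<Delta> \<phi>" "conv \<phi> \<psi> = \<phi>" "conv \<psi> \<phi> = \<phi>"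
proof -
  define p where "p = rec_nat \<psi> (\<lambda>_ r. conv \<psi> r)"
  have p_simps: "p 0 = \<psi>" "p (Suc k) = conv \<psi> (p k)" for k by (simp_all add: p_def)
  have p: "state (p k)" for k by (induction k) (simp_all add: p_simps conv_state \<psi>)
  have p_comm: "conv (p k) \<psi> = conv \<psi> (p k)" for k
  proof (induction k)
    case (Suc k)
    have "conv (p (Suc k)) \<psi> = conv \<psi> (conv (p k) \<psi>)"
      unfolding p_simps by (rule conv_assoc[OF \<psi> p \<psi>])
    thus ?case unfolding Suc.IH p_simps .
  qed (simp add: p_simps)
  define A where "A n x = (\<Sum>k\<in>{..n}. p k x) / of_nat (Suc n)" for n x
  have A: "state (A n)" for n
  proof -
    have "A n = (\<lambda>x. (\<Sum>k\<in>{..n}. p k x) / of_nat (card {..n}))" by (simp add: fun_eq_iff A_def)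
    moreover have "state (\<lambda>x. (\<Sum>k\<in>{..n}. p k x) / of_nat (card {..n}))"
      by (rule state_average) (auto intro: p)
    ultimately show ?thesis by (simp only:)
  qed
  obtain \<phi> G where \<phi>: "state \<phi>" and G: "G \<noteq> bot" "G \<le> filtermap A sequentially"
    and lim: "\<And>x. ((\<lambda>f. f x) \<longlongrightarrow> \<phi> x) G"
    by (rule states_cluster_point[of A, OF A]) (rule that)
  \<comment> \<open>Convolution by \<open>\<psi>\<close> from the left and from the right both have
    this shape on an entry of \<open>U\<close>, with \<open>c\<close> taken from
    \<open>\<psi>\<close>. The difference of the averages telescopes to its first and last term,
    each of modulus at most \<open>norm y\<close>.\<close>
  have limit: "(\<Sum>K\<in>S. c K * \<phi> (W K)) = \<phi> y"
    if "\<And>k. (\<Sum>K\<in>S. c K * p k (W K)) = p (Suc k) y" for S y and c :: "bool list \<Rightarrow> complex" and W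
  proof -
    have "(\<lambda>n. (\<Sum>K\<in>S. c K * A n (W K)) - A n y) \<longlonglongrightarrow> 0"
    proof (rule Lim_null_comparison)
      show "(\<lambda>n. 2 * norm y * inverse (real (Suc n))) \<longlonglongrightarrow> 0"
        using tendsto_mult[OF tendsto_const LIMSEQ_inverse_real_of_nat, of "2 * norm y"] by simp
      have "cmod ((\<Sum>K\<in>S. c K * A n (W K)) - A n y) \<le> 2 * norm y * inverse (real (Suc n))" for n
      proof -
        have "(\<Sum>K\<in>S. c K * A n (W K)) = (\<Sum>k\<in>{..n}. \<Sum>K\<in>S. c K * p k (W K)) / of_nat (Suc n)"
          by (simp add: A_def sum_divide_distrib sum_distrib_left sum.swap[of _ _ "{..n}"])
        moreover have "(\<Sum>k\<in>{..n}. p (Suc k) y) - (\<Sum>k\<in>{..n}. p k y) = p (Suc n) y - p 0 y"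
          by (induction n) (simp_all add: algebra_simps)
        ultimately have "(\<Sum>K\<in>S. c K * A n (W K)) - A n y = (p (Suc n) y - p 0 y) / of_nat (Suc n)"
          unfolding that A_def by (simp only: diff_divide_distrib[symmetric])
        moreover have "cmod (p (Suc n) y - p 0 y) \<le> norm y + norm y"
          by (rule order_trans[OF norm_triangle_ineq4]) (intro add_mono state_bound p)
        ultimately show ?thesis by (simp add: divide_inverse norm_mult norm_inverse mult_right_mono del: of_nat_Suc)
      qed
      thus "\<forall>\<^sub>F n in sequentially. norm ((\<Sum>K\<in>S. c K * A n (W K)) - A n y) \<le> 2 * norm y * inverse (real (Suc n))"
        by simp
    qed
    hence "((\<lambda>f. (\<Sum>K\<in>S. c K * f (W K)) - f y) \<longlongrightarrow> 0) (filtermap A sequentially)"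
      by (simp add: filterlim_filtermap)
    hence "((\<lambda>f. (\<Sum>K\<in>S. c K * f (W K)) - f y) \<longlongrightarrow> 0) G" by (rule tendsto_mono[OF G(2)])
    moreover have "((\<lambda>f. (\<Sum>K\<in>S. c K * f (W K)) - f y) \<longlongrightarrow> (\<Sum>K\<in>S. c K * \<phi> (W K)) - \<phi> y) G"
      by (intro tendsto_intros lim)
    ultimately have "(\<Sum>K\<in>S. c K * \<phi> (W K)) - \<phi> y = 0" using G(1) tendsto_unique by blast
    thus ?thesis by simp
  qed
  have left: "conv \<psi> \<phi> = \<phi>"
  proof (rule U_eqI)
    fix I J :: "bool list" assume IJ: "length I = length J"
    show "conv \<psi> \<phi> (U I J) = \<phi> (U I J)"
      unfolding conv_U[OF \<psi> \<phi> IJ refl] by (rule limit) (simp add: p_simps conv_U[OF \<psi> p IJ refl])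
  qed (intro state_bcl conv_state \<phi> \<psi>)+
  have right: "conv \<phi> \<psi> = \<phi>"
  proof (rule U_eqI)
    fix I J :: "bool list" assume IJ: "length I = length J"
    show "conv \<phi> \<psi> (U I J) = \<phi> (U I J)"
      unfolding conv_U[OF \<phi> \<psi> IJ refl] mult.commute[of "\<phi> _"]
      by (rule limit) (simp add: p_simps conv_U[OF p \<psi> IJ refl] mult.commute flip: p_comm)
  qed (intro state_bcl conv_state \<phi> \<psi>)+
  have absorb: "conv \<phi> (p k) = \<phi>" for k
    by (induction k) (simp_all add: p_simps right p \<phi> \<psi> flip: conv_assoc)
  \<comment> \<open>The left factor is kept fixed while the mean in the right factor tends to
    \<open>\<phi>\<close>; on an entry of \<open>U\<close> this is a limit of finite sums.\<close>
  have "conv \<phi> \<phi> = \<phi>"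
  proof (rule U_eqI)
    fix I J :: "bool list" assume IJ: "length I = length J"
    have "(\<Sum>K\<in>bitlists (length J). \<phi> (U I K) * A n (U K J)) = \<phi> (U I J)" for n
    proof -
      have "(\<Sum>K\<in>bitlists (length J). \<phi> (U I K) * A n (U K J)) =
        (\<Sum>k\<in>{..n}. \<Sum>K\<in>bitlists (length J). \<phi> (U I K) * p k (U K J)) / of_nat (Suc n)"
        by (simp add: A_def sum_divide_distrib sum_distrib_left sum.swap[of _ _ "{..n}"])
      also have "\<dots> = \<phi> (U I J)"
        by (simp add: absorb flip: conv_U[OF \<phi> p IJ refl] del: of_nat_Suc)
      finally show ?thesis .
    qed
    hence "eventually (\<lambda>f. (\<Sum>K\<in>bitlists (length J). \<phi> (U I K) * f (U K J)) = \<phi> (U I J)) G"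
      by (intro filter_leD[OF G(2)]) (simp add: eventually_filtermap)
    hence "((\<lambda>f. \<Sum>K\<in>bitlists (length J). \<phi> (U I K) * f (U K J)) \<longlongrightarrow> \<phi> (U I J)) G"
      by (rule tendsto_eventually)
    moreover have "((\<lambda>f. \<Sum>K\<in>bitlists (length J). \<phi> (U I K) * f (U K J)) \<longlongrightarrow>
        (\<Sum>K\<in>bitlists (length J). \<phi> (U I K) * \<phi> (U K J))) G"
      by (intro tendsto_intros lim)
    ultimately have "(\<Sum>K\<in>bitlists (length J). \<phi> (U I K) * \<phi> (U K J)) = \<phi> (U I J)"
      using G(1) tendsto_unique by blast
    thus "conv \<phi> \<phi> (U I J) = \<phi> (U I J)" by (simp add: conv_U[OF \<phi> \<phi> IJ refl])
  qed (intro state_bcl conv_state \<phi>)+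
  thus ?thesis using that left right \<phi> by (simp add: idempotent_state_iff)
qed

lemma null_gamma:
  assumes "state \<phi>" "\<phi> (star \<gamma> * \<gamma>) = 0"
  shows "\<phi> (x * \<gamma>) = 0" "\<phi> (x * star \<gamma>) = 0" "\<phi> (\<gamma> * x) = 0" "\<phi> (star \<gamma> * x) = 0"
proof -
  note pos = state_pos_fun[OF assms(1)]
  have "null \<phi> \<gamma>" "null \<phi> (star \<gamma>)" using assms(2) by (simp_all add: star_star normal_order)
  from null_mult[OF pos this(1)] null_mult[OF pos this(2)]
  have 1: "\<phi> (x * \<gamma>) = 0" "\<phi> (x * star \<gamma>) = 0" for x by auto
  thus "\<phi> (x * \<gamma>) = 0" "\<phi> (x * star \<gamma>) = 0" by auto
  have "\<phi> y = cnj (\<phi> (star y))" for y by (simp add: pos_fun_star[OF pos])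
  from this[of "\<gamma> * x"] this[of "star \<gamma> * x"]
  show "\<phi> (\<gamma> * x) = 0" "\<phi> (star \<gamma> * x) = 0" by (simp_all add: star_mult star_star 1)
qed

text \<open>The entry tested is a nonzero multiple of \<open>star \<gamma> * \<gamma>\<close>. If
  \<open>\<phi>\<close> lived on the circle, only the summand with
  \<open>\<phi> (star \<alpha> * \<alpha>) = 1\<close> would survive in the convolution, and the
  value of \<open>\<psi>\<close> there would have to vanish too.\<close>

lemma absorbing_nonzero:
  assumes \<phi>: "state \<phi>" "conv \<phi> \<psi> = \<phi>" and \<psi>: "state \<psi>" "\<psi> (star \<gamma> * \<gamma>) \<noteq> 0"
  shows "\<phi> (star \<gamma> * \<gamma>) \<noteq> 0"
proof
  assume z: "\<phi> (star \<gamma> * \<gamma>) = 0"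
  note lin = state_linear[OF \<phi>(1)] state_linear[OF \<psi>(1)]
  have c: "U [True, False] [False, True] = - (q *\<^sub>R (star \<gamma> * \<gamma>))"
    by (simp add: u_def normal_order)
  have "\<phi> (U [True, False] [False, True]) =
      (\<Sum>K\<in>bitlists (Suc (Suc 0)). \<phi> (U [True, False] K) * \<psi> (U K [False, True]))"
    using conv_U[OF \<phi>(1) \<psi>(1), of "[True, False]" "Suc (Suc 0)" "[False, True]"] by (simp add: \<phi>(2))
  also have "\<dots> = \<phi> (star \<alpha> * \<alpha>) * \<psi> (U [True, False] [False, True])"
    by (simp add: sum_bitlists_Suc u_def lin null_gamma[OF \<phi>(1) z])
  also have "\<phi> (star \<alpha> * \<alpha>) = 1" by (simp add: normal_order lin z state_one \<phi>)
  finally show False unfolding c using \<psi>(2) q_nonzero by (simp add: lin z)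
qed

lemma haar_idempotent_exists:
  obtains h where "idempotent_state tens \<Delta> h" "h (star \<gamma> * \<gamma>) \<noteq> 0"
proof -
  obtain \<phi> where \<phi>: "pol_state q \<phi>" "\<phi> (fgen Gamma_Star * fgen Gamma) = 1"
    using vacuum_pol_state[of q] q_square by auto
  obtain \<psi> where \<psi>: "state \<psi>" "\<And>x. \<psi> (ev x) = \<phi> x" using state_extension[OF \<phi>(1)] by blast
  have "\<psi> (star \<gamma> * \<gamma>) \<noteq> 0"
    using \<psi>(2)[of "fgen Gamma_Star * fgen Gamma"] \<phi>(2) by (simp only: eval_free_mult eval_free_fgen) simp
  moreover obtain h where h: "idempotent_state tens \<Delta> h" "conv h \<psi> = h"
    using idempotent_absorbing[OF \<psi>(1)] by blast
  ultimately show ?thesis using that absorbing_nonzero[of h \<psi>] \<psi>(1) idem_state[OF h(1)] by blast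
qed

lemma conv_haar:
  assumes h: "idempotent_state tens \<Delta> h" "h (star \<gamma> * \<gamma>) \<noteq> 0" and \<rho>: "state \<rho>"
  shows "conv h \<rho> = h" "conv \<rho> h = h"
proof -
  note hs = idem_state[OF h(1)]
  \<comment> \<open>Mixing in \<open>h\<close> keeps the value at
    \<open>star \<gamma> * \<gamma>\<close> positive even when \<open>\<rho>\<close> lives on the
    circle, and the contribution of \<open>h\<close> can be subtracted afterwards because
    \<open>conv h h = h\<close>.\<close>
  define \<psi> where "\<psi> x = (\<rho> x + h x) / 2" for x
  have \<psi>: "state \<psi>"
  proof -
    have "state (\<lambda>x. (\<Sum>k\<in>{False, True}. (if k then h else \<rho>) x) / of_nat (card {False, True}))"
      by (rule state_average) (use hs \<rho> in auto)
    thus ?thesis by (simp add: \<psi>_def[abs_def])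
  qed
  have "Re (h (star \<gamma> * \<gamma>)) > 0"
    using h(2) pos_fun_real[OF state_pos_fun[OF hs], of \<gamma>] by (auto simp: complex_eq_iff less_le)
  moreover have "Re (\<rho> (star \<gamma> * \<gamma>)) \<ge> 0" by (rule pos_fun_real[OF state_pos_fun[OF \<rho>]])
  ultimately have "Re (\<rho> (star \<gamma> * \<gamma>) + h (star \<gamma> * \<gamma>)) > 0" by simp
  hence "\<rho> (star \<gamma> * \<gamma>) + h (star \<gamma> * \<gamma>) \<noteq> 0" by (metis less_irrefl zero_complex.sel(1))
  hence "\<psi> (star \<gamma> * \<gamma>) \<noteq> 0" by (simp add: \<psi>_def)
  moreover obtain \<phi> where \<phi>: "idempotent_state tens \<Delta> \<phi>" "conv \<phi> \<psi> = \<phi>" "conv \<psi> \<phi> = \<phi>"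
    using idempotent_absorbing[OF \<psi>] by blast
  ultimately have "\<phi> (star \<gamma> * \<gamma>) \<noteq> 0" using absorbing_nonzero[of \<phi> \<psi>] \<psi> idem_state[OF \<phi>(1)] by blast
  hence "\<phi> = h" using idempotent_state_unique[OF \<phi>(1) _ h] by blast
  hence c: "conv h \<psi> = h" "conv \<psi> h = h" using \<phi> by auto
  have hh: "conv h h = h" using h(1) by (simp add: idempotent_state_iff)
  show "conv h \<rho> = h" "conv \<rho> h = h"
  proof (rule_tac [!] U_eqI)
    fix I J :: "bool list" assume IJ: "length I = length J"
    have "conv h \<psi> (U I J) = (conv h \<rho> (U I J) + conv h h (U I J)) / 2"
      "conv \<psi> h (U I J) = (conv \<rho> h (U I J) + conv h h (U I J)) / 2"
      unfolding conv_U[OF hs \<psi> IJ refl] conv_U[OF \<psi> hs IJ refl] conv_U[OF hs \<rho> IJ refl]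
        conv_U[OF \<rho> hs IJ refl] conv_U[OF hs hs IJ refl] \<psi>_def
      by (simp_all add: sum_divide_distrib distrib_left distrib_right sum.distrib add_divide_distrib)
    thus "conv h \<rho> (U I J) = h (U I J)" "conv \<rho> h (U I J) = h (U I J)"
      unfolding c hh by (simp_all add: field_simps)
  qed (intro state_bcl conv_state hs \<rho>)+
qed

section \<open>From absorption of all states to invariance\<close>

lemma left_slice_state:
  assumes "state h" "state \<rho>"
  shows "\<rho> (tensor_lift tens (\<lambda>a b. h a *\<^sub>C b) (\<Delta> x)) = conv h \<rho> x"
proof -
  obtain F where F: "bounded_clinear F" "\<And>a b. F (tens a b) = h a *\<^sub>C b" using left_slice[OF assms(1)] by blast
  have "(\<lambda>y. \<rho> (F y)) = product_state h \<rho>"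
    by (rule tensor_eqI[OF bounded_clinear_compose[OF state_bcl[OF assms(2)] F(1)] state_bcl[OF product_state(1)[OF assms]]])
       (simp add: F(2) product_state(2)[OF assms] state_linear[OF assms(2)])
  thus ?thesis unfolding tensor_lift_eqI[OF F] conv_def by (rule fun_cong)
qed

lemma right_slice_state:
  assumes "state h" "state \<rho>"
  shows "\<rho> (tensor_lift tens (\<lambda>a b. h b *\<^sub>C a) (\<Delta> x)) = conv \<rho> h x"
proof -
  obtain F where F: "bounded_clinear F" "\<And>a b. F (tens a b) = h b *\<^sub>C a" using right_slice[OF assms(1)] by blast
  have "(\<lambda>y. \<rho> (F y)) = product_state \<rho> h"
    by (rule tensor_eqI[OF bounded_clinear_compose[OF state_bcl[OF assms(2)] F(1)] state_bcl[OF product_state(1)[OF assms(2,1)]]])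
       (simp add: F(2) product_state(2)[OF assms(2,1)] state_linear[OF assms(2)] mult.commute)
  thus ?thesis unfolding tensor_lift_eqI[OF F] conv_def by (rule fun_cong)
qed

text \<open>Invariance is an identity in the algebra and is tested by states \<open>\<rho>\<close>,
  which turn a slice into a convolution with \<open>\<rho>\<close>; so it amounts to absorption of
  every state. An invariant \<open>h'\<close> equals \<open>h\<close> because
  \<open>conv h' h\<close> can be read from either side.\<close>

lemma haar_state_eqI:
  assumes h: "idempotent_state tens \<Delta> h" "h (star \<gamma> * \<gamma>) \<noteq> 0"
  shows "haar_state tens \<Delta> = h"
  unfolding haar_state_def
proof (rule the_equality)
  note hs = idem_state[OF h(1)]
  show "state h \<and> (\<forall>x. tensor_lift tens (\<lambda>a b. h a *\<^sub>C b) (\<Delta> x) = h x *\<^sub>C 1 \<and>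
      tensor_lift tens (\<lambda>a b. h b *\<^sub>C a) (\<Delta> x) = h x *\<^sub>C 1)"
  proof (intro conjI allI hs)
    fix x
    have "tensor_lift tens (\<lambda>a b. h a *\<^sub>C b) (\<Delta> x) - h x *\<^sub>C 1 = 0"
      by (rule states_separate)
         (simp add: state_linear left_slice_state hs conv_haar[OF h] state_one)
    thus "tensor_lift tens (\<lambda>a b. h a *\<^sub>C b) (\<Delta> x) = h x *\<^sub>C 1" by simp
    have "tensor_lift tens (\<lambda>a b. h b *\<^sub>C a) (\<Delta> x) - h x *\<^sub>C 1 = 0"
      by (rule states_separate)
         (simp add: state_linear right_slice_state hs conv_haar[OF h] state_one)
    thus "tensor_lift tens (\<lambda>a b. h b *\<^sub>C a) (\<Delta> x) = h x *\<^sub>C 1" by simp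
  qed
  fix h'
  assume h': "state h' \<and> (\<forall>x. tensor_lift tens (\<lambda>a b. h' a *\<^sub>C b) (\<Delta> x) = h' x *\<^sub>C 1 \<and>
      tensor_lift tens (\<lambda>a b. h' b *\<^sub>C a) (\<Delta> x) = h' x *\<^sub>C 1)"
  show "h' = h"
  proof
    fix x
    have "h' x = h (tensor_lift tens (\<lambda>a b. h' a *\<^sub>C b) (\<Delta> x))"
      using h' by (simp add: state_linear[OF hs] state_one[OF hs])
    also have "\<dots> = conv h' h x" by (rule left_slice_state) (use h' hs in auto)
    also have "\<dots> = h x" using conv_haar(2)[OF h] h' by simp
    finally show "h' x = h x" .
  qed
qed

end

section \<open>States living on the circle\<close>

context csuq2
begin

text \<open>Integer powers of \<open>\<alpha>\<close> as if it were unitary, which it becomes on the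
  circle, where \<open>\<alpha>pow k\<close> is the function \<open>w powi k\<close>.\<close>

definition \<alpha>pow :: "int \<Rightarrow> 'a"
  where "\<alpha>pow k = (if k \<ge> 0 then \<alpha> ^ nat k else star \<alpha> ^ nat (- k))"

lemma \<alpha>pow_0 [simp]: "\<alpha>pow 0 = 1"
  by (simp add: \<alpha>pow_def)

lemma star_\<alpha>pow: "star (\<alpha>pow k) = \<alpha>pow (- k)"
  by (simp add: \<alpha>pow_def star_power star_star)

text \<open>The exponent of \<open>w\<close> in the image of \<open>U I I\<close> on the
  circle.\<close>

definition weight :: "bool list \<Rightarrow> int"
  where "weight I = int (count_list I False) - int (count_list I True)"

lemma \<alpha>pow_eq_U:
  obtains I where "\<alpha>pow k = U I I" "weight I = k"
proof -
  have "U (replicate n i) (replicate n i) = u i i ^ n" for n i by (induction n) simp_all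
  moreover have "count_list (replicate n i) j = (if i = j then n else 0)" for n and i j :: bool
    by (induction n) auto
  ultimately have "\<alpha>pow k = U (replicate (nat \<bar>k\<bar>) (k < 0)) (replicate (nat \<bar>k\<bar>) (k < 0))"
    "weight (replicate (nat \<bar>k\<bar>) (k < 0)) = k"
    by (auto simp: \<alpha>pow_def u_def weight_def)
  thus ?thesis using that by blast
qed

end

context csuq2_tensor
begin

context
  fixes \<phi> assumes st: "state \<phi>" and vanish: "\<phi> (star \<gamma> * \<gamma>) = 0"
begin

text \<open>\<open>\<gamma>\<close> and \<open>star \<gamma>\<close> commute with every entry of
  \<open>u\<close> up to a scalar, so they can be moved to the right end, where they lie in the left
  kernel.\<close>

lemma gamma_U_zero:
  "length I = length J \<Longrightarrow> \<phi> (x * \<gamma> * U I J) = 0 \<and> \<phi> (x * star \<gamma> * U I J) = 0"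
proof (induction I J arbitrary: x rule: list_induct2)
  case Nil
  show ?case using null_gamma[OF st vanish] by simp
next
  case (Cons i I j J)
  note lin = state_linear[OF st]
  have "\<exists>r. \<gamma> * u i j = r *\<^sub>R (u i j * \<gamma>)"
  proof (cases i; cases j)
    assume "\<not> i" "\<not> j"
    thus ?thesis using q_nonzero by (intro exI[of _ "1 / q"]) (simp add: u_def normal_order)
  qed (auto simp: u_def normal_order intro: exI[of _ 1] exI[of _ q])
  then obtain r where r: "\<gamma> * u i j = r *\<^sub>R (u i j * \<gamma>)" by blast
  have "\<exists>r. star \<gamma> * u i j = r *\<^sub>R (u i j * star \<gamma>)"
  proof (cases i; cases j)
    assume "\<not> i" "\<not> j"
    thus ?thesis using q_nonzero by (intro exI[of _ "1 / q"]) (simp add: u_def normal_order)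
  qed (auto simp: u_def normal_order intro: exI[of _ 1] exI[of _ q])
  then obtain r' where r': "star \<gamma> * u i j = r' *\<^sub>R (u i j * star \<gamma>)" by blast
  have "x * \<gamma> * U (i # I) (j # J) = x * (\<gamma> * u i j) * U I J" by (simp add: mult.assoc)
  also have "\<dots> = r *\<^sub>R (x * u i j * \<gamma> * U I J)" unfolding r by (simp add: mult.assoc)
  finally have 1: "x * \<gamma> * U (i # I) (j # J) = r *\<^sub>R (x * u i j * \<gamma> * U I J)" .
  have "x * star \<gamma> * U (i # I) (j # J) = x * (star \<gamma> * u i j) * U I J" by (simp add: mult.assoc)
  also have "\<dots> = r' *\<^sub>R (x * u i j * star \<gamma> * U I J)" unfolding r' by (simp add: mult.assoc)
  finally have 2: "x * star \<gamma> * U (i # I) (j # J) = r' *\<^sub>R (x * u i j * star \<gamma> * U I J)" .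
  show ?case unfolding 1 2 using Cons.IH[of "x * u i j"] by (simp add: lin)
qed

lemma circle_U_offdiag:
  "length I = length J \<Longrightarrow> I \<noteq> J \<Longrightarrow> \<phi> (x * U I J) = 0"
proof (induction I J arbitrary: x rule: list_induct2)
  case (Cons i I j J)
  note lin = state_linear[OF st]
  show ?case
  proof (cases "i = j")
    case True
    thus ?thesis using Cons.IH[of "x * u i j"] Cons.prems by (simp add: mult.assoc)
  next
    case False
    have "\<phi> (x * \<gamma> * U I J) = 0" "\<phi> (x * star \<gamma> * U I J) = 0"
      using gamma_U_zero[OF Cons.hyps, of x] by simp_all
    thus ?thesis using False by (cases i) (simp_all add: u_def mult.assoc lin)
  qed
qed simp

text \<open>Both products of \<open>\<alpha>\<close> with \<open>star \<alpha>\<close> differ from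
  \<open>1\<close> by a multiple of \<open>star \<gamma> * \<gamma>\<close>, which
  \<open>\<phi>\<close> ignores, so a word in the two letters collapses to a single power. The
  prefix \<open>x\<close> absorbs letters during the induction.\<close>

lemma circle_U_diag: "\<phi> (x * U I I) = \<phi> (x * \<alpha>pow (weight I))"
proof (induction I arbitrary: x)
  case Nil
  show ?case by (simp add: weight_def)
next
  case (Cons i I)
  note lin = state_linear[OF st]
  have \<gamma>\<gamma>: "\<phi> (x * (star \<gamma> * \<gamma>) * \<alpha>pow k) = 0" for k
  proof -
    obtain J where "\<alpha>pow k = U J J" using \<alpha>pow_eq_U by blast
    thus ?thesis using gamma_U_zero[of J J "x * star \<gamma>"] by (simp add: mult.assoc)
  qed
  have \<alpha>: "\<phi> (x * \<alpha> * \<alpha>pow k) = \<phi> (x * \<alpha>pow (k + 1))" for k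
  proof (cases "k \<ge> 0")
    case True
    hence "nat (k + 1) = Suc (nat k)" by simp
    thus ?thesis using True by (simp add: \<alpha>pow_def mult.assoc)
  next
    case False
    hence "nat (- k) = Suc (nat (- (k + 1)))" by simp
    hence k: "\<alpha>pow k = star \<alpha> * \<alpha>pow (k + 1)" using False by (simp add: \<alpha>pow_def)
    have "x * \<alpha> * \<alpha>pow k = x * (\<alpha> * star \<alpha>) * \<alpha>pow (k + 1)" unfolding k by (simp add: mult.assoc)
    also have "\<dots> = x * \<alpha>pow (k + 1) - q\<^sup>2 *\<^sub>R (x * (star \<gamma> * \<gamma>) * \<alpha>pow (k + 1))"
      unfolding normal_order by (simp add: right_diff_distrib left_diff_distrib)
    finally show ?thesis by (simp only: lin \<gamma>\<gamma>) simp
  qed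
  have \<alpha>': "\<phi> (x * star \<alpha> * \<alpha>pow k) = \<phi> (x * \<alpha>pow (k - 1))" for k
  proof (cases "k \<le> 0")
    case True
    hence "nat (- (k - 1)) = Suc (nat (- k))" by simp
    hence "\<alpha>pow (k - 1) = star \<alpha> * \<alpha>pow k" using True by (auto simp: \<alpha>pow_def)
    thus ?thesis by (simp add: mult.assoc)
  next
    case False
    hence "nat k = Suc (nat (k - 1))" by simp
    hence k: "\<alpha>pow k = \<alpha> * \<alpha>pow (k - 1)" using False by (simp add: \<alpha>pow_def)
    have "x * star \<alpha> * \<alpha>pow k = x * (star \<alpha> * \<alpha>) * \<alpha>pow (k - 1)" unfolding k by (simp add: mult.assoc)
    also have "\<dots> = x * \<alpha>pow (k - 1) - x * (star \<gamma> * \<gamma>) * \<alpha>pow (k - 1)"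
      unfolding normal_order by (simp add: right_diff_distrib left_diff_distrib)
    finally show ?thesis by (simp only: lin \<gamma>\<gamma>) simp
  qed
  have "\<phi> (x * U (i # I) (i # I)) = \<phi> (x * u i i * \<alpha>pow (weight I))"
    using Cons.IH[of "x * u i i"] by (simp add: mult.assoc)
  also have "\<dots> = \<phi> (x * \<alpha>pow (weight (i # I)))"
  proof -
    have "weight (i # I) = (if i then weight I - 1 else weight I + 1)" by (simp add: weight_def)
    thus ?thesis by (cases i) (simp_all add: u_def \<alpha> \<alpha>')
  qed
  finally show ?case .
qed

lemma circle_U: "length I = length J \<Longrightarrow> \<phi> (U I J) = (if I = J then \<phi> (\<alpha>pow (weight I)) else 0)"
  using circle_U_offdiag[of I J 1] circle_U_diag[of 1 I] by (cases "I = J") simp_all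

lemma circle_\<alpha>pow_mult: "\<phi> (\<alpha>pow k * \<alpha>pow l) = \<phi> (\<alpha>pow (k + l))"
proof -
  obtain I where I: "\<alpha>pow k = U I I" "weight I = k" by (rule \<alpha>pow_eq_U)
  obtain J where J: "\<alpha>pow l = U J J" "weight J = l" by (rule \<alpha>pow_eq_U)
  have "\<alpha>pow k * \<alpha>pow l = U (I @ J) (I @ J)" by (simp add: I J U_append)
  moreover have "weight (I @ J) = k + l" using I J by (simp add: weight_def)
  ultimately show ?thesis using circle_U_diag[of 1 "I @ J"] by simp
qed

text \<open>All matrices \<open>\<phi>(U)\<close> are diagonal, so idempotence is a condition on
  each diagonal entry separately.\<close>

lemma circle_idempotent_iff: "idempotent_state tens \<Delta> \<phi> \<longleftrightarrow> (\<forall>k. \<phi> (\<alpha>pow k) \<in> {0, 1})"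
proof -
  have sum: "(\<Sum>K\<in>bitlists n. \<phi> (U I K) * \<phi> (U K J)) = (if I = J then (\<phi> (\<alpha>pow (weight I)))\<^sup>2 else 0)"
    if "length I = n" "length J = n" for I J n
  proof -
    have "(\<Sum>K\<in>bitlists n. \<phi> (U I K) * \<phi> (U K J)) =
        (\<Sum>K\<in>bitlists n. if K = I then \<phi> (\<alpha>pow (weight I)) * \<phi> (U I J) else 0)"
      by (rule sum.cong) (use that in \<open>auto simp: circle_U\<close>)
    thus ?thesis using that by (simp add: circle_U power2_eq_square)
  qed
  have sq: "z\<^sup>2 = z \<longleftrightarrow> z \<in> {0, 1}" for z :: complex
    by (auto simp: power2_eq_square)
  show ?thesis
  proof
    assume *: "idempotent_state tens \<Delta> \<phi>"
    show "\<forall>k. \<phi> (\<alpha>pow k) \<in> {0, 1}"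
    proof
      fix k
      obtain I where I: "\<alpha>pow k = U I I" "weight I = k" by (rule \<alpha>pow_eq_U)
      have "(\<phi> (\<alpha>pow k))\<^sup>2 = \<phi> (\<alpha>pow k)"
        using idem_U[OF *, of I "length I" I] sum[of I "length I" I] I by simp
      thus "\<phi> (\<alpha>pow k) \<in> {0, 1}" unfolding sq .
    qed
  next
    assume "\<forall>k. \<phi> (\<alpha>pow k) \<in> {0, 1}"
    hence *: "(\<phi> (\<alpha>pow k))\<^sup>2 = \<phi> (\<alpha>pow k)" for k using sq by blast
    show "idempotent_state tens \<Delta> \<phi>"
      unfolding idempotent_state_U_iff[OF st]
    proof (intro allI ballI)
      fix n and I J :: "bool list" assume "I \<in> bitlists n" "J \<in> bitlists n"
      thus "(\<Sum>K\<in>bitlists n. \<phi> (U I K) * \<phi> (U K J)) = \<phi> (U I J)"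
        using sum[of I n J] circle_U[of I J] * by simp
    qed
  qed
qed

text \<open>A unitary whose expectation is \<open>1\<close> acts as the identity on the GNS vector:
  \<open>\<alpha>pow k - 1\<close> lies in the left kernel.\<close>

lemma circle_period:
  assumes "\<phi> (\<alpha>pow k) = 1"
  shows "\<phi> (\<alpha>pow (l + k)) = \<phi> (\<alpha>pow l)"
proof -
  note lin = state_linear[OF st] and pos = state_pos_fun[OF st]
  have "\<phi> (\<alpha>pow (- k)) = 1" using pos_fun_star[OF pos, of "\<alpha>pow k"] assms by (simp add: star_\<alpha>pow)
  hence "null \<phi> (\<alpha>pow k - 1)"
    using circle_\<alpha>pow_mult[of "- k" k] assms
    by (simp add: star_diff star_\<alpha>pow left_diff_distrib right_diff_distrib lin state_one[OF st])
  hence "\<phi> (\<alpha>pow l * (\<alpha>pow k - 1)) = 0" by (rule null_mult[OF pos])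
  thus ?thesis using circle_\<alpha>pow_mult[of l k] by (simp add: right_diff_distrib lin)
qed

end

lemma circle_eqI:
  assumes "state \<phi>" "\<phi> (star \<gamma> * \<gamma>) = 0" "state \<psi>" "\<psi> (star \<gamma> * \<gamma>) = 0"
    and "\<And>k. \<phi> (\<alpha>pow k) = \<psi> (\<alpha>pow k)"
  shows "\<phi> = \<psi>"
  by (rule U_eqI) (simp_all add: state_bcl assms circle_U)

end

section \<open>Evaluation at points of the circle\<close>

context csuq2
begin

definition eval_at :: "complex \<Rightarrow> 'a \<Rightarrow> complex"
  where "eval_at w = (THE e. star_hom e \<and> e \<alpha> = w \<and> e \<gamma> = 0)"

lemma eval_at:
  assumes "cmod w = 1"
  shows "star_hom (eval_at w)" "eval_at w \<alpha> = w" "eval_at w \<gamma> = 0"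
proof -
  obtain e where e: "star_hom e" "e \<alpha> = w" "e \<gamma> = (0::complex)" using star_hom_character[OF assms] .
  have "star_hom (eval_at w) \<and> eval_at w \<alpha> = w \<and> eval_at w \<gamma> = 0"
    unfolding eval_at_def
  proof (rule theI[where a = e])
    fix e' :: "'a \<Rightarrow> complex" assume "star_hom e' \<and> e' \<alpha> = w \<and> e' \<gamma> = 0"
    thus "e' = e" using e by (intro star_hom_eqI) auto
  qed (use e in blast)
  thus "star_hom (eval_at w)" "eval_at w \<alpha> = w" "eval_at w \<gamma> = 0" by auto
qed

lemma eval_at_state:
  assumes "cmod w = 1"
  shows "state (eval_at w)"
  using state_complex_id star_hom_simps[OF eval_at(1)[OF assms]] by (simp add: state_def)

lemma eval_at_\<alpha>pow:
  assumes "cmod w = 1"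
  shows "eval_at w (\<alpha>pow k) = w powi k"
proof -
  have pow: "eval_at w (x ^ n) = eval_at w x ^ n" for x n
    by (induction n) (simp_all add: star_hom_simps[OF eval_at(1)[OF assms]])
  have "w * cnj w = 1" using assms by (simp add: complex_norm_square[symmetric])
  hence "cnj w = inverse w" by (metis inverse_unique)
  thus ?thesis
    by (simp add: \<alpha>pow_def pow star_hom_simps[OF eval_at(1)[OF assms]] eval_at[OF assms] power_int_def)
qed

text \<open>Each evaluation is a state and therefore contractive, so approximating \<open>x\<close>
  in norm by polynomials approximates the function uniformly in \<open>w\<close> by continuous
  ones.\<close>

lemma continuous_eval_at: "continuous_on (sphere 0 1) (\<lambda>w. eval_at w x)"
proof -
  have ev: "continuous_on (sphere 0 1) (\<lambda>w. eval_at w (ev z))" for z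
  proof -
    have letter: "continuous_on (sphere 0 1) (\<lambda>w. eval_letter w (0::complex) l)" for l
      by (cases l) (auto intro!: continuous_intros)
    have word: "continuous_on (sphere 0 1) (\<lambda>w. prod_list (map (eval_letter w (0::complex)) ls))" for ls
      by (induction ls) (auto intro!: continuous_intros letter)
    have "continuous_on (sphere 0 1) (\<lambda>w. eval_free w (0::complex) z)"
      unfolding eval_free_def complex_scaleC by (intro continuous_intros word)
    thus ?thesis
      by (rule continuous_on_eq) (simp add: star_hom_eval_free[OF eval_at(1)] eval_at)
  qed
  obtain s where s: "(\<lambda>n. ev (s n)) \<longlonglongrightarrow> x" using dense_sequence[OF dense_ev] .
  have "uniform_limit (sphere 0 1) (\<lambda>n w. eval_at w (ev (s n))) (\<lambda>w. eval_at w x) sequentially"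
  proof (rule uniform_limitI)
    fix e :: real assume "e > 0"
    with s have "\<forall>\<^sub>F n in sequentially. dist (ev (s n)) x < e" by (rule tendstoD)
    thus "\<forall>\<^sub>F n in sequentially. \<forall>w\<in>sphere 0 1. dist (eval_at w (ev (s n))) (eval_at w x) < e"
    proof (rule eventually_mono, intro ballI)
      fix n w assume n: "dist (ev (s n)) x < e" and w: "w \<in> sphere (0::complex) 1"
      hence st: "state (eval_at w)" by (simp add: eval_at_state)
      have "dist (eval_at w (ev (s n))) (eval_at w x) = cmod (eval_at w (ev (s n) - x))"
        by (simp add: dist_norm state_linear[OF st])
      also have "\<dots> \<le> dist (ev (s n)) x" unfolding dist_norm by (rule state_bound[OF st])
      finally show "dist (eval_at w (ev (s n))) (eval_at w x) < e" using n by linarith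
    qed
  qed
  thus ?thesis by (rule uniform_limit_theorem[rotated]) (simp_all add: ev)
qed

lemma circle_map_eq: "circle_map \<alpha> \<gamma> = (\<lambda>x w. if cmod w = 1 then eval_at w x else 0)"
  unfolding circle_map_def
proof (rule the_equality)
  let ?j = "\<lambda>x w. if cmod w = 1 then eval_at w x else 0"
  show "(\<forall>x. continuous_on (sphere 0 1) (?j x) \<and> (\<forall>w. w \<notin> sphere 0 1 \<longrightarrow> ?j x w = 0)) \<and>
    (\<forall>w\<in>sphere 0 1. star_hom (\<lambda>x. ?j x w) \<and> ?j \<alpha> w = w \<and> ?j \<gamma> w = 0)"
  proof (intro conjI allI)
    show "continuous_on (sphere 0 1) (?j x)" for x
      by (rule continuous_on_eq[OF continuous_eval_at[of x]]) simp
    show "\<forall>w\<in>sphere 0 1. star_hom (\<lambda>x. ?j x w) \<and> ?j \<alpha> w = w \<and> ?j \<gamma> w = 0"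
      by (simp add: eval_at)
  qed simp
  fix j :: "'a \<Rightarrow> complex \<Rightarrow> complex"
  assume j: "(\<forall>x. continuous_on (sphere 0 1) (j x) \<and> (\<forall>w. w \<notin> sphere 0 1 \<longrightarrow> j x w = 0)) \<and>
    (\<forall>w\<in>sphere 0 1. star_hom (\<lambda>x. j x w) \<and> j \<alpha> w = w \<and> j \<gamma> w = 0)"
  show "j = ?j"
  proof (intro ext)
    fix x w
    show "j x w = ?j x w"
    proof (cases "cmod w = 1")
      case True
      have "(\<lambda>x. j x w) = eval_at w"
        by (rule star_hom_eqI) (use j True in \<open>auto simp: eval_at\<close>)
      thus ?thesis using True by (simp add: fun_eq_iff)
    qed (use j in auto)
  qed
qed

lemma counit_eq: "counit \<alpha> \<gamma> = eval_at 1"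
  by (simp add: counit_def eval_at_def)

lemma eval_at_gamma: "cmod w = 1 \<Longrightarrow> eval_at w (star \<gamma> * \<gamma>) = 0"
  by (simp add: star_hom_simps[OF eval_at(1)] eval_at)

lemma circle_state_eq:
  "circle_state \<alpha> \<gamma> x = integral {0..2 * pi} (\<lambda>t. eval_at (cis t) x) / of_real (2 * pi)"
  by (simp add: circle_state_def circle_map_eq)

lemma cyclic_state_eq:
  assumes "n \<ge> 1"
  shows "cyclic_state \<alpha> \<gamma> n x = (\<Sum>w | w ^ n = 1. eval_at w x) / of_nat n"
proof -
  have "cmod w = 1" if "w ^ n = 1" for w
    using power_eq_1_iff[OF that] assms by auto
  thus ?thesis by (simp add: cyclic_state_def circle_map_eq)
qed

end

section \<open>Classification\<close>

lemma integral_cis_of_int: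
  "integral {0..2 * pi} (\<lambda>t. cis (of_int k * t)) = (if k = 0 then of_real (2 * pi) else 0)"
proof (cases "k = 0")
  case True
  thus ?thesis by (simp add: scaleR_conv_of_real)
next
  case False
  define F where "F z = exp (\<i> * of_int k * z) / (\<i> * of_int k)" for z :: complex
  have "(F has_field_derivative exp (\<i> * of_int k * z)) (at z within A)" for z A
    unfolding F_def using False by (auto intro!: derivative_eq_intros)
  hence "((\<lambda>t. F (of_real t)) has_vector_derivative exp (\<i> * of_int k * of_real t)) (at t within {0..2 * pi})" for t
    by (intro has_vector_derivative_real_field)
  hence "((\<lambda>t. exp (\<i> * of_int k * of_real t)) has_integral (F (of_real (2 * pi)) - F (of_real 0))) {0..2 * pi}"
    by (intro fundamental_theorem_of_calculus) auto
  moreover have cis: "exp (\<i> * of_int k * of_real t) = cis (of_int k * t)" for t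
    by (simp add: cis_conv_exp mult.assoc)
  have "F (of_real (2 * pi)) = F (of_real 0)"
    unfolding F_def cis using cis_multiple_2pi[of "of_int k"] by (simp add: mult_ac)
  ultimately show ?thesis using False by (simp add: cis integral_unique)
qed

text \<open>Multiplication by the primitive root \<open>\<zeta>\<close> permutes the roots of unity
  and multiplies the sum by \<open>\<zeta> powi k\<close>, which differs from \<open>1\<close>
  unless \<open>n\<close> divides \<open>k\<close>.\<close>

lemma sum_powi_roots_unity:
  assumes n: "n \<ge> 1"
  shows "(\<Sum>w | w ^ n = 1. (w::complex) powi k) = (if int n dvd k then of_nat n else 0)"
proof (cases "int n dvd k")
  case True
  then obtain m where m: "k = int n * m" by auto
  have "w powi k = 1" if "w ^ n = 1" for w :: complex
    using that by (simp add: m power_int_mult)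
  thus ?thesis using True n by (simp add: card_roots_unity_eq)
next
  case False
  define \<zeta> where "\<zeta> = cis (2 * pi / n)"
  have \<zeta>n: "\<zeta> ^ n = 1" using n by (simp add: \<zeta>_def Complex.DeMoivre)
  have "\<zeta> powi k \<noteq> 1"
  proof
    assume "\<zeta> powi k = 1"
    hence "cos (of_int k * (2 * pi / n)) = 1"
      unfolding \<zeta>_def cis_power_int by (metis cis.sel(1) one_complex.sel(1))
    then obtain m :: int where "of_int k * (2 * pi / n) = of_int m * 2 * pi" unfolding cos_one_2pi_int by blast
    hence "real_of_int k = of_int (int n * m)" using n by (simp add: field_simps)
    hence "k = int n * m" by linarith
    thus False using False by simp
  qed
  moreover have "(\<Sum>w | w ^ n = 1. (\<zeta> * w) powi k) = (\<Sum>w | w ^ n = 1. w powi k)"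
    by (rule sum.reindex_bij_witness[where i = "\<lambda>w. w / \<zeta>" and j = "\<lambda>w. \<zeta> * w"])
       (use \<zeta>n in \<open>auto simp: power_mult_distrib power_divide \<zeta>_def\<close>)
  hence "\<zeta> powi k * (\<Sum>w | w ^ n = 1. w powi k) = (\<Sum>w | w ^ n = 1. w powi k)"
    by (simp add: power_int_mult_distrib sum_distrib_left)
  ultimately show ?thesis using False by simp
qed

context csuq2
begin

lemma continuous_eval_at_cis: "continuous_on {0..2 * pi} (\<lambda>t. eval_at (cis t) x)"
  by (rule continuous_on_compose2[OF continuous_eval_at]) (auto intro!: continuous_intros)

lemma circle_state:
  shows "state (circle_state \<alpha> \<gamma>)" "circle_state \<alpha> \<gamma> (star \<gamma> * \<gamma>) = 0"
    "circle_state \<alpha> \<gamma> (\<alpha>pow k) = (if k = 0 then 1 else 0)"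
proof -
  note int = integrable_continuous_interval[OF continuous_eval_at_cis]
  note st = eval_at_state[OF norm_cis] and lin = state_linear[OF eval_at_state[OF norm_cis]]
  have pi: "complex_of_real (2 * pi) \<noteq> 0" by simp
  show "state (circle_state \<alpha> \<gamma>)" unfolding state_def
  proof (intro conjI allI bounded_clinearI[where K = 1])
    fix x y c
    show "circle_state \<alpha> \<gamma> (x + y) = circle_state \<alpha> \<gamma> x + circle_state \<alpha> \<gamma> y"
      unfolding circle_state_eq lin by (simp add: integral_add int add_divide_distrib)
    show "circle_state \<alpha> \<gamma> (c *\<^sub>C x) = c *\<^sub>C circle_state \<alpha> \<gamma> x"
      unfolding circle_state_eq lin by simp
    have "cmod (integral {0..2 * pi} (\<lambda>t. eval_at (cis t) x)) \<le> norm x * (2 * pi - 0)"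
      by (rule integral_bound) (simp_all add: continuous_eval_at_cis state_bound[OF st])
    thus "norm (circle_state \<alpha> \<gamma> x) \<le> 1 * norm x"
      unfolding circle_state_eq by (simp add: norm_divide field_simps)
    let ?f = "\<lambda>t. eval_at (cis t) (star x * x)"
    have f: "Re (?f t) \<ge> 0" "Im (?f t) = 0" for t
      using pos_fun_real[OF state_pos_fun[OF st]] by auto
    have "Re (integral {0..2 * pi} ?f) = integral {0..2 * pi} (Re \<circ> ?f)"
      "Im (integral {0..2 * pi} ?f) = integral {0..2 * pi} (Im \<circ> ?f)"
      by (rule integral_linear[OF int, symmetric], rule bounded_linear_Re bounded_linear_Im)+
    moreover have "integral {0..2 * pi} (Re \<circ> ?f) \<ge> 0"
      by (rule integral_nonneg[OF integrable_linear[OF int bounded_linear_Re]]) (simp add: f)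
    ultimately have "integral {0..2 * pi} ?f \<in> \<real>\<^sub>\<ge>\<^sub>0"
      by (simp add: complex_nonneg_Reals_iff f o_def)
    thus "circle_state \<alpha> \<gamma> (star x * x) \<in> \<real>\<^sub>\<ge>\<^sub>0"
      unfolding circle_state_eq by (rule nonneg_Reals_divide_I) (simp add: nonneg_Reals_of_real_iff del: of_real_mult)
    show "circle_state \<alpha> \<gamma> 1 = 1"
      unfolding circle_state_eq by (simp add: state_one[OF st] scaleR_conv_of_real)
  qed
  show "circle_state \<alpha> \<gamma> (star \<gamma> * \<gamma>) = 0"
    unfolding circle_state_eq by (simp add: eval_at_gamma)
  show "circle_state \<alpha> \<gamma> (\<alpha>pow k) = (if k = 0 then 1 else 0)"
    unfolding circle_state_eq by (simp add: eval_at_\<alpha>pow cis_power_int integral_cis_of_int del: of_real_mult)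
qed

lemma cyclic_state:
  assumes "n \<ge> 1"
  shows "state (cyclic_state \<alpha> \<gamma> n)" "cyclic_state \<alpha> \<gamma> n (star \<gamma> * \<gamma>) = 0"
    "cyclic_state \<alpha> \<gamma> n (\<alpha>pow k) = (if int n dvd k then 1 else 0)"
proof -
  have unit: "cmod w = 1" if "w ^ n = 1" for w :: complex
    using power_eq_1_iff[OF that] assms by auto
  have "state (\<lambda>x. (\<Sum>w\<in>{w. w ^ n = 1}. eval_at w x) / of_nat (card {w::complex. w ^ n = 1}))"
  proof (rule state_average)
    show "finite {w::complex. w ^ n = 1}" using finite_roots_unity[OF assms] by simp
    show "{w::complex. w ^ n = 1} \<noteq> {}" by (auto intro: exI[of _ 1])
  qed (simp add: eval_at_state unit)
  thus "state (cyclic_state \<alpha> \<gamma> n)"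
    using assms by (simp add: cyclic_state_eq[OF assms, abs_def] card_roots_unity_eq)
  show "cyclic_state \<alpha> \<gamma> n (star \<gamma> * \<gamma>) = 0"
    unfolding cyclic_state_eq[OF assms] by (simp add: eval_at_gamma unit)
  have "(\<Sum>w | w ^ n = 1. eval_at w (\<alpha>pow k)) = (\<Sum>w | w ^ n = 1. w powi k)"
    by (rule sum.cong) (simp_all add: eval_at_\<alpha>pow unit)
  thus "cyclic_state \<alpha> \<gamma> n (\<alpha>pow k) = (if int n dvd k then 1 else 0)"
    unfolding cyclic_state_eq[OF assms] using assms by (simp add: sum_powi_roots_unity)
qed

lemma counit:
  shows "state (counit \<alpha> \<gamma>)" "counit \<alpha> \<gamma> (star \<gamma> * \<gamma>) = 0" "counit \<alpha> \<gamma> (\<alpha>pow k) = 1"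
  unfolding counit_eq by (simp_all add: eval_at_state eval_at_gamma eval_at_\<alpha>pow)

end

context csuq2_tensor
begin

lemma idempotent_circle_cases:
  assumes idem: "idempotent_state tens \<Delta> \<phi>" and z: "\<phi> (star \<gamma> * \<gamma>) = 0"
  shows "\<phi> = counit \<alpha> \<gamma> \<or> \<phi> = circle_state \<alpha> \<gamma> \<or> (\<exists>n\<ge>2. \<phi> = cyclic_state \<alpha> \<gamma> n)"
proof -
  note st = idem_state[OF idem]
  \<comment> \<open>\<open>S\<close> is a subgroup of the integers, the annihilator of the subgroup
    of the circle that carries \<open>\<phi>\<close>; \<open>period\<close>, \<open>neg\<close> and
    \<open>S0\<close> are the subgroup properties.\<close>
  define S where "S k \<longleftrightarrow> \<phi> (\<alpha>pow k) = 1" for k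
  have val: "\<phi> (\<alpha>pow k) = (if S k then 1 else 0)" for k
  proof -
    have "\<phi> (\<alpha>pow k) \<in> {0, 1}" using circle_idempotent_iff[OF st z] idem by blast
    thus ?thesis by (auto simp: S_def)
  qed
  have period: "S (l + k) \<longleftrightarrow> S l" if "S k" for k l
    using circle_period[OF st z, of k l] that by (simp add: S_def)
  have neg: "S (- k) \<longleftrightarrow> S k" for k
    using pos_fun_star[OF state_pos_fun[OF st], of "\<alpha>pow k"]
    unfolding S_def star_\<alpha>pow by (simp only: complex_cnj_one_iff)
  have S0: "S 0" by (simp add: S_def state_one[OF st])
  show ?thesis
  proof (cases "\<exists>n::nat. n \<ge> 1 \<and> S (int n)")
    case False
    have "S k \<longleftrightarrow> k = 0" for k
    proof
      assume "S k"
      hence "S (int (nat \<bar>k\<bar>))" using neg[of k] by (cases "k \<ge> 0") auto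
      hence "\<not> nat \<bar>k\<bar> \<ge> 1" using False by blast
      thus "k = 0" by simp
    qed (use S0 in simp)
    hence "\<phi> = circle_state \<alpha> \<gamma>"
      by (intro circle_eqI st z circle_state) (simp add: val circle_state)
    thus ?thesis by blast
  next
    case True
    \<comment> \<open>The least positive element generates \<open>S\<close>, by division with
      remainder.\<close>
    define n where "n = (LEAST n. n \<ge> 1 \<and> S (int n))"
    have n: "n \<ge> 1" "S (int n)" using LeastI_ex[OF True] by (auto simp: n_def)
    have least: "\<not> S (int m)" if "m \<ge> 1" "m < n" for m
      using not_less_Least[of m "\<lambda>n. n \<ge> 1 \<and> S (int n)"] that by (auto simp: n_def)
    have mult: "S (l + int n * int m) \<longleftrightarrow> S l" for l m
    proof (induction m)
      case (Suc m)
      thus ?case using period[OF n(2), of "l + int n * int m"] by (simp add: algebra_simps)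
    qed simp
    have "S k \<longleftrightarrow> S (k mod int n)" for k
    proof (cases "k div int n \<ge> 0")
      case True
      thus ?thesis using mult[of "k mod int n" "nat (k div int n)"] by simp
    next
      case False
      \<comment> \<open>\<open>mult\<close> adds only nonnegative multiples of \<open>n\<close>, so
        for a negative quotient the shift starts at \<open>k\<close> and ends at the
        remainder.\<close>
      thus ?thesis using mult[of k "nat (- (k div int n))"] by (simp add: minus_mult_div_eq_mod[symmetric])
    qed
    moreover have "S (k mod int n) \<longleftrightarrow> int n dvd k" for k
    proof -
      have "k mod int n \<ge> 0" "k mod int n < int n" using n by auto
      thus ?thesis using least[of "nat (k mod int n)"] S0
        by (cases "k mod int n = 0") (auto simp: dvd_eq_mod_eq_0 nat_less_iff)
    qed
    ultimately have S: "S k \<longleftrightarrow> int n dvd k" for k by blast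
    show ?thesis
    \<comment> \<open>The counit is the case of the trivial subgroup, which the list of cyclic
      states from \<open>2\<close> on leaves out.\<close>
    proof (cases "n = 1")
      case True
      hence "\<phi> = counit \<alpha> \<gamma>" by (intro circle_eqI st z counit) (simp add: val S counit)
      thus ?thesis by blast
    next
      case False
      have "\<phi> = cyclic_state \<alpha> \<gamma> n"
        by (intro circle_eqI st z cyclic_state n) (simp add: val S cyclic_state(3)[OF n(1)])
      moreover have "n \<ge> 2" using False n by simp
      ultimately show ?thesis by blast
    qed
  qed
qed

lemma idempotent_states:
  "{\<phi>. idempotent_state tens \<Delta> \<phi>} =
    {haar_state tens \<Delta>, counit \<alpha> \<gamma>, circle_state \<alpha> \<gamma>} \<union> {cyclic_state \<alpha> \<gamma> n | n. 2 \<le> n}"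
proof -
  obtain h where h: "idempotent_state tens \<Delta> h" "h (star \<gamma> * \<gamma>) \<noteq> 0"
    using haar_idempotent_exists .
  have haar: "haar_state tens \<Delta> = h" by (rule haar_state_eqI[OF h])
  have "idempotent_state tens \<Delta> (counit \<alpha> \<gamma>)" "idempotent_state tens \<Delta> (circle_state \<alpha> \<gamma>)"
    by (simp_all add: circle_idempotent_iff counit circle_state)
  moreover have "idempotent_state tens \<Delta> (cyclic_state \<alpha> \<gamma> n)" if "2 \<le> n" for n
    using that by (simp add: circle_idempotent_iff cyclic_state)
  moreover have "\<phi> = h \<or> \<phi> = counit \<alpha> \<gamma> \<or> \<phi> = circle_state \<alpha> \<gamma> \<or> (\<exists>n\<ge>2. \<phi> = cyclic_state \<alpha> \<gamma> n)"
    if "idempotent_state tens \<Delta> \<phi>" for \<phi>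
    using idempotent_circle_cases[OF that] idempotent_state_unique[OF that _ h] by blast
  ultimately show ?thesis unfolding haar using h(1) by blast
qed

end

theorem theorem5p1:
  fixes q :: real
    and \<alpha> \<gamma> :: "'a::cstar_algebra"
    and tens :: "'a \<Rightarrow> 'a \<Rightarrow> 'b::cstar_algebra"
  assumes "q \<in> {-1<..<0} \<union> {0<..<1}"
    and "is_CSUq2 q \<alpha> \<gamma>"
    and "is_spatial_tensor tens"
  shows "{\<phi>. idempotent_state tens (comult q tens \<alpha> \<gamma>) \<phi>} =
    {haar_state tens (comult q tens \<alpha> \<gamma>), counit \<alpha> \<gamma>, circle_state \<alpha> \<gamma>} \<union>
    {cyclic_state \<alpha> \<gamma> n | n. 2 \<le> n}"
proof -
  interpret csuq2_tensor q \<alpha> \<gamma> tens by unfold_locales (rule assms)+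
  show ?thesis by (rule idempotent_states)
qed

end
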